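(* Let $(K,<)$ be an ordered field with a henselian valuation $v$ and a compatible angular component map $\mathrm{ac}\colon K\to Kv$, and let $\mathcal{K}=((K,<),(Kv,<),vK;\overline{\ \cdot\ },v,\mathrm{ac})$ be the associated three-sorted structure in the language $\mathcal{L}_{\mathrm{ovf}}^{\mathrm{ac}}$. Then the theory of $\mathcal{K}$ in $\mathcal{L}_{\mathrm{ovf}}^{\mathrm{ac}}$ eliminates field quantifiers. More precisely, let $\underline{x}=(x_1,\ldots,x_\ell)$, $\underline{y}=(y_1,\ldots,y_m)$, $\underline{z}=(z_1,\ldots,z_n)$ be tuples of distinct variables of field sort, residue field sort and value group sort, respectively. Then for any $\mathcal{L}_{\mathrm{ovf}}^{\mathrm{ac}}$-formula $\varphi(\underline{x},\underline{y},\underline{z})$ there are some $N\in\mathbb{N}$, special $\mathbf{r}$-formulas $\psi_1(\underline{x},\underline{y}),\ldots,\psi_N(\underline{x},\underline{y})$ and special $\mathbf{v}$-formulas $\theta_1(\underline{x},\underline{z}),\ldots,\theta_N(\underline{x},\underline{z})$ such that $\varphi(\underline{x},\underline{y},\underline{z})$ is equivalent over $\mathcal{K}$ to $$(\psi_1(\underline{x},\underline{y})\wedge\theta_1(\underline{x},\underline{z}))\vee\ldots\vee(\psi_N(\underline{x},\underline{y})\wedge\theta_N(\underline{x},\underline{z})).$$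
   Context: All orders are linear. $\mathcal{L}_{\mathrm{or}}=\{+,-,\cdot,0,1,<\}$ is the language of ordered rings and $\mathcal{L}_{\mathrm{og}}=\{+,-,0,<\}$ the language of ordered groups. For a valuation $v$ on $K$, $vK$ is the value group (written additively), $Kv$ the residue field, $\mathcal{O}_v$ the valuation ring, and $\overline{a}$ the residue of $a\in\mathcal{O}_v$. A henselian valuation $v$ on an ordered field $(K,<)$ is convex, so $Kv$ carries an induced field order $<$, for which the residue of a unit $a\in\mathcal{O}_v^\times$ is positive if and only if $a>0$; $(Kv,<)$ denotes this ordered field. An angular component map is a map $\mathrm{ac}\colon K\to Kv$ with $\mathrm{ac}(0)=0$ which restricts to a group homomorphism $K^\times\to (Kv)^\times$ and satisfies $\mathrm{ac}(u)=\overline{u}$ for all $u\in\mathcal{O}_v^\times$. It is compatible (with $<$) if for all $x\in K$: $x>0$ if and only if $\mathrm{ac}(x)>0$. The three-sorted language is $\mathcal{L}_{\mathrm{ovf}}^{\mathrm{ac}}=(\mathcal{L}_{\mathrm{or}},\mathcal{L}_{\mathrm{or}},\mathcal{L}_{\mathrm{og}};\overline{\ \cdot\ },v,\mathrm{ac})$ with sorts $\mathbf{f}$ (field), $\mathbf{r}$ (residue field), $\mathbf{v}$ (value group) and unary function symbols $\overline{\ \cdot\ }\colon\mathbf{f}\to\mathbf{r}$, $v\colon\mathbf{f}\to\mathbf{v}$, $\mathrm{ac}\colon\mathbf{f}\to\mathbf{r}$. By convention, in this structure $v(0)=0$, and $\overline{a}=0$ for $a\in K$ with $v(a)<0$. Given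 an $\mathcal{L}_{\mathrm{or}}$-formula $\psi'(u_1,\ldots,u_k,\underline{y})$ (only using free and bound $\mathbf{r}$-variables), an $\mathcal{L}_{\mathrm{og}}$-formula $\theta'(v_1,\ldots,v_k,\underline{z})$ (only using free and bound $\mathbf{v}$-variables) and polynomials $q_1(\underline{x}),\ldots,q_k(\underline{x})\in\mathbb{Z}[\underline{x}]$, the formula $\psi(\underline{x},\underline{y}):=\psi'(\mathrm{ac}(q_1(\underline{x})),\ldots,\mathrm{ac}(q_k(\underline{x})),\underline{y})$ is called a special $\mathbf{r}$-formula, and $\theta(\underline{x},\underline{z}):=\theta'(v(q_1(\underline{x})),\ldots,v(q_k(\underline{x})),\underline{z})$ is called a special $\mathbf{v}$-formula. *)

theory Defs
  imports Complex_Main "HOL-Computational_Algebra.Polynomial"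
begin

section \<open>Valuations, residue fields, angular components\<close>

text \<open>
  The fields \<open>K\<close> and \<open>Kv\<close> and the group \<open>vK\<close> are types. A valuation is a function on \<open>K\<close> of which
  only the values at nonzero arguments matter (its value at \<open>0\<close> is thought of as infinity); it
  maps the nonzero elements onto the type of its value group.
\<close>

definition valuation :: "('k::field \<Rightarrow> 'g::linordered_ab_group_add) \<Rightarrow> bool" where
  "valuation v \<longleftrightarrow>
     (\<forall>x y. x \<noteq> 0 \<longrightarrow> y \<noteq> 0 \<longrightarrow> v (x * y) = v x + v y) \<and>
     (\<forall>x y. x \<noteq> 0 \<longrightarrow> y \<noteq> 0 \<longrightarrow> x + y \<noteq> 0 \<longrightarrow> min (v x) (v y) \<le> v (x + y)) \<and>
     v ` (- {0}) = UNIV"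

definition val_ring :: "('k::field \<Rightarrow> 'g::linordered_ab_group_add) \<Rightarrow> 'k set" where
  "val_ring v = {x. x = 0 \<or> 0 \<le> v x}"

definition val_units :: "('k::field \<Rightarrow> 'g::linordered_ab_group_add) \<Rightarrow> 'k set" where
  "val_units v = {x. x \<noteq> 0 \<and> v x = 0}"

definition val_max_ideal :: "('k::field \<Rightarrow> 'g::linordered_ab_group_add) \<Rightarrow> 'k set" where
  "val_max_ideal v = {x. x = 0 \<or> 0 < v x}"

definition henselian_valuation :: "('k::field \<Rightarrow> 'g::linordered_ab_group_add) \<Rightarrow> bool" where
  "henselian_valuation v \<longleftrightarrow> valuation v \<and>
     (\<forall>f a. (\<forall>i. coeff f i \<in> val_ring v) \<longrightarrow> a \<in> val_ring v \<longrightarrow>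
        poly f a \<in> val_max_ideal v \<longrightarrow> poly (pderiv f) a \<notin> val_max_ideal v \<longrightarrow>
        (\<exists>b \<in> val_ring v. poly f b = 0 \<and> b - a \<in> val_max_ideal v))"

text \<open>
  The type \<open>'r\<close> with the map \<open>res\<close> is the residue field \<open>Kv\<close> with its residue map: \<open>res\<close> is a
  surjective ring homomorphism on the valuation ring whose kernel is the maximal ideal. Its
  values outside the valuation ring are irrelevant.
\<close>

definition residue_map ::
    "('k::field \<Rightarrow> 'g::linordered_ab_group_add) \<Rightarrow> ('k \<Rightarrow> 'r::field) \<Rightarrow> bool" where
  "residue_map v res \<longleftrightarrow>
     (\<forall>a \<in> val_ring v. \<forall>b \<in> val_ring v.
        res (a + b) = res a + res b \<and> res (a * b) = res a * res b) \<and>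
     res 1 = 1 \<and>
     (\<forall>a \<in> val_ring v. res a = 0 \<longleftrightarrow> a \<in> val_max_ideal v) \<and>
     res ` val_ring v = UNIV"

text \<open>
  The order of the type \<open>'r\<close> is the one induced from \<open>K\<close>. For a henselian \<open>v\<close> the induced order
  exists, as \<open>v\<close> is then convex.
\<close>

definition induced_residue_order ::
    "('k::linordered_field \<Rightarrow> 'g::linordered_ab_group_add) \<Rightarrow> ('k \<Rightarrow> 'r::linordered_field) \<Rightarrow> bool"
  where
  "induced_residue_order v res \<longleftrightarrow> (\<forall>a \<in> val_units v. 0 < res a \<longleftrightarrow> 0 < a)"

definition angular_component ::
    "('k::field \<Rightarrow> 'g::linordered_ab_group_add) \<Rightarrow> ('k \<Rightarrow> 'r::field) \<Rightarrow> ('k \<Rightarrow> 'r) \<Rightarrow> bool" where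
  "angular_component v res ac \<longleftrightarrow>
     ac 0 = 0 \<and>
     (\<forall>x. x \<noteq> 0 \<longrightarrow> ac x \<noteq> 0) \<and>
     (\<forall>x y. x \<noteq> 0 \<longrightarrow> y \<noteq> 0 \<longrightarrow> ac (x * y) = ac x * ac y) \<and>
     (\<forall>u \<in> val_units v. ac u = res u)"

definition compatible_ac :: "('k::linordered_field \<Rightarrow> 'r::linordered_field) \<Rightarrow> bool" where
  "compatible_ac ac \<longleftrightarrow> (\<forall>x. 0 < x \<longleftrightarrow> 0 < ac x)"


section \<open>Syntax of the three-sorted language\<close>

text \<open>
  Variables of each sort are indexed by \<open>nat\<close>, separately for each sort; the minus sign of both
  languages is unary. No function symbol leads from another sort into the field sort, so the
  field terms in the variables \<open>xs\<close> are the expressions for polynomials in \<open>\<int>[xs]\<close>.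
\<close>

datatype fterm = FVar nat | FZero | FOne | FAdd fterm fterm | FMinus fterm | FMul fterm fterm

datatype rterm = RVar nat | RZero | ROne | RAdd rterm rterm | RMinus rterm | RMul rterm rterm
  | Res fterm | Ac fterm

datatype vterm = VVar nat | VZero | VAdd vterm vterm | VMinus vterm | Val fterm

datatype fm = Falsum
  | EqF fterm fterm | LessF fterm fterm
  | EqR rterm rterm | LessR rterm rterm
  | EqV vterm vterm | LessV vterm vterm
  | Neg fm | And fm fm | Or fm fm
  | ExF nat fm | ExR nat fm | ExV nat fm

definition AllF :: "nat \<Rightarrow> fm \<Rightarrow> fm" where "AllF i \<phi> = Neg (ExF i (Neg \<phi>))"
definition AllR :: "nat \<Rightarrow> fm \<Rightarrow> fm" where "AllR i \<phi> = Neg (ExR i (Neg \<phi>))"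
definition AllV :: "nat \<Rightarrow> fm \<Rightarrow> fm" where "AllV i \<phi> = Neg (ExV i (Neg \<phi>))"

definition Iff :: "fm \<Rightarrow> fm \<Rightarrow> fm" where
  "Iff \<phi> \<psi> = Or (And \<phi> \<psi>) (And (Neg \<phi>) (Neg \<psi>))"

definition Disj :: "fm list \<Rightarrow> fm" where
  "Disj \<phi>s = foldr Or \<phi>s Falsum"

text \<open>\<open>fvars\<close>, \<open>fvars_r\<close>, \<open>fvars_v\<close> collect the field variables of a term of each of the three sorts.\<close>

primrec fvars :: "fterm \<Rightarrow> nat set" where
  "fvars (FVar i) = {i}"
| "fvars FZero = {}"
| "fvars FOne = {}"
| "fvars (FAdd s t) = fvars s \<union> fvars t"
| "fvars (FMinus t) = fvars t"
| "fvars (FMul s t) = fvars s \<union> fvars t"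

primrec fvars_r :: "rterm \<Rightarrow> nat set" where
  "fvars_r (RVar i) = {}"
| "fvars_r RZero = {}"
| "fvars_r ROne = {}"
| "fvars_r (RAdd s t) = fvars_r s \<union> fvars_r t"
| "fvars_r (RMinus t) = fvars_r t"
| "fvars_r (RMul s t) = fvars_r s \<union> fvars_r t"
| "fvars_r (Res t) = fvars t"
| "fvars_r (Ac t) = fvars t"

primrec fvars_v :: "vterm \<Rightarrow> nat set" where
  "fvars_v (VVar i) = {}"
| "fvars_v VZero = {}"
| "fvars_v (VAdd s t) = fvars_v s \<union> fvars_v t"
| "fvars_v (VMinus t) = fvars_v t"
| "fvars_v (Val t) = fvars t"

primrec rvars :: "rterm \<Rightarrow> nat set" where
  "rvars (RVar i) = {i}"
| "rvars RZero = {}"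
| "rvars ROne = {}"
| "rvars (RAdd s t) = rvars s \<union> rvars t"
| "rvars (RMinus t) = rvars t"
| "rvars (RMul s t) = rvars s \<union> rvars t"
| "rvars (Res t) = {}"
| "rvars (Ac t) = {}"

primrec vvars :: "vterm \<Rightarrow> nat set" where
  "vvars (VVar i) = {i}"
| "vvars VZero = {}"
| "vvars (VAdd s t) = vvars s \<union> vvars t"
| "vvars (VMinus t) = vvars t"
| "vvars (Val t) = {}"

primrec freeF :: "fm \<Rightarrow> nat set" where
  "freeF Falsum = {}"
| "freeF (EqF s t) = fvars s \<union> fvars t"
| "freeF (LessF s t) = fvars s \<union> fvars t"
| "freeF (EqR s t) = fvars_r s \<union> fvars_r t"
| "freeF (LessR s t) = fvars_r s \<union> fvars_r t"
| "freeF (EqV s t) = fvars_v s \<union> fvars_v t"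
| "freeF (LessV s t) = fvars_v s \<union> fvars_v t"
| "freeF (Neg \<phi>) = freeF \<phi>"
| "freeF (And \<phi> \<psi>) = freeF \<phi> \<union> freeF \<psi>"
| "freeF (Or \<phi> \<psi>) = freeF \<phi> \<union> freeF \<psi>"
| "freeF (ExF i \<phi>) = freeF \<phi> - {i}"
| "freeF (ExR i \<phi>) = freeF \<phi>"
| "freeF (ExV i \<phi>) = freeF \<phi>"

primrec freeR :: "fm \<Rightarrow> nat set" where
  "freeR Falsum = {}"
| "freeR (EqF s t) = {}"
| "freeR (LessF s t) = {}"
| "freeR (EqR s t) = rvars s \<union> rvars t"
| "freeR (LessR s t) = rvars s \<union> rvars t"
| "freeR (EqV s t) = {}"
| "freeR (LessV s t) = {}"
| "freeR (Neg \<phi>) = freeR \<phi>"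
| "freeR (And \<phi> \<psi>) = freeR \<phi> \<union> freeR \<psi>"
| "freeR (Or \<phi> \<psi>) = freeR \<phi> \<union> freeR \<psi>"
| "freeR (ExF i \<phi>) = freeR \<phi>"
| "freeR (ExR i \<phi>) = freeR \<phi> - {i}"
| "freeR (ExV i \<phi>) = freeR \<phi>"

primrec freeV :: "fm \<Rightarrow> nat set" where
  "freeV Falsum = {}"
| "freeV (EqF s t) = {}"
| "freeV (LessF s t) = {}"
| "freeV (EqR s t) = {}"
| "freeV (LessR s t) = {}"
| "freeV (EqV s t) = vvars s \<union> vvars t"
| "freeV (LessV s t) = vvars s \<union> vvars t"
| "freeV (Neg \<phi>) = freeV \<phi>"
| "freeV (And \<phi> \<psi>) = freeV \<phi> \<union> freeV \<psi>"
| "freeV (Or \<phi> \<psi>) = freeV \<phi> \<union> freeV \<psi>"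
| "freeV (ExF i \<phi>) = freeV \<phi>"
| "freeV (ExR i \<phi>) = freeV \<phi>"
| "freeV (ExV i \<phi>) = freeV \<phi> - {i}"

definition sentence :: "fm \<Rightarrow> bool" where
  "sentence \<phi> \<longleftrightarrow> freeF \<phi> = {} \<and> freeR \<phi> = {} \<and> freeV \<phi> = {}"

definition all_closure :: "nat list \<Rightarrow> nat list \<Rightarrow> nat list \<Rightarrow> fm \<Rightarrow> fm" where
  "all_closure xs ys zs \<phi> = foldr AllF xs (foldr AllR ys (foldr AllV zs \<phi>))"

primrec field_quantifier_free :: "fm \<Rightarrow> bool" where
  "field_quantifier_free Falsum \<longleftrightarrow> True"
| "field_quantifier_free (EqF s t) \<longleftrightarrow> True"
| "field_quantifier_free (LessF s t) \<longleftrightarrow> True"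
| "field_quantifier_free (EqR s t) \<longleftrightarrow> True"
| "field_quantifier_free (LessR s t) \<longleftrightarrow> True"
| "field_quantifier_free (EqV s t) \<longleftrightarrow> True"
| "field_quantifier_free (LessV s t) \<longleftrightarrow> True"
| "field_quantifier_free (Neg \<phi>) \<longleftrightarrow> field_quantifier_free \<phi>"
| "field_quantifier_free (And \<phi> \<psi>) \<longleftrightarrow> field_quantifier_free \<phi> \<and> field_quantifier_free \<psi>"
| "field_quantifier_free (Or \<phi> \<psi>) \<longleftrightarrow> field_quantifier_free \<phi> \<and> field_quantifier_free \<psi>"
| "field_quantifier_free (ExF i \<phi>) \<longleftrightarrow> False"
| "field_quantifier_free (ExR i \<phi>) \<longleftrightarrow> field_quantifier_free \<phi>"
| "field_quantifier_free (ExV i \<phi>) \<longleftrightarrow> field_quantifier_free \<phi>"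


section \<open>Special formulas\<close>

text \<open>Formulas of ordered rings in residue variables only, and of ordered groups in value group
  variables only.\<close>

primrec pure_rterm :: "rterm \<Rightarrow> bool" where
  "pure_rterm (RVar i) \<longleftrightarrow> True"
| "pure_rterm RZero \<longleftrightarrow> True"
| "pure_rterm ROne \<longleftrightarrow> True"
| "pure_rterm (RAdd s t) \<longleftrightarrow> pure_rterm s \<and> pure_rterm t"
| "pure_rterm (RMinus t) \<longleftrightarrow> pure_rterm t"
| "pure_rterm (RMul s t) \<longleftrightarrow> pure_rterm s \<and> pure_rterm t"
| "pure_rterm (Res t) \<longleftrightarrow> False"
| "pure_rterm (Ac t) \<longleftrightarrow> False"

primrec pure_vterm :: "vterm \<Rightarrow> bool" where
  "pure_vterm (VVar i) \<longleftrightarrow> True"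
| "pure_vterm VZero \<longleftrightarrow> True"
| "pure_vterm (VAdd s t) \<longleftrightarrow> pure_vterm s \<and> pure_vterm t"
| "pure_vterm (VMinus t) \<longleftrightarrow> pure_vterm t"
| "pure_vterm (Val t) \<longleftrightarrow> False"

primrec pure_rfm :: "fm \<Rightarrow> bool" where
  "pure_rfm Falsum \<longleftrightarrow> True"
| "pure_rfm (EqF s t) \<longleftrightarrow> False"
| "pure_rfm (LessF s t) \<longleftrightarrow> False"
| "pure_rfm (EqR s t) \<longleftrightarrow> pure_rterm s \<and> pure_rterm t"
| "pure_rfm (LessR s t) \<longleftrightarrow> pure_rterm s \<and> pure_rterm t"
| "pure_rfm (EqV s t) \<longleftrightarrow> False"
| "pure_rfm (LessV s t) \<longleftrightarrow> False"
| "pure_rfm (Neg \<phi>) \<longleftrightarrow> pure_rfm \<phi>"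
| "pure_rfm (And \<phi> \<psi>) \<longleftrightarrow> pure_rfm \<phi> \<and> pure_rfm \<psi>"
| "pure_rfm (Or \<phi> \<psi>) \<longleftrightarrow> pure_rfm \<phi> \<and> pure_rfm \<psi>"
| "pure_rfm (ExF i \<phi>) \<longleftrightarrow> False"
| "pure_rfm (ExR i \<phi>) \<longleftrightarrow> pure_rfm \<phi>"
| "pure_rfm (ExV i \<phi>) \<longleftrightarrow> False"

primrec pure_vfm :: "fm \<Rightarrow> bool" where
  "pure_vfm Falsum \<longleftrightarrow> True"
| "pure_vfm (EqF s t) \<longleftrightarrow> False"
| "pure_vfm (LessF s t) \<longleftrightarrow> False"
| "pure_vfm (EqR s t) \<longleftrightarrow> False"
| "pure_vfm (LessR s t) \<longleftrightarrow> False"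
| "pure_vfm (EqV s t) \<longleftrightarrow> pure_vterm s \<and> pure_vterm t"
| "pure_vfm (LessV s t) \<longleftrightarrow> pure_vterm s \<and> pure_vterm t"
| "pure_vfm (Neg \<phi>) \<longleftrightarrow> pure_vfm \<phi>"
| "pure_vfm (And \<phi> \<psi>) \<longleftrightarrow> pure_vfm \<phi> \<and> pure_vfm \<psi>"
| "pure_vfm (Or \<phi> \<psi>) \<longleftrightarrow> pure_vfm \<phi> \<and> pure_vfm \<psi>"
| "pure_vfm (ExF i \<phi>) \<longleftrightarrow> False"
| "pure_vfm (ExR i \<phi>) \<longleftrightarrow> False"
| "pure_vfm (ExV i \<phi>) \<longleftrightarrow> pure_vfm \<phi>"

text \<open>
  Substitution for the free residue (value group) variables. It is only applied to pure
  formulas, and the terms put in place of a variable are the variable itself or of the form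
  \<open>Ac q\<close> (\<open>Val q\<close>), whose only variables are of field sort; so no variable is captured.
\<close>

primrec rterm_subst :: "(nat \<Rightarrow> rterm) \<Rightarrow> rterm \<Rightarrow> rterm" where
  "rterm_subst \<sigma> (RVar i) = \<sigma> i"
| "rterm_subst \<sigma> RZero = RZero"
| "rterm_subst \<sigma> ROne = ROne"
| "rterm_subst \<sigma> (RAdd s t) = RAdd (rterm_subst \<sigma> s) (rterm_subst \<sigma> t)"
| "rterm_subst \<sigma> (RMinus t) = RMinus (rterm_subst \<sigma> t)"
| "rterm_subst \<sigma> (RMul s t) = RMul (rterm_subst \<sigma> s) (rterm_subst \<sigma> t)"
| "rterm_subst \<sigma> (Res t) = Res t"
| "rterm_subst \<sigma> (Ac t) = Ac t"

primrec vterm_subst :: "(nat \<Rightarrow> vterm) \<Rightarrow> vterm \<Rightarrow> vterm" where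
  "vterm_subst \<sigma> (VVar i) = \<sigma> i"
| "vterm_subst \<sigma> VZero = VZero"
| "vterm_subst \<sigma> (VAdd s t) = VAdd (vterm_subst \<sigma> s) (vterm_subst \<sigma> t)"
| "vterm_subst \<sigma> (VMinus t) = VMinus (vterm_subst \<sigma> t)"
| "vterm_subst \<sigma> (Val t) = Val t"

primrec fm_subst_r :: "(nat \<Rightarrow> rterm) \<Rightarrow> fm \<Rightarrow> fm" where
  "fm_subst_r \<sigma> Falsum = Falsum"
| "fm_subst_r \<sigma> (EqF s t) = EqF s t"
| "fm_subst_r \<sigma> (LessF s t) = LessF s t"
| "fm_subst_r \<sigma> (EqR s t) = EqR (rterm_subst \<sigma> s) (rterm_subst \<sigma> t)"
| "fm_subst_r \<sigma> (LessR s t) = LessR (rterm_subst \<sigma> s) (rterm_subst \<sigma> t)"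
| "fm_subst_r \<sigma> (EqV s t) = EqV s t"
| "fm_subst_r \<sigma> (LessV s t) = LessV s t"
| "fm_subst_r \<sigma> (Neg \<phi>) = Neg (fm_subst_r \<sigma> \<phi>)"
| "fm_subst_r \<sigma> (And \<phi> \<psi>) = And (fm_subst_r \<sigma> \<phi>) (fm_subst_r \<sigma> \<psi>)"
| "fm_subst_r \<sigma> (Or \<phi> \<psi>) = Or (fm_subst_r \<sigma> \<phi>) (fm_subst_r \<sigma> \<psi>)"
| "fm_subst_r \<sigma> (ExF i \<phi>) = ExF i (fm_subst_r \<sigma> \<phi>)"
| "fm_subst_r \<sigma> (ExR i \<phi>) = ExR i (fm_subst_r (\<sigma>(i := RVar i)) \<phi>)"
| "fm_subst_r \<sigma> (ExV i \<phi>) = ExV i (fm_subst_r \<sigma> \<phi>)"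

primrec fm_subst_v :: "(nat \<Rightarrow> vterm) \<Rightarrow> fm \<Rightarrow> fm" where
  "fm_subst_v \<sigma> Falsum = Falsum"
| "fm_subst_v \<sigma> (EqF s t) = EqF s t"
| "fm_subst_v \<sigma> (LessF s t) = LessF s t"
| "fm_subst_v \<sigma> (EqR s t) = EqR s t"
| "fm_subst_v \<sigma> (LessR s t) = LessR s t"
| "fm_subst_v \<sigma> (EqV s t) = EqV (vterm_subst \<sigma> s) (vterm_subst \<sigma> t)"
| "fm_subst_v \<sigma> (LessV s t) = LessV (vterm_subst \<sigma> s) (vterm_subst \<sigma> t)"
| "fm_subst_v \<sigma> (Neg \<phi>) = Neg (fm_subst_v \<sigma> \<phi>)"
| "fm_subst_v \<sigma> (And \<phi> \<psi>) = And (fm_subst_v \<sigma> \<phi>) (fm_subst_v \<sigma> \<psi>)"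
| "fm_subst_v \<sigma> (Or \<phi> \<psi>) = Or (fm_subst_v \<sigma> \<phi>) (fm_subst_v \<sigma> \<psi>)"
| "fm_subst_v \<sigma> (ExF i \<phi>) = ExF i (fm_subst_v \<sigma> \<phi>)"
| "fm_subst_v \<sigma> (ExR i \<phi>) = ExR i (fm_subst_v \<sigma> \<phi>)"
| "fm_subst_v \<sigma> (ExV i \<phi>) = ExV i (fm_subst_v (\<sigma>(i := VVar i)) \<phi>)"

definition ac_subst :: "nat list \<Rightarrow> fterm list \<Rightarrow> nat \<Rightarrow> rterm" where
  "ac_subst us qs i = (case map_of (zip us qs) i of None \<Rightarrow> RVar i | Some q \<Rightarrow> Ac q)"

definition val_subst :: "nat list \<Rightarrow> fterm list \<Rightarrow> nat \<Rightarrow> vterm" where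
  "val_subst us qs i = (case map_of (zip us qs) i of None \<Rightarrow> VVar i | Some q \<Rightarrow> Val q)"

definition special_rfm :: "nat list \<Rightarrow> nat list \<Rightarrow> fm \<Rightarrow> bool" where
  "special_rfm xs ys \<psi> \<longleftrightarrow>
     (\<exists>\<psi>' us qs. pure_rfm \<psi>' \<and> distinct us \<and> set us \<inter> set ys = {} \<and> length qs = length us \<and>
        freeR \<psi>' \<subseteq> set us \<union> set ys \<and> (\<forall>q \<in> set qs. fvars q \<subseteq> set xs) \<and>
        \<psi> = fm_subst_r (ac_subst us qs) \<psi>')"

definition special_vfm :: "nat list \<Rightarrow> nat list \<Rightarrow> fm \<Rightarrow> bool" where
  "special_vfm xs zs \<theta> \<longleftrightarrow>
     (\<exists>\<theta>' us qs. pure_vfm \<theta>' \<and> distinct us \<and> set us \<inter> set zs = {} \<and> length qs = length us \<and>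
        freeV \<theta>' \<subseteq> set us \<union> set zs \<and> (\<forall>q \<in> set qs. fvars q \<subseteq> set xs) \<and>
        \<theta> = fm_subst_v (val_subst us qs) \<theta>')"


section \<open>Semantics\<close>

text \<open>The symbols of ordered rings and ordered groups are interpreted by the operations of the
  types, so a structure only consists of the interpretations of the three function symbols
  between the sorts.\<close>

record ('k, 'r, 'g) ovf_ac =
  residue :: "'k \<Rightarrow> 'r"
  val :: "'k \<Rightarrow> 'g"
  ang :: "'k \<Rightarrow> 'r"

definition ovf_ac_structure ::
    "('k::linordered_field \<Rightarrow> 'g::linordered_ab_group_add) \<Rightarrow> ('k \<Rightarrow> 'r::linordered_field) \<Rightarrow>
     ('k \<Rightarrow> 'r) \<Rightarrow> ('k, 'r, 'g) ovf_ac" where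
  "ovf_ac_structure v res ac =
     \<lparr> residue = (\<lambda>a. if a \<in> val_ring v then res a else 0),
       val = (\<lambda>a. if a = 0 then 0 else v a),
       ang = ac \<rparr>"

primrec eval_f :: "(nat \<Rightarrow> 'k::linordered_field) \<Rightarrow> fterm \<Rightarrow> 'k" where
  "eval_f x (FVar i) = x i"
| "eval_f x FZero = 0"
| "eval_f x FOne = 1"
| "eval_f x (FAdd s t) = eval_f x s + eval_f x t"
| "eval_f x (FMinus t) = - eval_f x t"
| "eval_f x (FMul s t) = eval_f x s * eval_f x t"

primrec eval_r :: "('k::linordered_field, 'r::linordered_field, 'g) ovf_ac \<Rightarrow>
    (nat \<Rightarrow> 'k) \<Rightarrow> (nat \<Rightarrow> 'r) \<Rightarrow> rterm \<Rightarrow> 'r" where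
  "eval_r K x y (RVar i) = y i"
| "eval_r K x y RZero = 0"
| "eval_r K x y ROne = 1"
| "eval_r K x y (RAdd s t) = eval_r K x y s + eval_r K x y t"
| "eval_r K x y (RMinus t) = - eval_r K x y t"
| "eval_r K x y (RMul s t) = eval_r K x y s * eval_r K x y t"
| "eval_r K x y (Res t) = residue K (eval_f x t)"
| "eval_r K x y (Ac t) = ang K (eval_f x t)"

primrec eval_v :: "('k::linordered_field, 'r, 'g::linordered_ab_group_add) ovf_ac \<Rightarrow>
    (nat \<Rightarrow> 'k) \<Rightarrow> (nat \<Rightarrow> 'g) \<Rightarrow> vterm \<Rightarrow> 'g" where
  "eval_v K x z (VVar i) = z i"
| "eval_v K x z VZero = 0"
| "eval_v K x z (VAdd s t) = eval_v K x z s + eval_v K x z t"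
| "eval_v K x z (VMinus t) = - eval_v K x z t"
| "eval_v K x z (Val t) = val K (eval_f x t)"

primrec sat :: "('k::linordered_field, 'r::linordered_field, 'g::linordered_ab_group_add) ovf_ac \<Rightarrow>
    (nat \<Rightarrow> 'k) \<Rightarrow> (nat \<Rightarrow> 'r) \<Rightarrow> (nat \<Rightarrow> 'g) \<Rightarrow> fm \<Rightarrow> bool" where
  "sat K x y z Falsum \<longleftrightarrow> False"
| "sat K x y z (EqF s t) \<longleftrightarrow> eval_f x s = eval_f x t"
| "sat K x y z (LessF s t) \<longleftrightarrow> eval_f x s < eval_f x t"
| "sat K x y z (EqR s t) \<longleftrightarrow> eval_r K x y s = eval_r K x y t"
| "sat K x y z (LessR s t) \<longleftrightarrow> eval_r K x y s < eval_r K x y t"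
| "sat K x y z (EqV s t) \<longleftrightarrow> eval_v K x z s = eval_v K x z t"
| "sat K x y z (LessV s t) \<longleftrightarrow> eval_v K x z s < eval_v K x z t"
| "sat K x y z (Neg \<phi>) \<longleftrightarrow> \<not> sat K x y z \<phi>"
| "sat K x y z (And \<phi> \<psi>) \<longleftrightarrow> sat K x y z \<phi> \<and> sat K x y z \<psi>"
| "sat K x y z (Or \<phi> \<psi>) \<longleftrightarrow> sat K x y z \<phi> \<or> sat K x y z \<psi>"
| "sat K x y z (ExF i \<phi>) \<longleftrightarrow> (\<exists>a. sat K (x(i := a)) y z \<phi>)"
| "sat K x y z (ExR i \<phi>) \<longleftrightarrow> (\<exists>a. sat K x (y(i := a)) z \<phi>)"
| "sat K x y z (ExV i \<phi>) \<longleftrightarrow> (\<exists>a. sat K x y (z(i := a)) \<phi>)"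

definition equivalent_over ::
    "('k::linordered_field, 'r::linordered_field, 'g::linordered_ab_group_add) ovf_ac \<Rightarrow>
     fm \<Rightarrow> fm \<Rightarrow> bool" where
  "equivalent_over K \<phi> \<psi> \<longleftrightarrow> (\<forall>x y z. sat K x y z \<phi> \<longleftrightarrow> sat K x y z \<psi>)"

definition Th ::
    "('k::linordered_field, 'r::linordered_field, 'g::linordered_ab_group_add) ovf_ac \<Rightarrow> fm set"
  where
  "Th K = {\<phi>. sentence \<phi> \<and> (\<forall>x y z. sat K x y z \<phi>)}"

text \<open>For a deductively closed set \<open>T\<close> of sentences, such as \<open>Th K\<close>: membership of the universal
  closure of \<open>Iff \<phi> \<chi>\<close> in \<open>T\<close> says that \<open>\<phi>\<close> and \<open>\<chi>\<close> are equivalent modulo \<open>T\<close>.\<close>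

definition eliminates_field_quantifiers :: "fm set \<Rightarrow> bool" where
  "eliminates_field_quantifiers T \<longleftrightarrow>
     (\<forall>\<phi>. \<exists>\<chi>. field_quantifier_free \<chi> \<and>
        freeF \<chi> \<subseteq> freeF \<phi> \<and> freeR \<chi> \<subseteq> freeR \<phi> \<and> freeV \<chi> \<subseteq> freeV \<phi> \<and>
        (\<exists>xs ys zs. set xs = freeF \<phi> \<and> set ys = freeR \<phi> \<and> set zs = freeV \<phi> \<and>
           all_closure xs ys zs (Iff \<phi> \<chi>) \<in> T))"

end

theory Submission
  imports Defs
begin

text \<open>
  Call the pair of \<open>ac x\<close> and \<open>v x\<close> the leading term of a nonzero \<open>x\<close>. A formula without field
  quantifiers sees field elements only through leading terms of polynomials: \<open>x < y\<close> says that
  \<open>ac (y - x)\<close> is positive, and the residue of \<open>x\<close> is \<open>ac x\<close> if \<open>v x = 0\<close> (with the convention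
  \<open>v 0 = 0\<close>) and \<open>0\<close> otherwise. So it suffices to eliminate \<open>\<exists>t\<close> in front of a condition on the
  leading terms of finitely many polynomials \<open>f\<^sub>j(t)\<close> whose coefficients are polynomials in the
  parameters.

  \<^emph>\<open>Good centres.\<close> Call \<open>c\<close> a good centre of \<open>f\<close> for \<open>t\<close> if \<open>v (f t)\<close> is at most the value of every
  term \<open>a\<^sub>i (t - c)\<^sup>i\<close> of the Taylor expansion of \<open>f\<close> at \<open>c\<close>. Then the terms of least value do not
  cancel, and the leading term of \<open>f t\<close> is computed from the leading terms of \<open>t - c\<close> and of the
  coefficients \<open>a\<^sub>i\<close>. Three facts about good centres carry the proof. First, in terms of the Taylor
  coefficients \<open>b\<^sub>i\<close> at \<open>t\<close> itself, \<open>c\<close> is good if and only if \<open>v (f t) \<le> v (b\<^sub>i (t - c)\<^sup>i)\<close> for all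
  \<open>i\<close>, so every centre closer to \<open>t\<close> than a good one is good (\<open>vle_taylor_shift_iff\<close>,
  \<open>good_center_closer\<close>). Secondly, some good centre is \<open>0\<close> or a root of a nonzero iterated
  derivative of \<open>f\<close> (\<open>ex_good_center\<close>): inductively take such a centre for \<open>f'\<close>; if it is not good
  for \<open>f\<close>, then \<open>f t\<close> is small compared to \<open>f'(t) (t - c)\<close>, and Hensel's lemma gives a root of \<open>f\<close>
  that is closer to \<open>t\<close>, which is a good centre. Hence finitely many polynomials have a common such
  centre, namely the closest one (\<open>ex_common_good_center\<close>). Thirdly, if \<open>c\<close> is good for \<open>f'\<close> and
  the leading terms in the expansion of \<open>f\<close> at \<open>c\<close> cancel for the leading term of \<open>s\<close>, then \<open>f\<close>
  has a root \<open>c + s'\<close> where \<open>s'\<close> has the same leading term as \<open>s\<close> (\<open>ex_root_if_not_pgood\<close>).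

  \<^emph>\<open>Elimination.\<close> By the second fact, \<open>\<exists>t\<close> is replaced by \<open>\<exists>c \<exists>\<rho> \<exists>\<gamma>\<close>, where \<open>(\<rho>, \<gamma>)\<close> is the leading
  term of \<open>t - c\<close> and \<open>c\<close> is \<open>0\<close> or a root of one of finitely many polynomials
  (\<open>definable_ex_field\<close>). What remains is a quantifier over the roots \<open>c\<close> of a polynomial \<open>g\<close> of
  degree \<open>n + 1\<close>, and it is removed by induction on the degree (\<open>roots_eliminable\<close>): modulo \<open>g\<close> the
  condition on \<open>c\<close> involves polynomials of degree at most \<open>n\<close> only; these and \<open>g'\<close> have a common
  good centre for \<open>c\<close> that is \<open>0\<close> or a root of a polynomial of degree at most \<open>n\<close>; and by the third
  fact, the existence of a root of \<open>g\<close> with given leading term relative to this centre is the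
  cancellation of leading terms. So the quantifier over \<open>c\<close> gives way to one over this centre, which
  the induction hypothesis removes.

  Residue field and value group do not interact in formulas without field sort, so such formulas
  are disjunctions of conjunctions of a formula for each of the two sorts (\<open>separated_pure\<close>).
\<close>

section \<open>Valued fields with an angular component\<close>

locale henselian_ac_field =
  fixes v :: "'k::linordered_field \<Rightarrow> 'g::linordered_ab_group_add"
    and res ac :: "'k \<Rightarrow> 'r::linordered_field"
  assumes henselian: "henselian_valuation v"
    and residue: "residue_map v res"
    and angular: "angular_component v res ac"
begin

text \<open>The order of the values with \<open>v 0 = \<infinity>\<close>: \<open>vle x y\<close> says that \<open>y\<close> is a multiple of \<open>x\<close> in the
  valuation ring.\<close>

definition vle :: "'k \<Rightarrow> 'k \<Rightarrow> bool" where
  "vle x y \<longleftrightarrow> y = 0 \<or> (x \<noteq> 0 \<and> v x \<le> v y)"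

lemma v_mult: "x \<noteq> 0 \<Longrightarrow> y \<noteq> 0 \<Longrightarrow> v (x * y) = v x + v y"
  and v_add: "x \<noteq> 0 \<Longrightarrow> y \<noteq> 0 \<Longrightarrow> x + y \<noteq> 0 \<Longrightarrow> min (v x) (v y) \<le> v (x + y)"
  and v_surj: "\<exists>x. x \<noteq> 0 \<and> v x = \<gamma>"
proof -
  have V: "valuation v" using henselian by (simp add: henselian_valuation_def)
  show "x \<noteq> 0 \<Longrightarrow> y \<noteq> 0 \<Longrightarrow> v (x * y) = v x + v y"
    and "x \<noteq> 0 \<Longrightarrow> y \<noteq> 0 \<Longrightarrow> x + y \<noteq> 0 \<Longrightarrow> min (v x) (v y) \<le> v (x + y)"
    using V by (auto simp: valuation_def)
  have "\<gamma> \<in> v ` (- {0})" using V by (simp add: valuation_def)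
  then show "\<exists>x. x \<noteq> 0 \<and> v x = \<gamma>" by auto
qed

lemma v_one [simp]: "v 1 = 0"
  using v_mult[of 1 1] by simp

lemma v_minus_one: "v (- 1) = 0"
proof -
  have "v (-1) + v (-1) = 0"
    using v_mult[of "-1" "-1"] by simp
  then show ?thesis by (simp add: double_zero_sym double_zero)
qed

lemma v_minus [simp]: "v (- x) = v x" if "x \<noteq> 0"
  using v_mult[of "-1" x] that v_minus_one by simp

lemma vle_refl [simp]: "vle x x" by (simp add: vle_def)

lemma vle_0_right [simp]: "vle x 0" by (simp add: vle_def)

lemma vle_0_left [simp]: "vle 0 x \<longleftrightarrow> x = 0" by (auto simp: vle_def)

lemma vle_trans [trans]: "vle x y \<Longrightarrow> vle y z \<Longrightarrow> vle x z"
  by (auto simp: vle_def)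

lemma vle_total: "vle x y \<or> vle y x"
  by (auto simp: vle_def)

lemma vle_add: "vle x y \<Longrightarrow> vle x z \<Longrightarrow> vle x (y + z)"
  using v_add[of y z] order_trans[of "v x" "min (v y) (v z)" "v (y + z)"]
  by (cases "y = 0"; cases "z = 0"; cases "y + z = 0") (auto simp: vle_def)

lemma vle_minus_right [simp]: "vle x (- y) \<longleftrightarrow> vle x y"
  by (auto simp: vle_def)

lemma vle_mult: "vle x y \<Longrightarrow> vle z w \<Longrightarrow> vle (x * z) (y * w)"
  by (auto simp: vle_def v_mult add_mono)

lemma vle_mult_left: "vle x y \<Longrightarrow> vle (a * x) (a * y)"
  by (rule vle_mult) simp_all

lemma vle_mult_cancel: "a \<noteq> 0 \<Longrightarrow> vle (a * x) (a * y) \<longleftrightarrow> vle x y"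
  by (auto simp: vle_def v_mult)

lemma vle_power: "vle x y \<Longrightarrow> vle (x ^ n) (y ^ n)"
  by (induction n) (simp_all add: vle_mult)

lemma vle_sum: "(\<And>i. i \<in> A \<Longrightarrow> vle x (f i)) \<Longrightarrow> vle x (sum f A)"
  by (induction A rule: infinite_finite_induct) (simp_all add: vle_add)

lemma val_ring_iff: "x \<in> val_ring v \<longleftrightarrow> vle 1 x"
  by (auto simp: val_ring_def vle_def)

lemma val_max_ideal_iff: "x \<in> val_max_ideal v \<longleftrightarrow> \<not> vle x 1"
  by (auto simp: val_max_ideal_def vle_def)

lemma res_add: "vle 1 a \<Longrightarrow> vle 1 b \<Longrightarrow> res (a + b) = res a + res b"
  and res_one [simp]: "res 1 = 1"
  and res_eq_0: "vle 1 a \<Longrightarrow> res a = 0 \<longleftrightarrow> \<not> vle a 1"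
  and res_surj: "\<exists>a. vle 1 a \<and> res a = r"
proof -
  note R = residue[unfolded residue_map_def val_ring_iff]
  show "vle 1 a \<Longrightarrow> vle 1 b \<Longrightarrow> res (a + b) = res a + res b"
    and "res 1 = 1"
    and "vle 1 a \<Longrightarrow> res a = 0 \<longleftrightarrow> \<not> vle a 1"
    using R by (auto simp: val_ring_iff val_max_ideal_iff)
  have "r \<in> res ` val_ring v" using R by simp
  then show "\<exists>a. vle 1 a \<and> res a = r" by (auto simp: val_ring_iff)
qed

lemma res_zero [simp]: "res 0 = 0"
  by (simp add: res_eq_0)

lemma res_sum: "(\<And>i. i \<in> A \<Longrightarrow> vle 1 (f i)) \<Longrightarrow> res (sum f A) = (\<Sum>i\<in>A. res (f i))"
  by (induction A rule: infinite_finite_induct) (simp_all add: res_add vle_sum)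

lemma vle_of_nat: "vle 1 (of_nat n)"
  by (induction n) (simp_all add: vle_add)

lemma res_of_nat: "res (of_nat n) = of_nat n"
  by (induction n) (simp_all add: vle_of_nat res_add)

text \<open>The residue field is ordered, hence of characteristic \<open>0\<close>, so positive integers are units.\<close>

lemma vle_of_nat_mult:
  assumes n: "n \<noteq> 0"
  shows "vle x (of_nat n * y) \<longleftrightarrow> vle x y"
proof -
  have "vle (of_nat n) 1"
    using n res_eq_0[of "of_nat n"] by (simp add: res_of_nat vle_of_nat)
  then have "v (of_nat n) = 0"
    using n vle_of_nat[of n] by (auto simp: vle_def)
  then show ?thesis using n by (auto simp: vle_def v_mult)
qed

lemma ac_zero [simp]: "ac 0 = 0"
  and ac_eq_0 [simp]: "ac x = 0 \<longleftrightarrow> x = 0"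
  and ac_mult: "ac (x * y) = ac x * ac y"
  and ac_unit: "vle 1 u \<Longrightarrow> vle u 1 \<Longrightarrow> ac u = res u"
proof -
  note A = angular[unfolded angular_component_def]
  show "ac 0 = 0" "ac x = 0 \<longleftrightarrow> x = 0" using A by auto
  show "ac (x * y) = ac x * ac y"
    using A by (cases "x = 0 \<or> y = 0") auto
  assume "vle 1 u" "vle u 1"
  then have "u \<in> val_units v" by (auto simp: val_units_def vle_def)
  then show "ac u = res u" using A by blast
qed

lemma ac_one [simp]: "ac 1 = 1"
  by (simp add: ac_unit)

lemma ac_power: "ac (x ^ n) = ac x ^ n"
  by (induction n) (simp_all add: ac_mult)

lemma rv_surj: "\<rho> \<noteq> 0 \<Longrightarrow> \<exists>s. s \<noteq> 0 \<and> ac s = \<rho> \<and> v s = \<gamma>"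
proof -
  assume \<rho>: "\<rho> \<noteq> 0"
  obtain x where x: "x \<noteq> 0" "v x = \<gamma>" using v_surj by blast
  obtain a where a: "vle 1 a" "res a = \<rho> / ac x" using res_surj by blast
  have u: "vle a 1" using res_eq_0[OF a(1)] a \<rho> x by auto
  then have "ac a = \<rho> / ac x" "a \<noteq> 0" "v a = 0" using a ac_unit by (auto simp: vle_def)
  then show ?thesis using x by (intro exI[of _ "a * x"]) (auto simp: ac_mult v_mult)
qed

section \<open>Leading terms of sums\<close>

text \<open>
  The sequences \<open>\<alpha>\<close> and \<open>\<beta>\<close> stand for the angular components and the values of the summands of a
  sum over \<open>{..d}\<close>; where \<open>\<alpha> i = 0\<close> the summand vanishes, and \<open>\<beta> i\<close> is arbitrary. The sequences are
  abstract because they will depend on a residue field and a value group variable.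
\<close>

definition leading :: "nat \<Rightarrow> (nat \<Rightarrow> 'r) \<Rightarrow> (nat \<Rightarrow> 'g) \<Rightarrow> nat \<Rightarrow> bool" where
  "leading d \<alpha> \<beta> i \<longleftrightarrow> \<alpha> i \<noteq> 0 \<and> (\<forall>j\<le>d. \<alpha> j \<noteq> 0 \<longrightarrow> \<beta> i \<le> \<beta> j)"

definition lead_ac :: "nat \<Rightarrow> (nat \<Rightarrow> 'r) \<Rightarrow> (nat \<Rightarrow> 'g) \<Rightarrow> 'r" where
  "lead_ac d \<alpha> \<beta> = (\<Sum>i\<le>d. if leading d \<alpha> \<beta> i then \<alpha> i else 0)"

text \<open>All indices that satisfy \<open>leading\<close> have the same value of \<open>\<beta>\<close>. It is selected by recursion and not by
  a choice operator so that it is visibly piecewise one of the \<open>\<beta> i\<close>.\<close>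

primrec leading_value :: "(nat \<Rightarrow> bool) \<Rightarrow> (nat \<Rightarrow> 'g) \<Rightarrow> nat \<Rightarrow> 'g" where
  "leading_value I \<beta> 0 = 0"
| "leading_value I \<beta> (Suc n) = (if I n then \<beta> n else leading_value I \<beta> n)"

definition lead_val :: "nat \<Rightarrow> (nat \<Rightarrow> 'r) \<Rightarrow> (nat \<Rightarrow> 'g) \<Rightarrow> 'g" where
  "lead_val d \<alpha> \<beta> = leading_value (leading d \<alpha> \<beta>) \<beta> (Suc d)"

text \<open>No cancellation of leading terms; a sum of zeros, which has none, counts as good.\<close>

definition good :: "nat \<Rightarrow> (nat \<Rightarrow> 'r) \<Rightarrow> (nat \<Rightarrow> 'g) \<Rightarrow> bool" where
  "good d \<alpha> \<beta> \<longleftrightarrow> (\<forall>i\<le>d. \<alpha> i = 0) \<or> lead_ac d \<alpha> \<beta> \<noteq> 0"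

lemma leading_value_eq:
  "(\<And>i. i < n \<Longrightarrow> I i \<Longrightarrow> \<beta> i = w) \<Longrightarrow> leading_value I \<beta> n = (if \<exists>i<n. I i then w else 0)"
  by (induction n) (auto simp: less_Suc_eq)

text \<open>The value as interpreted in the three-sorted structure.\<close>

definition val0 :: "'k \<Rightarrow> 'g" where "val0 a = (if a = 0 then 0 else v a)"

context
  fixes d :: nat and x :: "nat \<Rightarrow> 'k" and \<alpha> :: "nat \<Rightarrow> 'r" and \<beta> :: "nat \<Rightarrow> 'g"
  assumes \<alpha>: "\<And>i. i \<le> d \<Longrightarrow> \<alpha> i = ac (x i)" and \<beta>: "\<And>i. i \<le> d \<Longrightarrow> x i \<noteq> 0 \<Longrightarrow> \<beta> i = v (x i)"
begin

lemma leading_iff: "i \<le> d \<Longrightarrow> leading d \<alpha> \<beta> i \<longleftrightarrow> x i \<noteq> 0 \<and> (\<forall>j\<le>d. vle (x i) (x j))"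
  by (auto simp: leading_def \<alpha> \<beta> vle_def)

lemma ex_leading: "i \<le> d \<Longrightarrow> x i \<noteq> 0 \<Longrightarrow> \<exists>m\<le>d. leading d \<alpha> \<beta> m"
proof -
  assume i: "i \<le> d" "x i \<noteq> 0"
  let ?V = "(\<lambda>j. v (x j)) ` {j. j \<le> d \<and> x j \<noteq> 0}"
  have fin: "finite ?V" "?V \<noteq> {}" using i by auto
  obtain m where m: "m \<le> d" "x m \<noteq> 0" "v (x m) = Min ?V"
    using Min_in[OF fin] by fastforce
  moreover have "v (x m) \<le> v (x j)" if "j \<le> d" "x j \<noteq> 0" for j
    unfolding m(3) using fin(1) by (rule Min_le) (use that in auto)
  ultimately have "leading d \<alpha> \<beta> m"
    unfolding leading_iff[OF m(1)] vle_def by blast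
  then show "\<exists>m\<le>d. leading d \<alpha> \<beta> m" using \<open>m \<le> d\<close> by blast
qed

text \<open>After division by a summand of least value all summands are integral, and exactly the leading
  ones have a nonzero residue.\<close>

lemma res_sum_div_leading:
  assumes m: "m \<le> d" "leading d \<alpha> \<beta> m"
  shows "vle 1 ((\<Sum>i\<le>d. x i) / x m)" and "res ((\<Sum>i\<le>d. x i) / x m) = lead_ac d \<alpha> \<beta> / ac (x m)"
proof -
  have m': "x m \<noteq> 0" "\<And>j. j \<le> d \<Longrightarrow> vle (x m) (x j)" using m leading_iff by auto
  have q: "vle 1 (x j / x m)" if "j \<le> d" for j
    using m'(2)[OF that] m'(1) vle_mult_cancel[of "x m" 1 "x j / x m"] by simp
  have r: "res (x j / x m) = (if leading d \<alpha> \<beta> j then \<alpha> j else 0) / ac (x m)" if "j \<le> d" for j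
  proof (cases "vle (x j) (x m)")
    case True
    then have "x j \<noteq> 0" using m'(1) by auto
    moreover have l: "leading d \<alpha> \<beta> j"
      using True that m'(2) \<open>x j \<noteq> 0\<close> by (auto simp: leading_iff intro: vle_trans)
    moreover have "vle (x j / x m) 1"
      using True m'(1) vle_mult_cancel[of "x m" "x j / x m" 1] by simp
    ultimately have "ac (x j / x m) = res (x j / x m)" using q that ac_unit by auto
    moreover have "ac (x j / x m) * ac (x m) = ac (x j)"
      using m'(1) by (simp flip: ac_mult)
    ultimately show ?thesis using l m'(1) that by (simp add: field_simps \<alpha>)
  next
    case False
    then have "\<not> leading d \<alpha> \<beta> j" using that m by (auto simp: leading_iff)
    moreover have "\<not> vle (x j / x m) 1"
      using False m'(1) vle_mult_cancel[of "x m" "x j / x m" 1] by simp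
    ultimately show ?thesis using q[OF that] by (simp add: res_eq_0)
  qed
  show "vle 1 ((\<Sum>i\<le>d. x i) / x m)"
    unfolding sum_divide_distrib by (rule vle_sum) (simp add: q)
  show "res ((\<Sum>i\<le>d. x i) / x m) = lead_ac d \<alpha> \<beta> / ac (x m)"
    unfolding sum_divide_distrib lead_ac_def using q r by (subst res_sum) auto
qed

lemma good_sum:
  assumes "good d \<alpha> \<beta>"
  shows "ac (\<Sum>i\<le>d. x i) = lead_ac d \<alpha> \<beta>" and "val0 (\<Sum>i\<le>d. x i) = lead_val d \<alpha> \<beta>"
    and "j \<le> d \<Longrightarrow> vle (\<Sum>i\<le>d. x i) (x j)"
proof -
  let ?S = "\<Sum>i\<le>d. x i"
  have "ac ?S = lead_ac d \<alpha> \<beta> \<and> val0 ?S = lead_val d \<alpha> \<beta> \<and> (\<forall>j\<le>d. vle ?S (x j))"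
  proof (cases "\<forall>i\<le>d. x i = 0")
    case True
    then have "\<not> leading d \<alpha> \<beta> i" if "i \<le> d" for i using that by (simp add: leading_iff)
    then have "lead_ac d \<alpha> \<beta> = 0" "lead_val d \<alpha> \<beta> = 0"
      unfolding lead_ac_def lead_val_def by (simp, subst leading_value_eq[where w = 0]) auto
    then show ?thesis using True by (simp add: val0_def)
  next
    case False
    then obtain m where m: "m \<le> d" "leading d \<alpha> \<beta> m" using ex_leading by blast
    have m': "x m \<noteq> 0" "\<And>j. j \<le> d \<Longrightarrow> vle (x m) (x j)" using m leading_iff by auto
    have l: "lead_ac d \<alpha> \<beta> \<noteq> 0" using assms False by (auto simp: good_def \<alpha>)
    define u where "u = ?S / x m"
    have S: "?S = u * x m" using m' by (simp add: u_def)
    note R = res_sum_div_leading[OF m, folded u_def]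
    have u: "vle u 1" using R l m' res_eq_0[of u] by auto
    have u0: "u \<noteq> 0" "v u = 0" using u R(1) by (auto simp: vle_def)
    have "ac ?S = lead_ac d \<alpha> \<beta>"
      unfolding S ac_mult using ac_unit[OF R(1) u] R(2) m' by simp
    moreover have vS: "v ?S = v (x m)" "?S \<noteq> 0" unfolding S using u0 m' by (auto simp: v_mult)
    moreover have "lead_val d \<alpha> \<beta> = v (x m)"
      unfolding lead_val_def
    proof (subst leading_value_eq[of _ _ _ "v (x m)"])
      fix i assume "i < Suc d" "leading d \<alpha> \<beta> i"
      then show "\<beta> i = v (x m)" using m m'
        by (metis \<beta> leading_iff less_Suc_eq_le order_antisym vle_def)
    qed (use m in \<open>auto simp: less_Suc_eq_le\<close>)
    moreover have "vle ?S (x m)" using vS m' by (simp add: vle_def)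
    ultimately show ?thesis using m'(2) vle_trans by (auto simp: val0_def)
  qed
  then show "ac ?S = lead_ac d \<alpha> \<beta>" "val0 ?S = lead_val d \<alpha> \<beta>" "j \<le> d \<Longrightarrow> vle ?S (x j)"
    by blast+
qed

lemma not_good_sum:
  assumes "\<not> good d \<alpha> \<beta>"
  shows "\<exists>m\<le>d. leading d \<alpha> \<beta> m \<and> \<not> vle (\<Sum>i\<le>d. x i) (x m)"
proof -
  obtain m where m: "m \<le> d" "leading d \<alpha> \<beta> m" using ex_leading assms
    by (auto simp: good_def \<alpha>)
  have "x m \<noteq> 0" using m leading_iff by auto
  moreover have "res ((\<Sum>i\<le>d. x i) / x m) = 0"
    using res_sum_div_leading(2)[OF m] assms by (simp add: good_def)
  then have "\<not> vle ((\<Sum>i\<le>d. x i) / x m) 1"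
    using res_sum_div_leading(1)[OF m] res_eq_0 by blast
  ultimately have "\<not> vle (\<Sum>i\<le>d. x i) (x m)"
    using vle_mult_cancel[of "x m" "(\<Sum>i\<le>d. x i) / x m" 1] by simp
  then show ?thesis using m by blast
qed

lemma good_if_vle: "(\<And>i. i \<le> d \<Longrightarrow> vle (\<Sum>i\<le>d. x i) (x i)) \<Longrightarrow> good d \<alpha> \<beta>"
  using not_good_sum by blast

end

section \<open>Taylor expansions and good centres\<close>

abbreviation taylor :: "'k poly \<Rightarrow> 'k \<Rightarrow> nat \<Rightarrow> 'k" where
  "taylor p c i \<equiv> coeff (pcompose p [:c, 1:]) i"

lemma taylor_0: "taylor p c 0 = poly p c"
  by simp

lemma taylor_1: "taylor p c 1 = poly (pderiv p) c"
proof -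
  have "coeff (pderiv (pcompose p [:c, 1:])) 0 = coeff (pcompose (pderiv p) [:c, 1:]) 0"
    by (simp add: pderiv_pcompose pderiv_pCons)
  then show ?thesis by (simp add: coeff_pderiv)
qed

lemma taylor_pderiv: "taylor (pderiv p) c i = of_nat (Suc i) * taylor p c (Suc i)"
proof -
  have "pderiv (pcompose p [:c, 1:]) = pcompose (pderiv p) [:c, 1:]"
    by (simp add: pderiv_pcompose pderiv_pCons)
  then show ?thesis using coeff_pderiv[of "pcompose p [:c, 1:]" i] by simp
qed

lemma taylor_eq_0: "degree p < i \<Longrightarrow> taylor p c i = 0"
  by (rule coeff_eq_0) (simp add: degree_pcompose)

lemma poly_eq_sum_le: "degree p \<le> d \<Longrightarrow> poly p x = (\<Sum>i\<le>d. coeff p i * x ^ i)"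
  for x :: 'k
  unfolding poly_altdef by (rule sum.mono_neutral_left) (auto simp: not_le coeff_eq_0)

lemma poly_taylor: "degree p \<le> d \<Longrightarrow> poly p (c + s) = (\<Sum>i\<le>d. taylor p c i * s ^ i)"
proof -
  assume "degree p \<le> d"
  then have "poly (pcompose p [:c, 1:]) s = (\<Sum>i\<le>d. taylor p c i * s ^ i)"
    by (intro poly_eq_sum_le) (simp add: degree_pcompose)
  then show ?thesis by (simp add: poly_pcompose add.commute)
qed

text \<open>Re-expansion at another point has integral binomial coefficients; with \<open>c = 0\<close> it also expresses
  the Taylor coefficients as polynomials in the centre.\<close>

lemma taylor_shift:
  assumes "degree p \<le> d"
  shows "taylor p (c + s) i = (\<Sum>l\<le>d. of_nat (l choose i) * taylor p c l * s ^ (l - i))"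
proof -
  let ?q = "pcompose p [:c, 1:]"
  have q: "?q = (\<Sum>l\<le>d. smult (coeff ?q l) (monom 1 l))"
    using assms by (intro poly_eqI)
      (auto simp: coeff_sum degree_pcompose if_distrib not_le coeff_eq_0 cong: if_cong)
  have m: "pcompose (monom 1 l) [:s, 1:] = [:s, 1:] ^ l" for l
    by (induction l) (simp_all add: monom_Suc monom_0 pcompose_pCons pcompose_1 flip: one_pCons)
  have b: "coeff ([:s, 1:] ^ l) i = of_nat (l choose i) * s ^ (l - i)" for l i
  proof (induction l arbitrary: i)
    case (Suc l)
    show ?case
    proof (cases i)
      case (Suc j)
      show ?thesis
      proof (cases "j < l")
        case True
        then have "s ^ (l - j) = s * s ^ (l - Suc j)" by (simp add: Suc_diff_Suc flip: power_Suc)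
        then show ?thesis using Suc Suc.IH True by (simp add: algebra_simps)
      next
        case False
        then show ?thesis using Suc Suc.IH by (cases "j = l") (simp_all add: binomial_eq_0)
      qed
    qed (use Suc.IH in simp)
  qed (auto simp: coeff_eq_0 binomial_eq_0 not_less split: nat.splits)
  have "pcompose p [:c + s, 1:] = pcompose ?q [:s, 1:]"
    by (simp add: pcompose_assoc[symmetric] pcompose_pCons)
  also have "\<dots> = (\<Sum>l\<le>d. smult (coeff ?q l) ([:s, 1:] ^ l))"
    by (subst q) (simp add: pcompose_sum pcompose_smult m)
  finally show ?thesis by (simp add: coeff_sum b mult_ac)
qed

lemma vle_taylor_shift:
  assumes "\<And>i. vle x (taylor p c i * s ^ i)"
  shows "vle x (taylor p (c + s) i * s ^ i)"
proof -
  have "vle x (of_nat (l choose i) * taylor p c l * s ^ (l - i) * s ^ i)" for l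
  proof (cases "i \<le> l")
    case True
    have "of_nat (l choose i) * taylor p c l * s ^ (l - i) * s ^ i
        = of_nat (l choose i) * (taylor p c l * s ^ l)"
      using True by (simp flip: power_add add: mult.assoc)
    then show ?thesis using True assms[of l] by (metis vle_of_nat_mult binomial_eq_0_iff not_le)
  qed (simp add: binomial_eq_0)
  then show ?thesis
    by (subst taylor_shift[OF order_refl]) (auto simp: sum_distrib_right intro!: vle_sum)
qed

text \<open>A lower bound for the values of all Taylor terms does not depend on which end of the step \<open>s\<close> is
  used as the centre.\<close>

lemma vle_taylor_shift_iff:
  "(\<forall>i. vle x (taylor p (c + s) i * s ^ i)) \<longleftrightarrow> (\<forall>i. vle x (taylor p c i * s ^ i))"
proof -
  have "vle x (a * (- s) ^ i) \<longleftrightarrow> vle x (a * s ^ i)" for a i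
    by (cases "even i") simp_all
  then show ?thesis
    using vle_taylor_shift[of x p c s] vle_taylor_shift[of x p "c + s" "- s"] by auto
qed

lemma vle_taylor_pderiv:
  assumes "\<And>j. vle x (taylor (pderiv p) c j * s ^ j)" "1 \<le> i"
  shows "vle (x * s) (taylor p c i * s ^ i)"
proof -
  obtain j where j: "i = Suc j" using assms(2) by (cases i) auto
  have "vle x (of_nat (Suc j) * (taylor p c (Suc j) * s ^ j))"
    using assms(1)[of j] unfolding taylor_pderiv by (simp only: mult.assoc)
  then have "vle (s * x) (s * (taylor p c (Suc j) * s ^ j))"
    unfolding vle_of_nat_mult[OF nat.distinct(2)] by (rule vle_mult_left)
  then show ?thesis by (simp only: j mult_ac power_Suc)
qed

text \<open>The centre is \<open>t - s\<close>. The coefficients are those at \<open>t\<close>, so that the centre enters only through the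
  size of \<open>s\<close>; by \<open>vle_taylor_shift_iff\<close> the coefficients at the centre could be used as well.\<close>

definition good_center :: "'k poly \<Rightarrow> 'k \<Rightarrow> 'k \<Rightarrow> bool" where
  "good_center p t s \<longleftrightarrow> (\<forall>i. vle (poly p t) (taylor p t i * s ^ i))"

lemma good_center_closer: "good_center p t s \<Longrightarrow> vle s s' \<Longrightarrow> good_center p t s'"
  unfolding good_center_def using vle_trans[OF _ vle_mult_left[OF vle_power]] by blast

text \<open>Newton's criterion: the polynomial \<open>p (t + s * u) / (b\<^sub>1 * s)\<close> in \<open>u\<close>, with \<open>b\<^sub>1\<close> the linear Taylor
  coefficient at \<open>t\<close>, is integral with small constant coefficient and linear coefficient \<open>1\<close>.\<close>

lemma henselian_root:
  assumes 1: "\<And>i. 1 \<le> i \<Longrightarrow> vle (taylor p t 1 * s) (taylor p t i * s ^ i)"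
    and 0: "\<not> vle (poly p t) (taylor p t 1 * s)"
  shows "\<exists>u. \<not> vle u 1 \<and> poly p (t + s * u) = 0"
proof -
  define e where "e = taylor p t 1 * s"
  have e: "e \<noteq> 0" using 0 by (auto simp: e_def)
  have small: "\<not> vle (taylor p t 0) e" using 0 by (simp add: e_def)
  define f where "f = smult (1 / e) (pcompose (pcompose p [:t, 1:]) [:0, s:])"
  have c: "coeff f i * e = taylor p t i * s ^ i" for i
    using e by (simp add: f_def coeff_pcompose_linear)
  have "vle (1 * e) (coeff f i * e)" for i
    unfolding c using 1[of i] small vle_total[of "taylor p t 0" e] by (cases i) (auto simp: e_def)
  then have "vle 1 (coeff f i)" for i
    using vle_mult_cancel[OF e, of 1 "coeff f i"] by (simp add: mult.commute)
  then have i: "\<forall>i. coeff f i \<in> val_ring v" by (simp add: val_ring_iff)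
  have "\<not> vle (coeff f 0 * e) (1 * e)" using small unfolding c by simp
  then have "\<not> vle (poly f 0) 1"
    using vle_mult_cancel[OF e, of "coeff f 0" 1] by (simp add: mult.commute poly_0_coeff_0)
  moreover have "coeff f 1 * e = e" unfolding c by (simp add: e_def)
  then have "poly (pderiv f) 0 = 1" using e by (simp add: poly_0_coeff_0 coeff_pderiv)
  ultimately obtain u where "poly f u = 0" "u - 0 \<in> val_max_ideal v"
    using henselian i unfolding henselian_valuation_def
    by (metis val_max_ideal_iff val_ring_iff vle_0_right vle_refl)
  then show ?thesis using e
    by (intro exI[of _ u]) (auto simp: f_def poly_pcompose val_max_ideal_iff add.commute mult.commute)
qed

text \<open>
  Induction on the degree: let \<open>c\<close> be a good centre of \<open>pderiv p\<close> and \<open>s = t - c\<close>. Then the value of the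
  linear term \<open>w\<close> is at most that of all later terms \<open>taylor p t i * s ^ i\<close>, because the factors \<open>i\<close>
  from the derivative are units. Either \<open>c\<close> is good for \<open>p\<close>, or \<open>p t\<close> has a larger value than \<open>w\<close>. In
  the latter case Hensel's lemma gives a root \<open>t + s * u\<close> with small \<open>u\<close>, which is the new centre. In
  \<open>0 = p (t + s * u)\<close> only the terms \<open>p t\<close> and \<open>w * u\<close> can balance, so \<open>p t\<close> has the value of \<open>w * u\<close>,
  and the values of the other terms are at least that.
\<close>

lemma ex_good_center:
  "\<exists>c. good_center p t (t - c) \<and>
    (c = 0 \<or> (\<exists>i\<le>degree p. (pderiv ^^ i) p \<noteq> 0 \<and> poly ((pderiv ^^ i) p) c = 0))"
proof (induction "degree p" arbitrary: p)
  case 0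
  then have z: "taylor p t i = 0" if "i \<noteq> 0" for i using that by (intro taylor_eq_0) auto
  have "vle (poly p t) (taylor p t i * (t - 0) ^ i)" for i
    using z[of i] by (cases "i = 0") simp_all
  then have "good_center p t (t - 0)" unfolding good_center_def by blast
  then show ?case by blast
next
  case (Suc n)
  have "n = degree (pderiv p)" using Suc.hyps(2) by (simp add: degree_pderiv)
  from Suc.hyps(1)[OF this] obtain c where c: "good_center (pderiv p) t (t - c)"
    "c = 0 \<or> (\<exists>i\<le>n. (pderiv ^^ i) (pderiv p) \<noteq> 0 \<and> poly ((pderiv ^^ i) (pderiv p)) c = 0)"
    using \<open>n = degree (pderiv p)\<close> by auto
  have c': "c = 0 \<or> (\<exists>i\<le>degree p. (pderiv ^^ i) p \<noteq> 0 \<and> poly ((pderiv ^^ i) p) c = 0)"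
  proof (rule disjE[OF c(2)])
    assume "\<exists>i\<le>n. (pderiv ^^ i) (pderiv p) \<noteq> 0 \<and> poly ((pderiv ^^ i) (pderiv p)) c = 0"
    then obtain i where "i \<le> n" "(pderiv ^^ Suc i) p \<noteq> 0" "poly ((pderiv ^^ Suc i) p) c = 0"
      unfolding funpow_Suc_right o_apply by blast
    then show ?thesis unfolding Suc.hyps(2)[symmetric] by (meson Suc_le_mono)
  qed simp
  define s where "s = t - c"
  have 1: "vle (taylor p t 1 * s) (taylor p t i * s ^ i)" if "1 \<le> i" for i
    using c(1) that unfolding good_center_def taylor_1 s_def by (intro vle_taylor_pderiv) auto
  show ?case
  proof (cases "vle (poly p t) (taylor p t 1 * s)")
    case True
    have "vle (poly p t) (taylor p t i * s ^ i)" for i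
      using vle_trans[OF True 1[of i]] by (cases "i = 0") simp_all
    then show ?thesis using c' by (auto simp: good_center_def s_def)
  next
    case False
    from henselian_root[OF 1 this] obtain u where u: "\<not> vle u 1" "poly p (t + s * u) = 0"
      by blast
    define w where "w = taylor p t 1 * s"
    have w: "w \<noteq> 0" using False by (auto simp: w_def)
    have uu: "vle 1 u" using u vle_total by blast
    have 2: "vle (w * u ^ 2) (taylor p t i * (s * u) ^ i)" if "2 \<le> i" for i
    proof -
      have "vle (w * u ^ 2) (w * u ^ i)"
      proof (rule vle_mult_left)
        have "vle (u ^ 2 * 1 ^ (i - 2)) (u ^ 2 * u ^ (i - 2))"
          by (intro vle_mult_left vle_power uu)
        then show "vle (u ^ 2) (u ^ i)" using that
            by (metis le_add_diff_inverse power_add power_one mult.right_neutral)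
      qed
      also have "vle (w * u ^ i) (taylor p t i * (s * u) ^ i)"
        using vle_mult[OF 1[of i] vle_refl[of "u ^ i"]] that
        by (simp add: w_def power_mult_distrib mult.assoc)
      finally show ?thesis .
    qed
    let ?d = "degree p"
    obtain n' where d: "?d = Suc n'" using Suc.hyps(2) by metis
    define F where "F i = taylor p t i * (s * u) ^ i" for i
    have "sum F {..?d} = 0"
      using u(2) poly_taylor[OF order_refl, of p t "s * u"] by (simp add: F_def)
    moreover have "sum F {..?d} = F 0 + sum F {Suc 0..?d}"
      unfolding d atMost_atLeast0 by (rule sum.atLeast_Suc_atMost) simp
    moreover have "sum F {Suc 0..?d} = F 1 + sum F {2..?d}"
      unfolding d numeral_2_eq_2 One_nat_def by (rule sum.atLeast_Suc_atMost) simp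
    moreover have "F 0 = poly p t" "F 1 = w * u" by (simp_all add: F_def w_def mult.assoc)
    ultimately have "poly p t + w * u + sum F {2..?d} = 0" by linarith
    then have sum0: "poly p t + w * u + (\<Sum>i\<in>{2..?d}. taylor p t i * (s * u) ^ i) = 0"
      unfolding F_def .
    have tail: "vle (w * u ^ 2) (\<Sum>i\<in>{2..?d}. taylor p t i * (s * u) ^ i)"
      by (intro vle_sum 2) simp
    \<comment> \<open>otherwise \<open>w * u\<close> would equal a sum of terms of larger value\<close>
    have p0: "vle (poly p t) (w * u)"
    proof (rule ccontr)
      assume neg: "\<not> vle (poly p t) (w * u)"
      then have "w * u \<noteq> 0" by auto
      have neg': "\<not> vle (w * u ^ 2) (w * u)"
        using u(1) \<open>w * u \<noteq> 0\<close> vle_mult_cancel[of "w * u" u 1] by (simp add: power2_eq_square mult.assoc)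
      define S where "S = (\<Sum>i\<in>{2..?d}. taylor p t i * (s * u) ^ i)"
      have "w * u = - (poly p t + S)"
        using sum0 unfolding S_def[symmetric] by linarith
      then have *: "vle x (w * u) \<longleftrightarrow> vle x (poly p t + S)" for x by (simp only: vle_minus_right)
      show False
      proof (cases "vle (poly p t) (w * u ^ 2)")
        case True
        then have "vle (poly p t) S" using vle_trans[OF True tail] by (simp add: S_def)
        then have "vle (poly p t) (poly p t + S)" by (rule vle_add[OF vle_refl])
        then show ?thesis using neg * by blast
      next
        case False
        then have "vle (w * u ^ 2) (poly p t)" using vle_total by blast
        then have "vle (w * u ^ 2) (poly p t + S)" unfolding S_def using tail by (rule vle_add)
        then show ?thesis using neg' * by blast
      qed
    qed
    have "vle (poly p t) (taylor p t i * (t - (t + s * u)) ^ i)" for i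
    proof -
      have "vle (poly p t) (taylor p t i * (s * u) ^ i)"
      proof (cases "i < 2")
        case True
        then have "i = 0 \<or> i = 1" by auto
        then show ?thesis using p0 by (auto simp: w_def mult.assoc)
      next
        case False
        have "vle (w * u) (w * u ^ 2)"
          unfolding power2_eq_square mult.assoc[symmetric] using vle_mult_left[OF uu, of "w * u"] by simp
        then show ?thesis using 2[of i] False vle_trans[OF vle_trans[OF p0]] by simp
      qed
      moreover have "(t - (t + s * u)) ^ i = (if even i then 1 else - 1) * (s * u) ^ i"
        by (simp add: power_minus')
      ultimately show ?thesis by (cases "even i") auto
    qed
    then have "good_center p t (t - (t + s * u))" by (simp add: good_center_def)
    moreover have "p \<noteq> 0" using Suc.hyps(2) by auto
    ultimately show ?thesis using u(2)
      by (intro exI[of _ "t + s * u"] conjI disjI2 exI[of _ 0]) simp_all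
  qed
qed

text \<open>Of two centres, the one closer to \<open>t\<close> is good for both polynomials.\<close>

lemma ex_common_good_center:
  assumes "finite S"
  shows "\<exists>c. (\<forall>p\<in>S. good_center p t (t - c)) \<and>
    (c = 0 \<or> (\<exists>p\<in>S. \<exists>i\<le>degree p. (pderiv ^^ i) p \<noteq> 0 \<and> poly ((pderiv ^^ i) p) c = 0))"
  using assms
proof (induction rule: finite_induct)
  case (insert p S)
  then obtain c where c: "\<And>p. p\<in>S \<Longrightarrow> good_center p t (t - c)"
    "c = 0 \<or> (\<exists>p\<in>S. \<exists>i\<le>degree p. (pderiv ^^ i) p \<noteq> 0 \<and> poly ((pderiv ^^ i) p) c = 0)" by blast
  obtain c' where c': "good_center p t (t - c')"
    "c' = 0 \<or> (\<exists>i\<le>degree p. (pderiv ^^ i) p \<noteq> 0 \<and> poly ((pderiv ^^ i) p) c' = 0)"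
    using ex_good_center by blast
  show ?case using vle_total[of "t - c" "t - c'"]
  proof
    assume "vle (t - c) (t - c')"
    then have "\<forall>q\<in>insert p S. good_center q t (t - c')"
      using c'(1) good_center_closer[OF c(1)] by simp
    then show ?thesis using c'(2) by (intro exI[of _ c']) auto
  next
    assume "vle (t - c') (t - c)"
    then have "\<forall>q\<in>insert p S. good_center q t (t - c)"
      using c(1) good_center_closer[OF c'(1)] by simp
    then show ?thesis using c(2) by (intro exI[of _ c]) auto
  qed
qed blast

section \<open>Leading terms of polynomial values\<close>

text \<open>The natural multiple \<open>n * \<gamma>\<close> in the ordered group.\<close>

primrec nmul :: "nat \<Rightarrow> 'g \<Rightarrow> 'g" where
  "nmul 0 \<gamma> = 0"
| "nmul (Suc n) \<gamma> = \<gamma> + nmul n \<gamma>"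

lemma v_power: "x \<noteq> 0 \<Longrightarrow> v (x ^ n) = nmul n (v x)"
  by (induction n) (simp_all add: v_mult)

text \<open>Leading term data of the Taylor terms of \<open>p (c + s)\<close>, for any \<open>s\<close> with \<open>ac s = \<rho>\<close> and \<open>v s = \<gamma>\<close>.\<close>

definition term_ac :: "'k poly \<Rightarrow> 'k \<Rightarrow> 'r \<Rightarrow> nat \<Rightarrow> 'r" where
  "term_ac p c \<rho> i = ac (taylor p c i) * \<rho> ^ i"

definition term_val :: "'k poly \<Rightarrow> 'k \<Rightarrow> 'g \<Rightarrow> nat \<Rightarrow> 'g" where
  "term_val p c \<gamma> i = val0 (taylor p c i) + nmul i \<gamma>"

lemma term_ac_eq: "term_ac p c (ac s) i = ac (taylor p c i * s ^ i)"
  by (simp add: term_ac_def ac_mult ac_power)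

lemma term_val_eq: "taylor p c i * s ^ i \<noteq> 0 \<Longrightarrow> s \<noteq> 0 \<Longrightarrow> term_val p c (v s) i = v (taylor p c i * s ^ i)"
  by (simp add: term_val_def v_mult v_power val0_def)

abbreviation pgood :: "nat \<Rightarrow> 'k poly \<Rightarrow> 'k \<Rightarrow> 'r \<Rightarrow> 'g \<Rightarrow> bool" where
  "pgood d p c \<rho> \<gamma> \<equiv> good d (term_ac p c \<rho>) (term_val p c \<gamma>)"

text \<open>This is \<open>good_sum\<close> for the Taylor expansion of \<open>p (c + s)\<close> at \<open>c\<close>.\<close>

lemma pgood_values:
  assumes "degree p \<le> d" "s \<noteq> 0" "pgood d p c (ac s) (v s)"
  shows "ac (poly p (c + s)) = lead_ac d (term_ac p c (ac s)) (term_val p c (v s))"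
    and "val0 (poly p (c + s)) = lead_val d (term_ac p c (ac s)) (term_val p c (v s))"
    and "good_center p (c + s) s"
proof -
  note L = good_sum[of d "term_ac p c (ac s)" "\<lambda>i. taylor p c i * s ^ i" "term_val p c (v s)",
      OF term_ac_eq term_val_eq[OF _ assms(2)] assms(3), folded poly_taylor[OF assms(1)]]
  show "ac (poly p (c + s)) = lead_ac d (term_ac p c (ac s)) (term_val p c (v s))"
    "val0 (poly p (c + s)) = lead_val d (term_ac p c (ac s)) (term_val p c (v s))"
    using L(1,2) by blast+
  have "vle (poly p (c + s)) (taylor p c i * s ^ i)" for i
  proof (cases "i \<le> d")
    case False
    then show ?thesis using assms(1) by (simp add: taylor_eq_0)
  qed (rule L(3))
  then show "good_center p (c + s) s"
    unfolding good_center_def using vle_taylor_shift_iff by blast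
qed

lemma good_center_imp_pgood:
  assumes "degree p \<le> d" "s \<noteq> 0" "good_center p (c + s) s"
  shows "pgood d p c (ac s) (v s)"
proof -
  have "vle (poly p (c + s)) (taylor p c i * s ^ i)" for i
    using assms(3) unfolding good_center_def using vle_taylor_shift_iff by blast
  then show ?thesis
    by (intro good_if_vle[of d "term_ac p c (ac s)" "\<lambda>i. taylor p c i * s ^ i" "term_val p c (v s)"])
      (simp_all add: term_ac_eq term_val_eq assms(2) flip: poly_taylor[OF assms(1)])
qed

text \<open>
  Since \<open>c\<close> is good for \<open>pderiv p\<close>, the value of \<open>s * poly (pderiv p) t\<close> is at most that of all
  Taylor terms of positive degree. If the leading terms cancel, \<open>p t\<close> has a larger value than these
  terms, so Hensel's lemma applies at \<open>t = c + s\<close>, and it moves \<open>s\<close> by a factor \<open>1 + u\<close> with small \<open>u\<close>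
  only.
\<close>

lemma ex_root_if_not_pgood:
  assumes d: "degree p \<le> d" "degree (pderiv p) \<le> d'" and s: "s \<noteq> 0"
    and g': "pgood d' (pderiv p) c (ac s) (v s)" and g: "\<not> pgood d p c (ac s) (v s)"
  shows "\<exists>s'. s' \<noteq> 0 \<and> ac s' = ac s \<and> v s' = v s \<and> poly p (c + s') = 0"
proof -
  define t where "t = c + s"
  have gc: "good_center (pderiv p) t s" using pgood_values(3)[OF d(2) s g'] by (simp add: t_def)
  have 1: "vle (taylor p t 1 * s) (taylor p t i * s ^ i)" if "1 \<le> i" for i
    using gc that unfolding good_center_def taylor_1 by (intro vle_taylor_pderiv) auto
  have "vle (poly (pderiv p) t) (taylor (pderiv p) c i * s ^ i)" for i
    using gc vle_taylor_shift_iff[of _ "pderiv p" c s] unfolding good_center_def t_def by blast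
  then have 2: "vle (taylor p t 1 * s) (taylor p c i * s ^ i)" if "1 \<le> i" for i
    using that unfolding taylor_1 by (intro vle_taylor_pderiv)
  obtain m where m: "m \<le> d" "leading d (term_ac p c (ac s)) (term_val p c (v s)) m"
    "\<not> vle (poly p t) (taylor p c m * s ^ m)"
    using not_good_sum[of d "term_ac p c (ac s)" "\<lambda>i. taylor p c i * s ^ i" "term_val p c (v s)",
        OF term_ac_eq term_val_eq[OF _ s] g]
    unfolding t_def poly_taylor[OF d(1)] by blast
  have 0: "\<not> vle (poly p t) (taylor p t 1 * s)"
  proof (cases m)
    case (Suc i)
    then show ?thesis using m(3) 2[of m] vle_trans by auto
  next
    case 0
    \<comment> \<open>the constant term is \<open>p t\<close> minus the later terms, so one of them has a smaller value than \<open>p t\<close>\<close>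
    show ?thesis
    proof
      assume *: "vle (poly p t) (taylor p t 1 * s)"
      have "vle (poly p t) (taylor p c i * s ^ i)" if "1 \<le> i" for i
        using vle_trans[OF * 2[OF that]] .
      then have "vle (poly p t) (\<Sum>i\<in>{1..d}. taylor p c i * s ^ i)"
        by (intro vle_sum) simp
      moreover have "poly p t = taylor p c 0 * s ^ 0 + (\<Sum>i\<in>{1..d}. taylor p c i * s ^ i)"
        unfolding t_def poly_taylor[OF d(1)] atMost_atLeast0 by (simp add: sum.atLeast_Suc_atMost)
      ultimately have "vle (poly p t) (taylor p c 0 * s ^ 0)"
        by (metis add_diff_cancel_right' diff_conv_add_uminus vle_add vle_minus_right vle_refl)
      then show False using m(3) 0 by blast
    qed
  qed
  from henselian_root[OF 1 0] obtain u where u: "\<not> vle u 1" "poly p (t + s * u) = 0" by blast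
  have uu: "vle 1 u" using u vle_total by blast
  have r: "res (1 + u) = 1" using res_add[OF vle_refl uu] res_eq_0[OF uu] u(1) by simp
  have u1: "vle 1 (1 + u)" using uu by (simp add: vle_add)
  have u2: "vle (1 + u) 1" using r res_eq_0[OF u1] by auto
  have "ac (1 + u) = 1" "1 + u \<noteq> 0" "v (1 + u) = 0"
    using ac_unit[OF u1 u2] r u1 u2 by (auto simp: vle_def)
  then have "s * (1 + u) \<noteq> 0" "ac (s * (1 + u)) = ac s" "v (s * (1 + u)) = v s"
    using s by (simp_all only: ac_mult v_mult mult_eq_0_iff simp_thms) simp_all
  moreover have "poly p (c + s * (1 + u)) = 0"
    using u(2) by (simp add: t_def algebra_simps)
  ultimately show ?thesis by blast
qed

text \<open>At a root, goodness would force all Taylor terms to vanish.\<close>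

lemma not_pgood_root:
  assumes "degree p \<le> d" "p \<noteq> 0" "s \<noteq> 0" "poly p (c + s) = 0"
  shows "\<not> pgood d p c (ac s) (v s)"
proof
  assume "pgood d p c (ac s) (v s)"
  from pgood_values(3)[OF assms(1,3) this] have "vle (poly p (c + s)) (taylor p (c + s) i * s ^ i)" for i
    by (simp add: good_center_def)
  then have "pcompose p [:c + s, 1:] = 0"
    using assms(3,4) by (intro poly_eqI) simp
  then show False using assms(2) by (simp add: pcompose_eq_0_iff)
qed

end


section \<open>Formulas without field sort\<close>

text \<open>Both sorts may occur in one formula here; they are separated only at the end.\<close>

primrec pure_fm :: "fm \<Rightarrow> bool" where
  "pure_fm Falsum \<longleftrightarrow> True"
| "pure_fm (EqF s t) \<longleftrightarrow> False"
| "pure_fm (LessF s t) \<longleftrightarrow> False"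
| "pure_fm (EqR s t) \<longleftrightarrow> pure_rterm s \<and> pure_rterm t"
| "pure_fm (LessR s t) \<longleftrightarrow> pure_rterm s \<and> pure_rterm t"
| "pure_fm (EqV s t) \<longleftrightarrow> pure_vterm s \<and> pure_vterm t"
| "pure_fm (LessV s t) \<longleftrightarrow> pure_vterm s \<and> pure_vterm t"
| "pure_fm (Neg \<phi>) \<longleftrightarrow> pure_fm \<phi>"
| "pure_fm (And \<phi> \<psi>) \<longleftrightarrow> pure_fm \<phi> \<and> pure_fm \<psi>"
| "pure_fm (Or \<phi> \<psi>) \<longleftrightarrow> pure_fm \<phi> \<and> pure_fm \<psi>"
| "pure_fm (ExF i \<phi>) \<longleftrightarrow> False"
| "pure_fm (ExR i \<phi>) \<longleftrightarrow> pure_fm \<phi>"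
| "pure_fm (ExV i \<phi>) \<longleftrightarrow> pure_fm \<phi>"

lemma finite_rvars [simp]: "finite (rvars t)" by (induction t) auto
lemma finite_vvars [simp]: "finite (vvars t)" by (induction t) auto
lemma finite_freeR [simp]: "finite (freeR \<phi>)" by (induction \<phi>) auto
lemma finite_freeV [simp]: "finite (freeV \<phi>)" by (induction \<phi>) auto

lemma finite_fvars [simp]: "finite (fvars t)" by (induction t) auto
lemma finite_fvars_r [simp]: "finite (fvars_r t)" by (induction t) auto
lemma finite_fvars_v [simp]: "finite (fvars_v t)" by (induction t) auto
lemma finite_freeF [simp]: "finite (freeF \<phi>)" by (induction \<phi>) auto

lemma ex_fresh: "finite A \<Longrightarrow> \<exists>j::nat. j \<notin> A"
  by (rule ex_new_if_finite) simp_all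

lemma eval_r_cong: "pure_rterm t \<Longrightarrow> (\<And>i. i \<in> rvars t \<Longrightarrow> y i = y' i) \<Longrightarrow> eval_r K x y t = eval_r K x' y' t"
  by (induction t) auto

lemma eval_v_cong: "pure_vterm t \<Longrightarrow> (\<And>i. i \<in> vvars t \<Longrightarrow> z i = z' i) \<Longrightarrow> eval_v K x z t = eval_v K x' z' t"
  by (induction t) auto

lemma sat_cong:
  "pure_fm \<phi> \<Longrightarrow> (\<And>i. i \<in> freeR \<phi> \<Longrightarrow> y i = y' i) \<Longrightarrow> (\<And>i. i \<in> freeV \<phi> \<Longrightarrow> z i = z' i) \<Longrightarrow>
    sat K x y z \<phi> \<longleftrightarrow> sat K x' y' z' \<phi>"
proof (induction \<phi> arbitrary: y y' z z')
  case (EqR s t)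
  then show ?case using eval_r_cong[of s y y' K x x'] eval_r_cong[of t y y' K x x'] by simp
next
  case (LessR s t)
  then show ?case using eval_r_cong[of s y y' K x x'] eval_r_cong[of t y y' K x x'] by simp
next
  case (EqV s t)
  then show ?case using eval_v_cong[of s z z' K x x'] eval_v_cong[of t z z' K x x'] by simp
next
  case (LessV s t)
  then show ?case using eval_v_cong[of s z z' K x x'] eval_v_cong[of t z z' K x x'] by simp
next
  case (Neg \<phi>)
  show ?case using Neg.IH[of y y' z z'] Neg.prems by simp
next
  case (And \<phi> \<psi>)
  show ?case using And.IH(1)[of y y' z z'] And.IH(2)[of y y' z z'] And.prems by simp
next
  case (Or \<phi> \<psi>)
  show ?case using Or.IH(1)[of y y' z z'] Or.IH(2)[of y y' z z'] Or.prems by simp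
next
  case (ExR i \<phi>)
  have "sat K x (y(i := a)) z \<phi> \<longleftrightarrow> sat K x' (y'(i := a)) z' \<phi>" for a
    using ExR.prems by (intro ExR.IH) auto
  then show ?case by simp
next
  case (ExV i \<phi>)
  have "sat K x y (z(i := a)) \<phi> \<longleftrightarrow> sat K x' y' (z'(i := a)) \<phi>" for a
    using ExV.prems by (intro ExV.IH) auto
  then show ?case by simp
qed simp_all

lemma eval_rterm_subst:
  "pure_rterm t \<Longrightarrow> eval_r K x y (rterm_subst \<sigma> t) = eval_r K x' (\<lambda>i. eval_r K x y (\<sigma> i)) t"
  by (induction t) auto

lemma eval_vterm_subst:
  "pure_vterm t \<Longrightarrow> eval_v K x z (vterm_subst \<sigma> t) = eval_v K x' (\<lambda>i. eval_v K x z (\<sigma> i)) t"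
  by (induction t) auto

lemma rterm_subst_syntax:
  "pure_rterm t \<Longrightarrow> fvars_r (rterm_subst \<sigma> t) = (\<Union>i\<in>rvars t. fvars_r (\<sigma> i))"
  "pure_rterm t \<Longrightarrow> rvars (rterm_subst \<sigma> t) = (\<Union>i\<in>rvars t. rvars (\<sigma> i))"
  "pure_rterm t \<Longrightarrow> \<forall>i. pure_rterm (\<sigma> i) \<Longrightarrow> pure_rterm (rterm_subst \<sigma> t)"
  by (induction t) auto

lemma vterm_subst_syntax:
  "pure_vterm t \<Longrightarrow> fvars_v (vterm_subst \<sigma> t) = (\<Union>i\<in>vvars t. fvars_v (\<sigma> i))"
  "pure_vterm t \<Longrightarrow> vvars (vterm_subst \<sigma> t) = (\<Union>i\<in>vvars t. vvars (\<sigma> i))"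
  "pure_vterm t \<Longrightarrow> \<forall>i. pure_vterm (\<sigma> i) \<Longrightarrow> pure_vterm (vterm_subst \<sigma> t)"
  by (induction t) auto

text \<open>Capture-avoiding substitution, by renaming bound variables.\<close>

lemma ex_pure_subst:
  assumes "pure_fm \<phi>" "\<forall>i. pure_rterm (\<sigma> i)" "\<forall>i. pure_vterm (\<tau> i)"
  shows "\<exists>\<phi>'. pure_fm \<phi>' \<and> freeR \<phi>' \<subseteq> (\<Union>i\<in>freeR \<phi>. rvars (\<sigma> i)) \<and>
    freeV \<phi>' \<subseteq> (\<Union>i\<in>freeV \<phi>. vvars (\<tau> i)) \<and>
    (\<forall>y z. sat K x y z \<phi>' \<longleftrightarrow> sat K x (\<lambda>i. eval_r K x y (\<sigma> i)) (\<lambda>i. eval_v K x z (\<tau> i)) \<phi>)"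
    (is "\<exists>\<phi>'. ?Q \<sigma> \<tau> \<phi> \<phi>'")
  using assms
proof (induction \<phi> arbitrary: \<sigma> \<tau>)
  case Falsum
  then show ?case by (intro exI[of _ Falsum]) auto
next
  case (EqR s t)
  then show ?case
    by (intro exI[of _ "EqR (rterm_subst \<sigma> s) (rterm_subst \<sigma> t)"])
      (auto simp: rterm_subst_syntax(2,3) eval_rterm_subst[where x' = x])
next
  case (LessR s t)
  then show ?case
    by (intro exI[of _ "LessR (rterm_subst \<sigma> s) (rterm_subst \<sigma> t)"])
      (auto simp: rterm_subst_syntax(2,3) eval_rterm_subst[where x' = x])
next
  case (EqV s t)
  then show ?case
    by (intro exI[of _ "EqV (vterm_subst \<tau> s) (vterm_subst \<tau> t)"])
      (auto simp: vterm_subst_syntax(2,3) eval_vterm_subst[where x' = x])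
next
  case (LessV s t)
  then show ?case
    by (intro exI[of _ "LessV (vterm_subst \<tau> s) (vterm_subst \<tau> t)"])
      (auto simp: vterm_subst_syntax(2,3) eval_vterm_subst[where x' = x])
next
  case (Neg \<phi>)
  obtain \<phi>' where "?Q \<sigma> \<tau> \<phi> \<phi>'" using Neg.IH[of \<sigma> \<tau>] Neg.prems by auto
  then show ?case by (intro exI[of _ "Neg \<phi>'"]) simp
next
  case (And \<phi> \<psi>)
  obtain \<phi>' where 1: "?Q \<sigma> \<tau> \<phi> \<phi>'" using And.IH(1)[of \<sigma> \<tau>] And.prems by auto
  obtain \<psi>' where 2: "?Q \<sigma> \<tau> \<psi> \<psi>'" using And.IH(2)[of \<sigma> \<tau>] And.prems by auto
  show ?case using 1 2 by (intro exI[of _ "And \<phi>' \<psi>'"]) auto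
next
  case (Or \<phi> \<psi>)
  obtain \<phi>' where 1: "?Q \<sigma> \<tau> \<phi> \<phi>'" using Or.IH(1)[of \<sigma> \<tau>] Or.prems by auto
  obtain \<psi>' where 2: "?Q \<sigma> \<tau> \<psi> \<psi>'" using Or.IH(2)[of \<sigma> \<tau>] Or.prems by auto
  show ?case using 1 2 by (intro exI[of _ "Or \<phi>' \<psi>'"]) auto
next
  case (ExR i \<phi>)
  obtain j where j: "j \<notin> (\<Union>k\<in>freeR \<phi> - {i}. rvars (\<sigma> k))"
    using ex_fresh[of "\<Union>k\<in>freeR \<phi> - {i}. rvars (\<sigma> k)"] by auto
  have p: "\<forall>k. pure_rterm ((\<sigma>(i := RVar j)) k)" using ExR.prems by simp
  obtain \<phi>' where 1: "pure_fm \<phi>'" "freeR \<phi>' \<subseteq> (\<Union>k\<in>freeR \<phi>. rvars ((\<sigma>(i := RVar j)) k))"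
    "freeV \<phi>' \<subseteq> (\<Union>i\<in>freeV \<phi>. vvars (\<tau> i))"
    "\<And>y z. sat K x y z \<phi>' \<longleftrightarrow>
      sat K x (\<lambda>k. eval_r K x y ((\<sigma>(i := RVar j)) k)) (\<lambda>i. eval_v K x z (\<tau> i)) \<phi>"
    using ExR.IH[OF _ p ExR.prems(3)] ExR.prems(1) unfolding pure_fm.simps by blast
  have "sat K x (y(j := a)) z \<phi>' \<longleftrightarrow>
      sat K x ((\<lambda>k. eval_r K x y (\<sigma> k))(i := a)) (\<lambda>i. eval_v K x z (\<tau> i)) \<phi>" for y z a
    unfolding 1(4)
  proof (rule sat_cong)
    fix k assume k: "k \<in> freeR \<phi>"
    show "eval_r K x (y(j := a)) ((\<sigma>(i := RVar j)) k) = ((\<lambda>k. eval_r K x y (\<sigma> k))(i := a)) k"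
    proof (cases "k = i")
      case False
      then have "j \<notin> rvars (\<sigma> k)" using j k by auto
      then show ?thesis using False ExR.prems
        by (auto intro!: eval_r_cong)
    qed simp
  qed (use ExR.prems in auto)
  then show ?case using 1(1-3) by (intro exI[of _ "ExR j \<phi>'"]) (auto split: if_splits)
next
  case (ExV i \<phi>)
  obtain j where j: "j \<notin> (\<Union>k\<in>freeV \<phi> - {i}. vvars (\<tau> k))"
    using ex_fresh[of "\<Union>k\<in>freeV \<phi> - {i}. vvars (\<tau> k)"] by auto
  have p: "\<forall>k. pure_vterm ((\<tau>(i := VVar j)) k)" using ExV.prems by simp
  obtain \<phi>' where 1: "pure_fm \<phi>'" "freeV \<phi>' \<subseteq> (\<Union>k\<in>freeV \<phi>. vvars ((\<tau>(i := VVar j)) k))"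
    "freeR \<phi>' \<subseteq> (\<Union>i\<in>freeR \<phi>. rvars (\<sigma> i))"
    "\<And>y z. sat K x y z \<phi>' \<longleftrightarrow>
      sat K x (\<lambda>k. eval_r K x y (\<sigma> k)) (\<lambda>k. eval_v K x z ((\<tau>(i := VVar j)) k)) \<phi>"
    using ExV.IH[OF _ ExV.prems(2) p] ExV.prems(1) unfolding pure_fm.simps by blast
  have "sat K x y (z(j := a)) \<phi>' \<longleftrightarrow>
      sat K x (\<lambda>k. eval_r K x y (\<sigma> k)) ((\<lambda>i. eval_v K x z (\<tau> i))(i := a)) \<phi>" for y z a
    unfolding 1(4)
  proof (rule sat_cong)
    fix k assume k: "k \<in> freeV \<phi>"
    show "eval_v K x (z(j := a)) ((\<tau>(i := VVar j)) k) = ((\<lambda>k. eval_v K x z (\<tau> k))(i := a)) k"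
    proof (cases "k = i")
      case False
      then have "j \<notin> vvars (\<tau> k)" using j k by auto
      then show ?thesis using False ExV.prems
        by (auto intro!: eval_v_cong)
    qed simp
  qed (use ExV.prems in auto)
  then show ?case using 1(1-3) by (intro exI[of _ "ExV j \<phi>'"]) (auto split: if_splits)
qed simp_all

section \<open>Definable predicates\<close>

text \<open>
  Definability is a property of predicates on an arbitrary type \<open>'e\<close> of parameters: the predicate is
  a formula without field sort evaluated at functions from given sets \<open>R\<close> and \<open>G\<close>. Quantification
  passes from \<open>'e \<times> 'r\<close> or \<open>'e \<times> 'g\<close> to \<open>'e\<close>, and no names of variables have to be managed. Of the
  structure \<open>K\<close> only the operations of the types matter for such formulas.
\<close>

locale ovf_ac_language =
  fixes K :: "('k::linordered_field, 'r::linordered_field, 'g::linordered_ab_group_add) ovf_ac"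
begin

abbreviation psat :: "(nat \<Rightarrow> 'r) \<Rightarrow> (nat \<Rightarrow> 'g) \<Rightarrow> fm \<Rightarrow> bool" where
  "psat \<equiv> sat K (\<lambda>_. 0)"

abbreviation evr :: "(nat \<Rightarrow> 'r) \<Rightarrow> rterm \<Rightarrow> 'r" where "evr \<equiv> eval_r K (\<lambda>_. 0)"
abbreviation evv :: "(nat \<Rightarrow> 'g) \<Rightarrow> vterm \<Rightarrow> 'g" where "evv \<equiv> eval_v K (\<lambda>_. 0)"

definition definable :: "('e \<Rightarrow> 'r) set \<Rightarrow> ('e \<Rightarrow> 'g) set \<Rightarrow> ('e \<Rightarrow> bool) \<Rightarrow> bool" where
  "definable R G P \<longleftrightarrow> (\<exists>\<phi> b c. pure_fm \<phi> \<and> (\<forall>i\<in>freeR \<phi>. b i \<in> R) \<and> (\<forall>i\<in>freeV \<phi>. c i \<in> G) \<and>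
     (\<forall>e. P e \<longleftrightarrow> psat (\<lambda>i. b i e) (\<lambda>i. c i e) \<phi>))"

lemma definableI:
  assumes "pure_fm \<phi>" "\<And>i. i \<in> freeR \<phi> \<Longrightarrow> b i \<in> R" "\<And>i. i \<in> freeV \<phi> \<Longrightarrow> c i \<in> G"
    and "\<And>e. P e \<longleftrightarrow> psat (\<lambda>i. b i e) (\<lambda>i. c i e) \<phi>"
  shows "definable R G P"
  unfolding definable_def using assms by blast

lemma definableE:
  assumes "definable R G P"
  obtains \<phi> b c where "pure_fm \<phi>" "\<And>i. i \<in> freeR \<phi> \<Longrightarrow> b i \<in> R" "\<And>i. i \<in> freeV \<phi> \<Longrightarrow> c i \<in> G"
    and "\<And>e. P e \<longleftrightarrow> psat (\<lambda>i. b i e) (\<lambda>i. c i e) \<phi>"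
  using assms unfolding definable_def by blast

lemma subst_fm:
  assumes "pure_fm \<phi>" "\<forall>i. pure_rterm (\<sigma> i)" "\<forall>i. pure_vterm (\<tau> i)"
  obtains \<phi>' where "pure_fm \<phi>'" "freeR \<phi>' \<subseteq> (\<Union>i\<in>freeR \<phi>. rvars (\<sigma> i))"
    "freeV \<phi>' \<subseteq> (\<Union>i\<in>freeV \<phi>. vvars (\<tau> i))"
    "\<And>y z. psat y z \<phi>' \<longleftrightarrow> psat (\<lambda>i. evr y (\<sigma> i)) (\<lambda>i. evv z (\<tau> i)) \<phi>"
  using ex_pure_subst[OF assms, of K "\<lambda>_. 0"] by blast

lemma definable_mono: "definable R G P \<Longrightarrow> R \<subseteq> R' \<Longrightarrow> G \<subseteq> G' \<Longrightarrow> definable R' G' P"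
  unfolding definable_def by blast

lemma definable_comp:
  "definable R G P \<Longrightarrow> (\<And>f. f \<in> R \<Longrightarrow> f \<circ> h \<in> R') \<Longrightarrow> (\<And>f. f \<in> G \<Longrightarrow> f \<circ> h \<in> G') \<Longrightarrow>
    definable R' G' (\<lambda>e. P (h e))"
proof (elim definableE)
  fix \<phi> b c
  assume "\<And>f. f \<in> R \<Longrightarrow> f \<circ> h \<in> R'" "\<And>f. f \<in> G \<Longrightarrow> f \<circ> h \<in> G'"
    "pure_fm \<phi>" "\<And>i. i \<in> freeR \<phi> \<Longrightarrow> b i \<in> R" "\<And>i. i \<in> freeV \<phi> \<Longrightarrow> c i \<in> G"
    "\<And>e. P e \<longleftrightarrow> psat (\<lambda>i. b i e) (\<lambda>i. c i e) \<phi>"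
  then show "definable R' G' (\<lambda>e. P (h e))"
    by (intro definableI[of \<phi> "\<lambda>i. b i \<circ> h" _ "\<lambda>i. c i \<circ> h"]) simp_all
qed

lemma definable_False [intro, simp]: "definable R G (\<lambda>e. False)"
  by (rule definableI[of Falsum]) simp_all

lemma definable_not [intro]: "definable R G P \<Longrightarrow> definable R G (\<lambda>e. \<not> P e)"
proof (elim definableE)
  fix \<phi> b c
  assume "pure_fm \<phi>" "\<And>i. i \<in> freeR \<phi> \<Longrightarrow> b i \<in> R" "\<And>i. i \<in> freeV \<phi> \<Longrightarrow> c i \<in> G"
    "\<And>e. P e \<longleftrightarrow> psat (\<lambda>i. b i e) (\<lambda>i. c i e) \<phi>"
  then show "definable R G (\<lambda>e. \<not> P e)"
    by (intro definableI[of "Neg \<phi>" b _ c]) simp_all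
qed

lemma definable_True [intro, simp]: "definable R G (\<lambda>e. True)"
  by (rule definableI[of "Neg Falsum"]) simp_all

lemma definable_and [intro]:
  assumes "definable R G P" "definable R G Q"
  shows "definable R G (\<lambda>e. P e \<and> Q e)"
proof -
  obtain \<phi> b c where \<phi>: "pure_fm \<phi>" "\<And>i. i \<in> freeR \<phi> \<Longrightarrow> b i \<in> R" "\<And>i. i \<in> freeV \<phi> \<Longrightarrow> c i \<in> G"
    "\<And>e. P e \<longleftrightarrow> psat (\<lambda>i. b i e) (\<lambda>i. c i e) \<phi>" using assms(1) unfolding definable_def by blast
  obtain \<psi> b' c' where \<psi>: "pure_fm \<psi>" "\<And>i. i \<in> freeR \<psi> \<Longrightarrow> b' i \<in> R" "\<And>i. i \<in> freeV \<psi> \<Longrightarrow> c' i \<in> G"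
    "\<And>e. Q e \<longleftrightarrow> psat (\<lambda>i. b' i e) (\<lambda>i. c' i e) \<psi>" using assms(2) unfolding definable_def by blast
  obtain \<phi>' where \<phi>': "pure_fm \<phi>'" "freeR \<phi>' \<subseteq> (\<Union>i\<in>freeR \<phi>. {2 * i})"
    "freeV \<phi>' \<subseteq> (\<Union>i\<in>freeV \<phi>. {2 * i})"
    "\<And>y z. psat y z \<phi>' \<longleftrightarrow> psat (\<lambda>i. y (2 * i)) (\<lambda>i. z (2 * i)) \<phi>"
    using subst_fm[OF \<phi>(1), of "\<lambda>i. RVar (2 * i)" "\<lambda>i. VVar (2 * i)"] by auto
  obtain \<psi>' where \<psi>': "pure_fm \<psi>'" "freeR \<psi>' \<subseteq> (\<Union>i\<in>freeR \<psi>. {2 * i + 1})"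
    "freeV \<psi>' \<subseteq> (\<Union>i\<in>freeV \<psi>. {2 * i + 1})"
    "\<And>y z. psat y z \<psi>' \<longleftrightarrow> psat (\<lambda>i. y (2 * i + 1)) (\<lambda>i. z (2 * i + 1)) \<psi>"
    using subst_fm[OF \<psi>(1), of "\<lambda>i. RVar (2 * i + 1)" "\<lambda>i. VVar (2 * i + 1)"] by auto
  show ?thesis
  proof (rule definableI[of "And \<phi>' \<psi>'" "\<lambda>i. if even i then b (i div 2) else b' (i div 2)" _
        "\<lambda>i. if even i then c (i div 2) else c' (i div 2)"])
    fix i assume "i \<in> freeR (And \<phi>' \<psi>')"
    then have "(\<exists>j\<in>freeR \<phi>. i = 2 * j) \<or> (\<exists>j\<in>freeR \<psi>. i = 2 * j + 1)" using \<phi>'(2) \<psi>'(2) by auto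
    then show "(if even i then b (i div 2) else b' (i div 2)) \<in> R" using \<phi>(2) \<psi>(2) by auto
  next
    fix i assume "i \<in> freeV (And \<phi>' \<psi>')"
    then have "(\<exists>j\<in>freeV \<phi>. i = 2 * j) \<or> (\<exists>j\<in>freeV \<psi>. i = 2 * j + 1)" using \<phi>'(3) \<psi>'(3) by auto
    then show "(if even i then c (i div 2) else c' (i div 2)) \<in> G" using \<phi>(3) \<psi>(3) by auto
  qed (simp_all add: \<phi>'(1,4) \<psi>'(1,4) \<phi>(4) \<psi>(4))
qed

lemma definable_or [intro]:
  assumes "definable R G P" "definable R G Q"
  shows "definable R G (\<lambda>e. P e \<or> Q e)"
proof -
  have "definable R G (\<lambda>e. \<not> (\<not> P e \<and> \<not> Q e))"
    using assms by (intro definable_not definable_and)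
  then show ?thesis by simp
qed

lemma definable_imp [intro]:
  assumes "definable R G P" "definable R G Q"
  shows "definable R G (\<lambda>e. P e \<longrightarrow> Q e)"
  unfolding imp_conv_disj using assms by (intro definable_or definable_not)

lemma definable_ball [intro]:
  "finite A \<Longrightarrow> (\<And>a. a \<in> A \<Longrightarrow> definable R G (P a)) \<Longrightarrow> definable R G (\<lambda>e. \<forall>a\<in>A. P a e)"
  by (induction A rule: finite_induct) (simp_all add: definable_and)

lemma definable_bex [intro]:
  "finite A \<Longrightarrow> (\<And>a. a \<in> A \<Longrightarrow> definable R G (P a)) \<Longrightarrow> definable R G (\<lambda>e. \<exists>a\<in>A. P a e)"
  by (induction A rule: finite_induct) (simp_all add: definable_or)

lemma definable_all_le: "(\<And>i. i \<le> d \<Longrightarrow> definable R G (P i)) \<Longrightarrow> definable R G (\<lambda>e. \<forall>i\<le>(d::nat). P i e)"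
  using definable_ball[of "{..d}" R G P] unfolding Ball_def atMost_iff by blast

lemma definable_base_eqR: "f \<in> R \<Longrightarrow> g \<in> R \<Longrightarrow> definable R G (\<lambda>e. f e = g e)"
  by (rule definableI[of "EqR (RVar 0) (RVar 1)" "\<lambda>i. if i = 0 then f else g"]) simp_all

lemma definable_base_lessR: "f \<in> R \<Longrightarrow> g \<in> R \<Longrightarrow> definable R G (\<lambda>e. f e < g e)"
  by (rule definableI[of "LessR (RVar 0) (RVar 1)" "\<lambda>i. if i = 0 then f else g"]) simp_all

lemma definable_base_eqV: "f \<in> G \<Longrightarrow> g \<in> G \<Longrightarrow> definable R G (\<lambda>e. f e = g e)"
  by (rule definableI[of "EqV (VVar 0) (VVar 1)" _ _ "\<lambda>i. if i = 0 then f else g"]) simp_all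

lemma definable_base_lessV: "f \<in> G \<Longrightarrow> g \<in> G \<Longrightarrow> definable R G (\<lambda>e. f e < g e)"
  by (rule definableI[of "LessV (VVar 0) (VVar 1)" _ _ "\<lambda>i. if i = 0 then f else g"]) simp_all

abbreviation lift :: "('e \<Rightarrow> 'b) set \<Rightarrow> ('e \<times> 'c \<Rightarrow> 'b) set" where
  "lift R \<equiv> (\<lambda>f. f \<circ> fst) ` R"

lemma definable_exR:
  assumes "definable (insert snd (lift R)) (lift G) Q"
  shows "definable R G (\<lambda>e. \<exists>r. Q (e, r))"
proof -
  obtain \<phi> b c where \<phi>: "pure_fm \<phi>" "\<And>i. i \<in> freeR \<phi> \<Longrightarrow> b i \<in> insert snd (lift R)"
    "\<And>i. i \<in> freeV \<phi> \<Longrightarrow> c i \<in> lift G"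
    "\<And>e. Q e \<longleftrightarrow> psat (\<lambda>i. b i e) (\<lambda>i. c i e) \<phi>" using assms unfolding definable_def by blast
  have "\<forall>i. \<exists>f. i \<in> freeR \<phi> \<longrightarrow> b i \<noteq> snd \<longrightarrow> f \<in> R \<and> (\<forall>e r. b i (e, r) = f e)"
    using \<phi>(2) by fastforce
  then obtain b' where b': "\<And>i. i \<in> freeR \<phi> \<Longrightarrow> b i \<noteq> snd \<Longrightarrow> b' i \<in> R \<and> (\<forall>e r. b i (e, r) = b' i e)" by metis
  have "\<forall>i. \<exists>f. i \<in> freeV \<phi> \<longrightarrow> f \<in> G \<and> (\<forall>e r. c i (e, r) = f e)"
    using \<phi>(3) by fastforce
  then obtain c' where c': "\<And>i. i \<in> freeV \<phi> \<Longrightarrow> c' i \<in> G \<and> (\<forall>e r. c i (e, r) = c' i e)" by metis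
  define \<sigma> where "\<sigma> = (\<lambda>i. if b i = snd then 0 else Suc i)"
  obtain \<phi>' where \<phi>': "pure_fm \<phi>'" "freeR \<phi>' \<subseteq> (\<Union>i\<in>freeR \<phi>. {\<sigma> i})" "freeV \<phi>' \<subseteq> (\<Union>i\<in>freeV \<phi>. {i})"
    "\<And>y z. psat y z \<phi>' \<longleftrightarrow> psat (\<lambda>i. y (\<sigma> i)) z \<phi>"
    using subst_fm[OF \<phi>(1), of "\<lambda>i. RVar (\<sigma> i)" VVar] by auto
  show ?thesis
  proof (rule definableI[of "ExR 0 \<phi>'" "\<lambda>i. b' (i - 1)" _ c'])
    fix i assume "i \<in> freeR (ExR 0 \<phi>')"
    then show "b' (i - 1) \<in> R" using \<phi>'(2) b' by (fastforce simp: \<sigma>_def split: if_splits)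
  next
    fix e
    have "Q (e, r) \<longleftrightarrow> psat ((\<lambda>i. b' (i - 1) e)(0 := r)) (\<lambda>i. c' i e) \<phi>'" for r
      unfolding \<phi>(4) \<phi>'(4) using b' c' \<phi>(1) by (intro sat_cong) (auto simp: \<sigma>_def)
    then show "(\<exists>r. Q (e, r)) \<longleftrightarrow> psat (\<lambda>i. b' (i - 1) e) (\<lambda>i. c' i e) (ExR 0 \<phi>')" by simp
  qed (use \<phi>' c' in auto)
qed

lemma definable_exV:
  assumes "definable (lift R) (insert snd (lift G)) Q"
  shows "definable R G (\<lambda>e. \<exists>\<gamma>. Q (e, \<gamma>))"
proof -
  obtain \<phi> b c where \<phi>: "pure_fm \<phi>" "\<And>i. i \<in> freeV \<phi> \<Longrightarrow> c i \<in> insert snd (lift G)"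
    "\<And>i. i \<in> freeR \<phi> \<Longrightarrow> b i \<in> lift R"
    "\<And>e. Q e \<longleftrightarrow> psat (\<lambda>i. b i e) (\<lambda>i. c i e) \<phi>" using assms unfolding definable_def by blast
  have "\<forall>i. \<exists>f. i \<in> freeV \<phi> \<longrightarrow> c i \<noteq> snd \<longrightarrow> f \<in> G \<and> (\<forall>e r. c i (e, r) = f e)"
    using \<phi>(2) by fastforce
  then obtain c' where c': "\<And>i. i \<in> freeV \<phi> \<Longrightarrow> c i \<noteq> snd \<Longrightarrow> c' i \<in> G \<and> (\<forall>e r. c i (e, r) = c' i e)" by metis
  have "\<forall>i. \<exists>f. i \<in> freeR \<phi> \<longrightarrow> f \<in> R \<and> (\<forall>e r. b i (e, r) = f e)"
    using \<phi>(3) by fastforce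
  then obtain b' where b': "\<And>i. i \<in> freeR \<phi> \<Longrightarrow> b' i \<in> R \<and> (\<forall>e r. b i (e, r) = b' i e)" by metis
  define \<sigma> where "\<sigma> = (\<lambda>i. if c i = snd then 0 else Suc i)"
  obtain \<phi>' where \<phi>': "pure_fm \<phi>'" "freeR \<phi>' \<subseteq> (\<Union>i\<in>freeR \<phi>. {i})" "freeV \<phi>' \<subseteq> (\<Union>i\<in>freeV \<phi>. {\<sigma> i})"
    "\<And>y z. psat y z \<phi>' \<longleftrightarrow> psat y (\<lambda>i. z (\<sigma> i)) \<phi>"
    using subst_fm[OF \<phi>(1), of RVar "\<lambda>i. VVar (\<sigma> i)"] by auto
  show ?thesis
  proof (rule definableI[of "ExV 0 \<phi>'" b' _ "\<lambda>i. c' (i - 1)"])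
    fix i assume "i \<in> freeV (ExV 0 \<phi>')"
    then show "c' (i - 1) \<in> G" using \<phi>'(3) c' by (fastforce simp: \<sigma>_def split: if_splits)
  next
    fix e
    have "Q (e, r) \<longleftrightarrow> psat (\<lambda>i. b' i e) ((\<lambda>i. c' (i - 1) e)(0 := r)) \<phi>'" for r
      unfolding \<phi>(4) \<phi>'(4) using b' c' \<phi>(1) by (intro sat_cong) (auto simp: \<sigma>_def)
    then show "(\<exists>r. Q (e, r)) \<longleftrightarrow> psat (\<lambda>i. b' i e) (\<lambda>i. c' (i - 1) e) (ExV 0 \<phi>')" by simp
  qed (use \<phi>' b' in auto)
qed

section \<open>Definable functions\<close>

text \<open>
  A function is definable over \<open>R\<close> and \<open>G\<close> if it may be used like an element of \<open>R\<close> (of \<open>G\<close>). The larger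
  sets \<open>R'\<close> and \<open>G'\<close> make the notion monotone, so that several definable functions can be eliminated
  one after the other. Unlike definability of the graph, this form makes closure under terms and case
  distinctions a matter of substitution.
\<close>

definition rfun :: "('e \<Rightarrow> 'r) set \<Rightarrow> ('e \<Rightarrow> 'g) set \<Rightarrow> ('e \<Rightarrow> 'r) \<Rightarrow> bool" where
  "rfun R G f \<longleftrightarrow> (\<forall>R' G' P. R \<subseteq> R' \<longrightarrow> G \<subseteq> G' \<longrightarrow> definable (insert f R') G' P \<longrightarrow> definable R' G' P)"

definition gfun :: "('e \<Rightarrow> 'r) set \<Rightarrow> ('e \<Rightarrow> 'g) set \<Rightarrow> ('e \<Rightarrow> 'g) \<Rightarrow> bool" where
  "gfun R G f \<longleftrightarrow> (\<forall>R' G' P. R \<subseteq> R' \<longrightarrow> G \<subseteq> G' \<longrightarrow> definable R' (insert f G') P \<longrightarrow> definable R' G' P)"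

lemma rfunI: "(\<And>R' G' P. R \<subseteq> R' \<Longrightarrow> G \<subseteq> G' \<Longrightarrow> definable (insert f R') G' P \<Longrightarrow> definable R' G' P) \<Longrightarrow> rfun R G f"
  by (simp add: rfun_def)

lemma gfunI: "(\<And>R' G' P. R \<subseteq> R' \<Longrightarrow> G \<subseteq> G' \<Longrightarrow> definable R' (insert f G') P \<Longrightarrow> definable R' G' P) \<Longrightarrow> gfun R G f"
  by (simp add: gfun_def)

lemma rfunD: "rfun R G f \<Longrightarrow> definable (insert f R') G' P \<Longrightarrow> R \<subseteq> R' \<Longrightarrow> G \<subseteq> G' \<Longrightarrow> definable R' G' P"
  by (simp add: rfun_def)

lemma gfunD: "gfun R G f \<Longrightarrow> definable R' (insert f G') P \<Longrightarrow> R \<subseteq> R' \<Longrightarrow> G \<subseteq> G' \<Longrightarrow> definable R' G' P"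
  by (simp add: gfun_def)

lemma rfun_base [intro]: "f \<in> R \<Longrightarrow> rfun R G f"
  unfolding rfun_def by (metis insert_absorb subset_iff)

lemma gfun_base [intro]: "f \<in> G \<Longrightarrow> gfun R G f"
  unfolding gfun_def by (metis insert_absorb subset_iff)

lemma rfun_mono:
  assumes "rfun R G f" "R \<subseteq> R'" "G \<subseteq> G'" shows "rfun R' G' f"
  using assms(2,3) by (intro rfunI) (rule rfunD[OF assms(1)], auto)

lemma gfun_mono:
  assumes "gfun R G f" "R \<subseteq> R'" "G \<subseteq> G'" shows "gfun R' G' f"
  using assms(2,3) by (intro gfunI) (rule gfunD[OF assms(1)], auto)

text \<open>A formula uses finitely many functions, which are eliminated one by one.\<close>

lemma definable_trans:
  assumes "definable A B P" "\<And>f. f \<in> A \<Longrightarrow> rfun R G f" "\<And>f. f \<in> B \<Longrightarrow> gfun R G f"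
  shows "definable R G P"
proof -
  obtain \<phi> b c where \<phi>: "pure_fm \<phi>" "\<And>i. i \<in> freeR \<phi> \<Longrightarrow> b i \<in> A"
    "\<And>i. i \<in> freeV \<phi> \<Longrightarrow> c i \<in> B"
    "\<And>e. P e \<longleftrightarrow> psat (\<lambda>i. b i e) (\<lambda>i. c i e) \<phi>" using assms(1) unfolding definable_def by blast
  have *: "definable (b ` freeR \<phi> \<union> R) (c ` freeV \<phi> \<union> G) P"
    using \<phi>(1,4) by (intro definableI[of \<phi> b _ c]) auto
  have r: "definable R G' P" if "finite C" "C \<subseteq> A" "G \<subseteq> G'" "definable (C \<union> R) G' P" for C G'
    using that
  proof (induction C rule: finite_induct)
    case (insert f C)
    then have "definable (C \<union> R) G' P" using rfunD[OF assms(2)[of f], of "C \<union> R" G' P] by auto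
    then show ?case using insert by auto
  qed simp
  have g: "definable R G P" if "finite C" "C \<subseteq> B" "definable R (C \<union> G) P" for C
    using that
  proof (induction C rule: finite_induct)
    case (insert f C)
    then have "definable R (C \<union> G) P" using gfunD[OF assms(3)[of f], of R "C \<union> G" P] by auto
    then show ?case using insert by auto
  qed simp
  show ?thesis using \<phi>(2,3) by (intro g[of "c ` freeV \<phi>"] r[of "b ` freeR \<phi>"] *) auto
qed

lemma definable_eqR: "rfun R G f \<Longrightarrow> rfun R G g \<Longrightarrow> definable R G (\<lambda>e. f e = g e)"
  by (rule definable_trans[OF definable_base_eqR[of f "{f, g}" g "{}"]]) auto

lemma definable_lessR: "rfun R G f \<Longrightarrow> rfun R G g \<Longrightarrow> definable R G (\<lambda>e. f e < g e)"
  by (rule definable_trans[OF definable_base_lessR[of f "{f, g}" g "{}"]]) auto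

lemma definable_eqV: "gfun R G f \<Longrightarrow> gfun R G g \<Longrightarrow> definable R G (\<lambda>e. f e = g e)"
  by (rule definable_trans[OF definable_base_eqV[of f "{f, g}" g "{}"]]) auto

lemma definable_lessV: "gfun R G f \<Longrightarrow> gfun R G g \<Longrightarrow> definable R G (\<lambda>e. f e < g e)"
  by (rule definable_trans[OF definable_base_lessV[of f "{f, g}" g "{}"]]) auto

lemma definable_leV: "gfun R G f \<Longrightarrow> gfun R G g \<Longrightarrow> definable R G (\<lambda>e. f e \<le> g e)"
  using definable_not[OF definable_lessV, of R G g f] by (simp add: not_less)

lemma rfun_term:
  assumes t: "pure_rterm t" and a: "\<And>i. i \<in> rvars t \<Longrightarrow> rfun R G (a i)"
  shows "rfun R G (\<lambda>e. evr (\<lambda>i. a i e) t)" (is "rfun R G ?h")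
proof (rule rfunI)
  fix R' G' P assume sub: "R \<subseteq> R'" "G \<subseteq> G'"
  assume "definable (insert ?h R') G' P"
  then obtain \<phi> b c where \<phi>: "pure_fm \<phi>" "\<And>i. i \<in> freeR \<phi> \<Longrightarrow> b i \<in> insert ?h R'"
    "\<And>i. i \<in> freeV \<phi> \<Longrightarrow> c i \<in> G'"
    "\<And>e. P e \<longleftrightarrow> psat (\<lambda>i. b i e) (\<lambda>i. c i e) \<phi>" unfolding definable_def by blast
  \<comment> \<open>even variables for the arguments of the term, odd ones for the other functions\<close>
  define \<sigma> where "\<sigma> = (\<lambda>i. if b i = ?h then rterm_subst (\<lambda>j. RVar (2 * j)) t else RVar (2 * i + 1))"
  have \<sigma>: "\<forall>i. pure_rterm (\<sigma> i)" using t by (simp add: \<sigma>_def rterm_subst_syntax(3))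
  obtain \<phi>' where \<phi>': "pure_fm \<phi>'" "freeR \<phi>' \<subseteq> (\<Union>i\<in>freeR \<phi>. rvars (\<sigma> i))"
    "freeV \<phi>' \<subseteq> freeV \<phi>" "\<And>y z. psat y z \<phi>' \<longleftrightarrow> psat (\<lambda>i. evr y (\<sigma> i)) z \<phi>"
    using subst_fm[OF \<phi>(1) \<sigma>, where \<tau> = VVar] by auto
  let ?b = "\<lambda>i. if even i then a (i div 2) else b (i div 2)"
  have "definable (a ` rvars t \<union> R') G' P"
  proof (rule definableI[of \<phi>' ?b _ c])
    fix i assume "i \<in> freeR \<phi>'"
    then obtain j where "j \<in> freeR \<phi>" "i \<in> rvars (\<sigma> j)" using \<phi>'(2) by blast
    then show "?b i \<in> a ` rvars t \<union> R'"
      using \<phi>(2)[of j] t by (cases "b j = ?h") (auto simp: \<sigma>_def rterm_subst_syntax(2))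
  next
    fix e
    show "P e \<longleftrightarrow> psat (\<lambda>i. ?b i e) (\<lambda>i. c i e) \<phi>'"
      unfolding \<phi>(4) \<phi>'(4)
    proof (rule sat_cong[OF \<phi>(1)])
      fix i
      show "b i e = evr (\<lambda>i. ?b i e) (\<sigma> i)"
        using t by (cases "b i = ?h") (simp_all add: \<sigma>_def eval_rterm_subst[where x' = "\<lambda>_. 0"])
    qed simp
  qed (use \<phi>'(1,3) \<phi>(3) in auto)
  then show "definable R' G' P"
    by (rule definable_trans) (use a sub in \<open>auto intro: rfun_mono\<close>)
qed

lemma gfun_term:
  assumes t: "pure_vterm t" and a: "\<And>i. i \<in> vvars t \<Longrightarrow> gfun R G (a i)"
  shows "gfun R G (\<lambda>e. evv (\<lambda>i. a i e) t)" (is "gfun R G ?h")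
proof (rule gfunI)
  fix R' G' P assume sub: "R \<subseteq> R'" "G \<subseteq> G'"
  assume "definable R' (insert ?h G') P"
  then obtain \<phi> b c where \<phi>: "pure_fm \<phi>" "\<And>i. i \<in> freeV \<phi> \<Longrightarrow> c i \<in> insert ?h G'"
    "\<And>i. i \<in> freeR \<phi> \<Longrightarrow> b i \<in> R'"
    "\<And>e. P e \<longleftrightarrow> psat (\<lambda>i. b i e) (\<lambda>i. c i e) \<phi>" unfolding definable_def by blast
  \<comment> \<open>even variables for the arguments of the term, odd ones for the other functions\<close>
  define \<sigma> where "\<sigma> = (\<lambda>i. if c i = ?h then vterm_subst (\<lambda>j. VVar (2 * j)) t else VVar (2 * i + 1))"
  have \<sigma>: "\<forall>i. pure_vterm (\<sigma> i)" using t by (simp add: \<sigma>_def vterm_subst_syntax(3))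
  obtain \<phi>' where \<phi>': "pure_fm \<phi>'" "freeR \<phi>' \<subseteq> freeR \<phi>"
    "freeV \<phi>' \<subseteq> (\<Union>i\<in>freeV \<phi>. vvars (\<sigma> i))" "\<And>y z. psat y z \<phi>' \<longleftrightarrow> psat y (\<lambda>i. evv z (\<sigma> i)) \<phi>"
    using subst_fm[OF \<phi>(1) _ \<sigma>, where \<sigma> = RVar] by auto
  let ?b = "\<lambda>i. if even i then a (i div 2) else c (i div 2)"
  have "definable R' (a ` vvars t \<union> G') P"
  proof (rule definableI[of \<phi>' b _ ?b])
    fix i assume "i \<in> freeV \<phi>'"
    then obtain j where "j \<in> freeV \<phi>" "i \<in> vvars (\<sigma> j)" using \<phi>'(3) by blast
    then show "?b i \<in> a ` vvars t \<union> G'"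
      using \<phi>(2)[of j] t by (cases "c j = ?h") (auto simp: \<sigma>_def vterm_subst_syntax(2))
  next
    fix e
    show "P e \<longleftrightarrow> psat (\<lambda>i. b i e) (\<lambda>i. ?b i e) \<phi>'"
      unfolding \<phi>(4) \<phi>'(4)
    proof (rule sat_cong[OF \<phi>(1)])
      fix i
      show "c i e = evv (\<lambda>i. ?b i e) (\<sigma> i)"
        using t by (cases "c i = ?h") (simp_all add: \<sigma>_def eval_vterm_subst[where x' = "\<lambda>_. 0"])
    qed simp
  qed (use \<phi>'(1,2) \<phi>(3) in auto)
  then show "definable R' G' P"
    by (rule definable_trans) (use a sub in \<open>auto intro: gfun_mono\<close>)
qed

lemma rfun_const: "rfun R G (\<lambda>e. 0)" "rfun R G (\<lambda>e. 1)"
  using rfun_term[of RZero] rfun_term[of ROne] by simp_all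

lemma gfun_const: "gfun R G (\<lambda>e. 0)"
  using gfun_term[of VZero] by simp

lemma rfun_add: "rfun R G f \<Longrightarrow> rfun R G g \<Longrightarrow> rfun R G (\<lambda>e. f e + g e)"
  using rfun_term[of "RAdd (RVar 0) (RVar 1)" R G "\<lambda>i. if i = 0 then f else g"] by simp

lemma rfun_mult: "rfun R G f \<Longrightarrow> rfun R G g \<Longrightarrow> rfun R G (\<lambda>e. f e * g e)"
  using rfun_term[of "RMul (RVar 0) (RVar 1)" R G "\<lambda>i. if i = 0 then f else g"] by simp

lemma rfun_minus: "rfun R G f \<Longrightarrow> rfun R G (\<lambda>e. - f e)"
  using rfun_term[of "RMinus (RVar 0)" R G "\<lambda>i. f"] by simp

lemma rfun_power: "rfun R G f \<Longrightarrow> rfun R G (\<lambda>e. f e ^ n)"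
  by (induction n) (simp_all add: rfun_const rfun_mult)

lemma rfun_sum: "finite A \<Longrightarrow> (\<And>a. a \<in> A \<Longrightarrow> rfun R G (f a)) \<Longrightarrow> rfun R G (\<lambda>e. \<Sum>a\<in>A. f a e)"
  by (induction A rule: finite_induct) (simp_all add: rfun_const rfun_add)

lemma gfun_add: "gfun R G f \<Longrightarrow> gfun R G g \<Longrightarrow> gfun R G (\<lambda>e. f e + g e)"
  using gfun_term[of "VAdd (VVar 0) (VVar 1)" R G "\<lambda>i. if i = 0 then f else g"] by simp

lemma gfun_minus: "gfun R G f \<Longrightarrow> gfun R G (\<lambda>e. - f e)"
  using gfun_term[of "VMinus (VVar 0)" R G "\<lambda>i. f"] by simp

text \<open>The predicate is split into the two cases, and in each of them the function is replaced.\<close>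

lemma rfun_if:
  assumes C: "definable R G C" and fg: "rfun R G f" "rfun R G g"
  shows "rfun R G (\<lambda>e. if C e then f e else g e)" (is "rfun R G ?h")
proof (rule rfunI)
  fix R' G' P assume sub: "R \<subseteq> R'" "G \<subseteq> G'"
  assume "definable (insert ?h R') G' P"
  then obtain \<phi> b c where \<phi>: "pure_fm \<phi>" "\<And>i. i \<in> freeR \<phi> \<Longrightarrow> b i \<in> insert ?h R'"
    "\<And>i. i \<in> freeV \<phi> \<Longrightarrow> c i \<in> G'"
    "\<And>e. P e \<longleftrightarrow> psat (\<lambda>i. b i e) (\<lambda>i. c i e) \<phi>" unfolding definable_def by blast
  define Q where "Q u e \<longleftrightarrow> psat (\<lambda>i. (if b i = ?h then u else b i) e) (\<lambda>i. c i e) \<phi>" for u :: "'a \<Rightarrow> 'r" and e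
  have "definable (insert u R') G' (Q u)" for u
    unfolding Q_def using \<phi>(1-3)
    by (intro definableI[of \<phi> "\<lambda>i. if b i = ?h then u else b i" _ c]) auto
  then have "definable R' G' (Q f)" "definable R' G' (Q g)" using fg sub rfunD by blast+
  moreover have "definable R' G' C" using C sub by (rule definable_mono)
  ultimately have "definable R' G' (\<lambda>e. C e \<and> Q f e \<or> \<not> C e \<and> Q g e)"
    by (intro definable_or definable_and definable_not)
  moreover have "P e \<longleftrightarrow> C e \<and> Q f e \<or> \<not> C e \<and> Q g e" for e
  proof (cases "C e")
    case True
    have "P e \<longleftrightarrow> Q f e" unfolding \<phi>(4) Q_def by (rule sat_cong) (use True \<phi>(1) in auto)
    then show ?thesis using True by simp
  next
    case False
    have "P e \<longleftrightarrow> Q g e" unfolding \<phi>(4) Q_def by (rule sat_cong) (use False \<phi>(1) in auto)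
    then show ?thesis using False by simp
  qed
  ultimately show "definable R' G' P" by presburger
qed

lemma gfun_if:
  assumes C: "definable R G C" and fg: "gfun R G f" "gfun R G g"
  shows "gfun R G (\<lambda>e. if C e then f e else g e)" (is "gfun R G ?h")
proof (rule gfunI)
  fix R' G' P assume sub: "R \<subseteq> R'" "G \<subseteq> G'"
  assume "definable R' (insert ?h G') P"
  then obtain \<phi> b c where \<phi>: "pure_fm \<phi>" "\<And>i. i \<in> freeR \<phi> \<Longrightarrow> b i \<in> R'"
    "\<And>i. i \<in> freeV \<phi> \<Longrightarrow> c i \<in> insert ?h G'"
    "\<And>e. P e \<longleftrightarrow> psat (\<lambda>i. b i e) (\<lambda>i. c i e) \<phi>" unfolding definable_def by blast
  define Q where "Q u e \<longleftrightarrow> psat (\<lambda>i. b i e) (\<lambda>i. (if c i = ?h then u else c i) e) \<phi>" for u :: "'a \<Rightarrow> 'g" and e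
  have "definable R' (insert u G') (Q u)" for u
    unfolding Q_def using \<phi>(1-3)
    by (intro definableI[of \<phi> b _ "\<lambda>i. if c i = ?h then u else c i"]) auto
  then have "definable R' G' (Q f)" "definable R' G' (Q g)" using fg sub gfunD by blast+
  moreover have "definable R' G' C" using C sub by (rule definable_mono)
  ultimately have "definable R' G' (\<lambda>e. C e \<and> Q f e \<or> \<not> C e \<and> Q g e)"
    by (intro definable_or definable_and definable_not)
  moreover have "P e \<longleftrightarrow> C e \<and> Q f e \<or> \<not> C e \<and> Q g e" for e
  proof (cases "C e")
    case True
    have "P e \<longleftrightarrow> Q f e" unfolding \<phi>(4) Q_def by (rule sat_cong) (use True \<phi>(1) in auto)
    then show ?thesis using True by simp
  next
    case False
    have "P e \<longleftrightarrow> Q g e" unfolding \<phi>(4) Q_def by (rule sat_cong) (use False \<phi>(1) in auto)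
    then show ?thesis using False by simp
  qed
  ultimately show "definable R' G' P" by presburger
qed

text \<open>Division is not a term, so the quotient is introduced by a quantifier; recall \<open>x / 0 = 0\<close>.\<close>

lemma rfun_divide:
  assumes "rfun R G f" "rfun R G g"
  shows "rfun R G (\<lambda>e. f e / g e)" (is "rfun R G ?h")
proof (rule rfunI)
  fix R' G' P assume sub: "R \<subseteq> R'" "G \<subseteq> G'"
  assume "definable (insert ?h R') G' P"
  then obtain \<phi> b c where \<phi>: "pure_fm \<phi>" "\<And>i. i \<in> freeR \<phi> \<Longrightarrow> b i \<in> insert ?h R'"
    "\<And>i. i \<in> freeV \<phi> \<Longrightarrow> c i \<in> G'"
    "\<And>e. P e \<longleftrightarrow> psat (\<lambda>i. b i e) (\<lambda>i. c i e) \<phi>" unfolding definable_def by blast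
  let ?R = "insert snd (lift (insert f (insert g R')))"
  let ?Q = "\<lambda>e. (g (fst e) = 0 \<and> snd e = 0 \<or> g (fst e) \<noteq> 0 \<and> snd e * g (fst e) = f (fst e)) \<and>
    psat (\<lambda>i. (if b i = ?h then snd else b i \<circ> fst) e) (\<lambda>i. (c i \<circ> fst) e) \<phi>"
  have fg: "rfun ?R (lift G') (\<lambda>e. f (fst e))" "rfun ?R (lift G') (\<lambda>e. g (fst e))" "rfun ?R (lift G') snd"
    by (rule rfun_base; force simp: comp_def)+
  have "definable ?R (lift G') (\<lambda>e. psat (\<lambda>i. (if b i = ?h then snd else b i \<circ> fst) e) (\<lambda>i. (c i \<circ> fst) e) \<phi>)"
  proof (rule definableI[of \<phi> "\<lambda>i. if b i = ?h then snd else b i \<circ> fst" _ "\<lambda>i. c i \<circ> fst"])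
    fix i assume "i \<in> freeR \<phi>"
    then show "(if b i = ?h then snd else b i \<circ> fst) \<in> ?R" using \<phi>(2)[of i] by auto
  qed (use \<phi>(1,3) in simp_all)
  moreover have "definable ?R (lift G') (\<lambda>e. g (fst e) = 0 \<and> snd e = 0 \<or> g (fst e) \<noteq> 0 \<and> snd e * g (fst e) = f (fst e))"
    by (intro definable_or definable_and definable_not definable_eqR rfun_mult fg rfun_const)
  ultimately have "definable ?R (lift G') ?Q" by (intro definable_and)
  then have "definable (insert f (insert g R')) G' (\<lambda>e. \<exists>r. ?Q (e, r))" by (rule definable_exR)
  moreover have "(\<exists>r. ?Q (e, r)) \<longleftrightarrow> P e" for e
  proof -
    have "(g e = 0 \<and> r = 0 \<or> g e \<noteq> 0 \<and> r * g e = f e) \<longleftrightarrow> r = ?h e" for r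
      by (cases "g e = 0") (auto simp: field_simps)
    then have "(\<exists>r. ?Q (e, r)) \<longleftrightarrow>
        psat (\<lambda>i. (if b i = ?h then snd else b i \<circ> fst) (e, ?h e)) (\<lambda>i. (c i \<circ> fst) (e, ?h e)) \<phi>"
      by simp
    also have "\<dots> \<longleftrightarrow> P e" unfolding \<phi>(4) using \<phi>(1) by (intro sat_cong) auto
    finally show ?thesis .
  qed
  ultimately have "definable (insert f (insert g R')) G' P" by simp
  then show "definable R' G' P"
    by (rule definable_trans) (use assms sub in \<open>auto intro: rfun_mono\<close>)
qed

lemma definable_finite:
  assumes "definable A B P"
  obtains A' B' where "finite A'" "A' \<subseteq> A" "finite B'" "B' \<subseteq> B" "definable A' B' P"
proof -
  obtain \<phi> b c where \<phi>: "pure_fm \<phi>" "\<And>i. i \<in> freeR \<phi> \<Longrightarrow> b i \<in> A" "\<And>i. i \<in> freeV \<phi> \<Longrightarrow> c i \<in> B"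
    "\<And>e. P e \<longleftrightarrow> psat (\<lambda>i. b i e) (\<lambda>i. c i e) \<phi>" using assms unfolding definable_def by blast
  have "definable (b ` freeR \<phi>) (c ` freeV \<phi>) P"
    using \<phi>(1,4) by (intro definableI[of \<phi> b _ c]) auto
  then show ?thesis using \<phi>(2,3) by (intro that[of "b ` freeR \<phi>" "c ` freeV \<phi>"]) auto
qed

text \<open>If each function used by \<open>P\<close> agrees along a relation \<open>rel\<close> with a definable function of other
  parameters, then so does \<open>P\<close>. This replaces the leading terms of polynomial values by their
  computed counterparts.\<close>

lemma definable_transfer:
  assumes P: "definable A B P"
    and A: "\<And>f. f \<in> A \<Longrightarrow> \<exists>f'. rfun R G f' \<and> (\<forall>d e. rel d e \<longrightarrow> f e = f' d)"
    and B: "\<And>f. f \<in> B \<Longrightarrow> \<exists>f'. gfun R G f' \<and> (\<forall>d e. rel d e \<longrightarrow> f e = f' d)"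
  shows "\<exists>P'. definable R G P' \<and> (\<forall>d e. rel d e \<longrightarrow> (P e \<longleftrightarrow> P' d))"
proof -
  obtain \<phi> b c where \<phi>: "pure_fm \<phi>" "\<And>i. i \<in> freeR \<phi> \<Longrightarrow> b i \<in> A" "\<And>i. i \<in> freeV \<phi> \<Longrightarrow> c i \<in> B"
    "\<And>e. P e \<longleftrightarrow> psat (\<lambda>i. b i e) (\<lambda>i. c i e) \<phi>" using P unfolding definable_def by blast
  have "\<forall>f\<in>A. \<exists>f'. rfun R G f' \<and> (\<forall>d e. rel d e \<longrightarrow> f e = f' d)" using A by blast
  then obtain a' where a': "\<And>f. f \<in> A \<Longrightarrow> rfun R G (a' f)"
    "\<And>f d e. f \<in> A \<Longrightarrow> rel d e \<Longrightarrow> f e = a' f d" by metis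
  have "\<forall>f\<in>B. \<exists>f'. gfun R G f' \<and> (\<forall>d e. rel d e \<longrightarrow> f e = f' d)" using B by blast
  then obtain b' where b': "\<And>f. f \<in> B \<Longrightarrow> gfun R G (b' f)"
    "\<And>f d e. f \<in> B \<Longrightarrow> rel d e \<Longrightarrow> f e = b' f d" by metis
  define P' where "P' d \<longleftrightarrow> psat (\<lambda>i. a' (b i) d) (\<lambda>i. b' (c i) d) \<phi>" for d
  have "definable (a' ` A) (b' ` B) P'"
    unfolding P'_def using \<phi>(1-3) by (intro definableI[of \<phi> "\<lambda>i. a' (b i)" _ "\<lambda>i. b' (c i)"]) auto
  then have "definable R G P'" by (rule definable_trans) (auto simp: a' b')
  moreover have "P e \<longleftrightarrow> P' d" if "rel d e" for d e
    unfolding \<phi>(4) P'_def using a'(2)[OF \<phi>(2) that] b'(2)[OF \<phi>(3) that]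
    by (intro sat_cong[OF \<phi>(1)]) auto
  ultimately show ?thesis by blast
qed

end

locale henselian_ovf_ac = henselian_ac_field v res ac + ovf_ac_language K
  for v :: "'k::linordered_field \<Rightarrow> 'g::linordered_ab_group_add"
    and res ac :: "'k \<Rightarrow> 'r::linordered_field" and K :: "('k, 'r, 'g) ovf_ac"
begin

lemma gfun_nmul: "gfun R G f \<Longrightarrow> gfun R G (\<lambda>e. nmul n (f e))"
  by (induction n) (simp_all add: gfun_const gfun_add)

section \<open>Definability of leading terms\<close>

context
  fixes R :: "('e \<Rightarrow> 'r) set" and G :: "('e \<Rightarrow> 'g) set"
    and \<alpha> :: "'e \<Rightarrow> nat \<Rightarrow> 'r" and \<beta> :: "'e \<Rightarrow> nat \<Rightarrow> 'g" and d :: nat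
  assumes \<alpha>: "\<And>i. rfun R G (\<lambda>e. \<alpha> e i)" and \<beta>: "\<And>i. gfun R G (\<lambda>e. \<beta> e i)"
begin

lemma definable_leading: "definable R G (\<lambda>e. leading d (\<alpha> e) (\<beta> e) i)"
  unfolding leading_def
  by (intro definable_and definable_all_le definable_imp definable_not definable_eqR definable_leV
      \<alpha> \<beta> rfun_const)

lemma rfun_lead_ac: "rfun R G (\<lambda>e. lead_ac d (\<alpha> e) (\<beta> e))"
  unfolding lead_ac_def by (intro rfun_sum rfun_if definable_leading \<alpha> rfun_const) simp

lemma gfun_lead_val: "gfun R G (\<lambda>e. lead_val d (\<alpha> e) (\<beta> e))"
proof -
  have "gfun R G (\<lambda>e. leading_value (leading d (\<alpha> e) (\<beta> e)) (\<beta> e) n)" for n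
    by (induction n) (simp_all add: gfun_const gfun_if definable_leading \<beta>)
  then show ?thesis by (simp only: lead_val_def)
qed

lemma definable_good: "definable R G (\<lambda>e. good d (\<alpha> e) (\<beta> e))"
  unfolding good_def
  by (intro definable_or definable_not definable_all_le definable_eqR \<alpha> rfun_lead_ac rfun_const)

end

section \<open>Families of polynomials\<close>

text \<open>
  \<open>F\<close> is the ring of polynomial functions of the parameters, \<open>polys F n\<close> consists of the families of
  polynomials of formal degree at most \<open>n\<close> with coefficients in \<open>F\<close>, and \<open>all_evals F\<close> is the ring
  of polynomial functions with one more field parameter. A predicate over \<open>rbase F R\<close> and \<open>gbase F G\<close>
  sees the field only through leading terms of elements of \<open>F\<close>.
\<close>

definition fun_ring :: "('e \<Rightarrow> 'k) set \<Rightarrow> bool" where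
  "fun_ring F \<longleftrightarrow> (\<lambda>e. 0) \<in> F \<and> (\<lambda>e. 1) \<in> F \<and> (\<forall>f\<in>F. (\<lambda>e. - f e) \<in> F) \<and>
     (\<forall>f\<in>F. \<forall>g\<in>F. (\<lambda>e. f e + g e) \<in> F \<and> (\<lambda>e. f e * g e) \<in> F)"

definition polys :: "('e \<Rightarrow> 'k) set \<Rightarrow> nat \<Rightarrow> ('e \<Rightarrow> 'k poly) set" where
  "polys F n = {h. (\<forall>e. degree (h e) \<le> n) \<and> (\<forall>i. (\<lambda>e. coeff (h e) i) \<in> F)}"

definition evals :: "('e \<Rightarrow> 'k) set \<Rightarrow> nat \<Rightarrow> ('e \<times> 'k \<Rightarrow> 'k) set" where
  "evals F n = (\<lambda>h (e, t). poly (h e) t) ` polys F n"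

definition all_evals :: "('e \<Rightarrow> 'k) set \<Rightarrow> ('e \<times> 'k \<Rightarrow> 'k) set" where
  "all_evals F = (\<Union>n. evals F n)"

definition rbase :: "('e \<Rightarrow> 'k) set \<Rightarrow> ('e \<Rightarrow> 'r) set \<Rightarrow> ('e \<Rightarrow> 'r) set" where
  "rbase F R = R \<union> (\<lambda>f e. ac (f e)) ` F"

definition gbase :: "('e \<Rightarrow> 'k) set \<Rightarrow> ('e \<Rightarrow> 'g) set \<Rightarrow> ('e \<Rightarrow> 'g) set" where
  "gbase F G = G \<union> (\<lambda>f e. val0 (f e)) ` F"

lemma polys_mono: "m \<le> n \<Longrightarrow> polys F m \<subseteq> polys F n"
  by (auto simp: polys_def intro: order_trans)

lemma evals_mono: "m \<le> n \<Longrightarrow> evals F m \<subseteq> evals F n"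
  unfolding evals_def by (intro image_mono polys_mono)

lemma evals_subset: "evals F n \<subseteq> all_evals F"
  by (auto simp: all_evals_def)

lemma rbase_mono: "F \<subseteq> F' \<Longrightarrow> rbase F R \<subseteq> rbase F' R"
  and gbase_mono: "F \<subseteq> F' \<Longrightarrow> gbase F G \<subseteq> gbase F' G"
  by (auto simp: rbase_def gbase_def)

lemma rbaseI: "f \<in> F \<Longrightarrow> (\<lambda>e. ac (f e)) \<in> rbase F R"
  and gbaseI: "f \<in> F \<Longrightarrow> (\<lambda>e. val0 (f e)) \<in> gbase F G"
  by (auto simp: rbase_def gbase_def)

context
  fixes F :: "('e \<Rightarrow> 'k) set"
  assumes F: "fun_ring F"
begin

lemma F_0: "(\<lambda>e. 0) \<in> F" and F_1: "(\<lambda>e. 1) \<in> F"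
  and F_minus: "f \<in> F \<Longrightarrow> (\<lambda>e. - f e) \<in> F"
  and F_add: "f \<in> F \<Longrightarrow> g \<in> F \<Longrightarrow> (\<lambda>e. f e + g e) \<in> F"
  and F_mult: "f \<in> F \<Longrightarrow> g \<in> F \<Longrightarrow> (\<lambda>e. f e * g e) \<in> F"
  using F by (auto simp: fun_ring_def)

lemma F_diff: "f \<in> F \<Longrightarrow> g \<in> F \<Longrightarrow> (\<lambda>e. f e - g e) \<in> F"
  using F_add[of f "\<lambda>e. - g e"] F_minus[of g] by simp

lemma F_of_nat: "(\<lambda>e. of_nat n) \<in> F"
  by (induction n) (simp_all add: F_0 F_add F_1)

lemma F_sum: "finite A \<Longrightarrow> (\<And>a. a \<in> A \<Longrightarrow> f a \<in> F) \<Longrightarrow> (\<lambda>e. \<Sum>a\<in>A. f a e) \<in> F"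
  by (induction A rule: finite_induct) (simp_all add: F_0 F_add)

lemma polys_coeff: "h \<in> polys F n \<Longrightarrow> (\<lambda>e. coeff (h e) i) \<in> F"
  and polys_degree: "h \<in> polys F n \<Longrightarrow> degree (h e) \<le> n"
  by (auto simp: polys_def)

lemma polysI: "(\<And>e. degree (h e) \<le> n) \<Longrightarrow> (\<And>i. (\<lambda>e. coeff (h e) i) \<in> F) \<Longrightarrow> h \<in> polys F n"
  by (simp add: polys_def)

lemma polys_const: "f \<in> F \<Longrightarrow> (\<lambda>e. [:f e:]) \<in> polys F n"
proof (rule polysI)
  fix i assume "f \<in> F"
  then show "(\<lambda>e. coeff [:f e:] i) \<in> F" by (cases i) (simp_all add: F_0)
qed simp

lemma polys_diff: "h \<in> polys F n \<Longrightarrow> h' \<in> polys F n \<Longrightarrow> (\<lambda>e. h e - h' e) \<in> polys F n"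
  by (rule polysI) (simp_all add: polys_degree degree_diff_le F_diff polys_coeff)

lemma polys_add: "h \<in> polys F n \<Longrightarrow> h' \<in> polys F n \<Longrightarrow> (\<lambda>e. h e + h' e) \<in> polys F n"
  by (rule polysI) (simp_all add: polys_degree degree_add_le F_add polys_coeff)

lemma polys_mult: "h \<in> polys F n \<Longrightarrow> h' \<in> polys F m \<Longrightarrow> (\<lambda>e. h e * h' e) \<in> polys F (n + m)"
proof (rule polysI)
  fix e assume "h \<in> polys F n" "h' \<in> polys F m"
  then show "degree (h e * h' e) \<le> n + m"
    using degree_mult_le[of "h e" "h' e"] by (meson add_mono order_trans polys_degree)
qed (simp add: coeff_mult F_sum F_mult polys_coeff)

lemma polys_monom: "f \<in> F \<Longrightarrow> (\<lambda>e. monom (f e) n) \<in> polys F n"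
proof (rule polysI)
  fix i assume "f \<in> F"
  then show "(\<lambda>e. coeff (monom (f e) n) i) \<in> F" by (cases "n = i") (simp_all add: F_0)
qed (rule degree_monom_le)

lemma polys_sum: "finite A \<Longrightarrow> (\<And>a. a \<in> A \<Longrightarrow> h a \<in> polys F n) \<Longrightarrow> (\<lambda>e. \<Sum>a\<in>A. h a e) \<in> polys F n"
proof (induction A rule: finite_induct)
  case empty
  then show ?case using polys_const[OF F_0, of n] by simp
qed (simp add: polys_add)

lemma polys_pderiv: "h \<in> polys F n \<Longrightarrow> (\<lambda>e. pderiv (h e)) \<in> polys F (n - 1)"
proof (rule polysI)
  fix i assume "h \<in> polys F n"
  then show "(\<lambda>e. coeff (pderiv (h e)) i) \<in> F"
    unfolding coeff_pderiv by (intro F_mult F_of_nat polys_coeff)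
qed (simp add: degree_pderiv polys_degree diff_le_mono)

lemma polys_pderiv_iter: "h \<in> polys F n \<Longrightarrow> (\<lambda>e. (pderiv ^^ i) (h e)) \<in> polys F n"
proof (induction i)
  case (Suc i)
  then show ?case using polys_pderiv[of "\<lambda>e. (pderiv ^^ i) (h e)" n] polys_mono[of "n - 1" n F] by auto
qed simp

lemma evalsI: "h \<in> polys F n \<Longrightarrow> (\<lambda>e. poly (h (fst e)) (snd e)) \<in> evals F n"
  unfolding evals_def by (auto simp: case_prod_unfold)

lemma evals_iff: "f \<in> evals F n \<longleftrightarrow> (\<exists>h\<in>polys F n. f = (\<lambda>e. poly (h (fst e)) (snd e)))"
  unfolding evals_def by (auto simp: case_prod_unfold)

lemma rbase_evalsE:
  assumes "f \<in> rbase (evals F n) (lift R)"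
  obtains g where "g \<in> R" "f = g \<circ> fst"
    | h where "h \<in> polys F n" "f = (\<lambda>e. ac (poly (h (fst e)) (snd e)))"
  using assms unfolding rbase_def by (auto simp: evals_iff)

lemma gbase_evalsE:
  assumes "f \<in> gbase (evals F n) (lift G)"
  obtains g where "g \<in> G" "f = g \<circ> fst"
    | h where "h \<in> polys F n" "f = (\<lambda>e. val0 (poly (h (fst e)) (snd e)))"
  using assms unfolding gbase_def by (auto simp: evals_iff)

lemma rbase_all_evals: "f \<in> rbase (all_evals F) R \<Longrightarrow> \<exists>n. f \<in> rbase (evals F n) R"
  and gbase_all_evals: "f' \<in> gbase (all_evals F) G \<Longrightarrow> \<exists>n. f' \<in> gbase (evals F n) G"
  unfolding rbase_def gbase_def all_evals_def by auto

lemma all_evalsI: "h \<in> polys F n \<Longrightarrow> (\<lambda>e. poly (h (fst e)) (snd e)) \<in> all_evals F"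
  using evalsI evals_subset by blast

lemma taylor_evals:
  assumes h: "h \<in> polys F n"
  shows "(\<lambda>e. taylor (h (fst e)) (snd e) i) \<in> all_evals F"
proof -
  have "taylor (h e) c i = poly (\<Sum>l\<le>n. monom (of_nat (l choose i) * coeff (h e) l) (l - i)) c" for e c
    using taylor_shift[OF polys_degree[OF h], of e 0 c i] by (simp add: poly_sum poly_monom)
  moreover have "(\<lambda>e. \<Sum>l\<le>n. monom (of_nat (l choose i) * coeff (h e) l) (l - i)) \<in> polys F n"
  proof (rule polys_sum)
    fix l assume "l \<in> {..n}"
    then have "l - i \<le> n" by auto
    then show "(\<lambda>e. monom (of_nat (l choose i) * coeff (h e) l) (l - i)) \<in> polys F n"
      using polys_monom[OF F_mult[OF F_of_nat polys_coeff[OF h]]] polys_mono by blast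
  qed simp
  ultimately show ?thesis using all_evalsI by simp
qed

text \<open>The identity is stated at the roots of \<open>g\<close>, where the quotient disappears. The leading coefficient
  is the formal one and may vanish for some parameters; the identity holds all the same.\<close>

lemma pseudo_division:
  assumes g: "g \<in> polys F (Suc n)"
  shows "h \<in> polys F m \<Longrightarrow> \<exists>k. \<exists>r\<in>polys F n. \<forall>e c. poly (g e) c = 0 \<longrightarrow>
    poly (r e) c = coeff (g e) (Suc n) ^ k * poly (h e) c"
proof (induction m arbitrary: h)
  case 0
  then have "h \<in> polys F n" using polys_mono[of 0 n] by auto
  then show ?case by (intro exI[of _ 0] bexI[of _ h]) auto
next
  case (Suc m)
  show ?case
  proof (cases "Suc m \<le> n")
    case True
    then have "h \<in> polys F n" using Suc.prems polys_mono by blast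
    then show ?thesis by (intro exI[of _ 0] bexI[of _ h]) auto
  next
    case False
    define u where "u e = [:coeff (g e) (Suc n):] * h e - monom (coeff (h e) (Suc m)) (m - n) * g e" for e
    have "(\<lambda>e. [:coeff (g e) (Suc n):] * h e) \<in> polys F (0 + Suc m)"
      by (intro polys_mult polys_const polys_coeff[OF g] Suc.prems)
    moreover have "(\<lambda>e. monom (coeff (h e) (Suc m)) (m - n) * g e) \<in> polys F (m - n + Suc n)"
      by (intro polys_mult polys_monom polys_coeff[OF Suc.prems] g)
    moreover have "m - n + Suc n = Suc m" using False by simp
    ultimately have u: "u \<in> polys F (Suc m)" unfolding u_def using polys_diff by simp
    have "u \<in> polys F m"
    proof (rule polysI)
      fix e
      have "coeff (u e) (Suc m) = 0"
        unfolding u_def using False by (simp add: coeff_monom_mult Suc_diff_le)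
      then show "degree (u e) \<le> m"
        using polys_degree[OF u, of e]
        by (metis degree_0 le_Suc_eq le0 leading_coeff_0_iff)
    qed (rule polys_coeff[OF u])
    from Suc.IH[OF this] obtain k r where r: "r \<in> polys F n"
      "\<And>e c. poly (g e) c = 0 \<Longrightarrow> poly (r e) c = coeff (g e) (Suc n) ^ k * poly (u e) c" by blast
    have "poly (r e) c = coeff (g e) (Suc n) ^ Suc k * poly (h e) c" if "poly (g e) c = 0" for e c
      using r(2)[OF that] that by (simp add: u_def)
    then show ?thesis using r(1) by blast
  qed
qed

section \<open>Elimination of a field quantifier\<close>

context
  fixes R :: "('e \<Rightarrow> 'r) set" and G :: "('e \<Rightarrow> 'g) set"
begin

text \<open>The bases for the parameters \<open>e\<close>, then \<open>(e, c)\<close>, \<open>((e, c), \<rho>)\<close> and \<open>(((e, c), \<rho>), \<gamma>)\<close>, where \<open>c\<close> is a centre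
  and \<open>(\<rho>, \<gamma>)\<close> the leading term of a step from it.\<close>

abbreviation "R0 \<equiv> rbase F R"
abbreviation "G0 \<equiv> gbase F G"
abbreviation R1 :: "('e \<times> 'k \<Rightarrow> 'r) set" where "R1 \<equiv> rbase (all_evals F) (lift R)"
abbreviation G1 :: "('e \<times> 'k \<Rightarrow> 'g) set" where "G1 \<equiv> gbase (all_evals F) (lift G)"
abbreviation R2 :: "(('e \<times> 'k) \<times> 'r \<Rightarrow> 'r) set" where "R2 \<equiv> insert snd (lift R1)"
abbreviation G2 :: "(('e \<times> 'k) \<times> 'r \<Rightarrow> 'g) set" where "G2 \<equiv> lift G1"
abbreviation R3 :: "((('e \<times> 'k) \<times> 'r) \<times> 'g \<Rightarrow> 'r) set" where "R3 \<equiv> lift R2"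
abbreviation G3 :: "((('e \<times> 'k) \<times> 'r) \<times> 'g \<Rightarrow> 'g) set" where "G3 \<equiv> insert snd (lift G2)"

abbreviation param :: "(('e \<times> 'k) \<times> 'r) \<times> 'g \<Rightarrow> 'e" where "param w \<equiv> fst (fst (fst w))"
abbreviation cent :: "(('e \<times> 'k) \<times> 'r) \<times> 'g \<Rightarrow> 'k" where "cent w \<equiv> snd (fst (fst w))"

lemma R3I: "f \<in> R1 \<Longrightarrow> rfun R3 G3 (\<lambda>w. f (fst (fst w)))"
  and G3I: "f' \<in> G1 \<Longrightarrow> gfun R3 G3 (\<lambda>w. f' (fst (fst w)))"
  and R3_snd: "rfun R3 G3 (\<lambda>w. snd (fst w))" and G3_snd: "gfun R3 G3 snd"
  by (rule rfun_base gfun_base; force simp: comp_def)+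

lemma rfun_term_ac:
  "h \<in> polys F n \<Longrightarrow>
    rfun R3 G3 (\<lambda>w. term_ac (h (param w)) (cent w) (snd (fst w)) i)"
  unfolding term_ac_def
proof (intro rfun_mult rfun_power R3_snd)
  assume "h \<in> polys F n"
  then have "(\<lambda>e. ac (taylor (h (fst e)) (snd e) i)) \<in> R1"
    by (intro rbaseI taylor_evals)
  then show "rfun R3 G3 (\<lambda>w. ac (taylor (h (param w)) (cent w) i))" by (rule R3I)
qed

lemma gfun_term_val:
  "h \<in> polys F n \<Longrightarrow>
    gfun R3 G3 (\<lambda>w. term_val (h (param w)) (cent w) (snd w) i)"
  unfolding term_val_def
proof (intro gfun_add gfun_nmul G3_snd)
  assume "h \<in> polys F n"
  then have "(\<lambda>e. val0 (taylor (h (fst e)) (snd e) i)) \<in> G1"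
    by (intro gbaseI taylor_evals)
  then show "gfun R3 G3 (\<lambda>w. val0 (taylor (h (param w)) (cent w) i))" by (rule G3I)
qed

lemma definable_pgood:
  "h \<in> polys F n \<Longrightarrow>
    definable R3 G3 (\<lambda>w. pgood d (h (param w)) (cent w) (snd (fst w)) (snd w))"
  by (rule definable_good) (rule rfun_term_ac gfun_term_val; assumption)+

text \<open>Where \<open>c\<close> is a good centre of the finitely many polynomials in \<open>P\<close>, the field element \<open>c + s\<close> enters
  \<open>P\<close> only through \<open>c\<close> and the leading term of \<open>s\<close>.\<close>

lemma center_form:
  assumes "definable (rbase (evals F n) (lift R)) (gbase (evals F n) (lift G)) P"
  obtains S P1 where "finite S" "S \<subseteq> polys F n" "definable R3 G3 P1"
    "\<And>e c s. s \<noteq> 0 \<Longrightarrow> (\<And>h. h \<in> S \<Longrightarrow> pgood n (h e) c (ac s) (v s)) \<Longrightarrow>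
      P (e, c + s) \<longleftrightarrow> P1 (((e, c), ac s), v s)"
proof -
  obtain A B where AB: "finite A" "A \<subseteq> rbase (evals F n) (lift R)" "finite B"
    "B \<subseteq> gbase (evals F n) (lift G)" "definable A B P"
    using assms by (rule definable_finite)
  define rel where "rel S w e \<longleftrightarrow> (\<exists>e0 c s. w = (((e0, c), ac s), v s) \<and> e = (e0, c + s) \<and> s \<noteq> 0 \<and>
    (\<forall>h\<in>S. pgood n (h e0) c (ac s) (v s)))" for S w and e :: "'e \<times> 'k"
  have rel_mono: "rel S w e \<Longrightarrow> S' \<subseteq> S \<Longrightarrow> rel S' w e" for S S' w e
    unfolding rel_def by blast
  have "\<exists>S f'. finite S \<and> S \<subseteq> polys F n \<and> rfun R3 G3 f' \<and> (\<forall>w e. rel S w e \<longrightarrow> f e = f' w)"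
    if "f \<in> A" for f
  proof -
    have "f \<in> rbase (evals F n) (lift R)" using that AB(2) by blast
    then show ?thesis
    proof (cases rule: rbase_evalsE)
      case 1
      then have "f \<in> R1" by (auto simp: rbase_def)
      then show ?thesis using R3I[of f] 1(2)
        by (intro exI[of _ "{}"] exI[of _ "\<lambda>w. f (fst (fst w))"]) (auto simp: rel_def)
    next
      case (2 h)
      show ?thesis
      proof (intro exI conjI allI impI)
        show "finite {h}" "{h} \<subseteq> polys F n" using 2(1) by simp_all
        show "rfun R3 G3 (\<lambda>w. lead_ac n (term_ac (h (param w)) (cent w) (snd (fst w)))
            (term_val (h (param w)) (cent w) (snd w)))"
          by (rule rfun_lead_ac) (rule rfun_term_ac[OF 2(1)] gfun_term_val[OF 2(1)])+
        show "f e = lead_ac n (term_ac (h (param w)) (cent w) (snd (fst w)))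
            (term_val (h (param w)) (cent w) (snd w))" if "rel {h} w e" for w e
        proof -
          obtain e0 c s where "w = (((e0, c), ac s), v s)" "e = (e0, c + s)" "s \<noteq> 0"
            "pgood n (h e0) c (ac s) (v s)" using \<open>rel {h} w e\<close> unfolding rel_def by blast
          then show ?thesis using pgood_values(1)[OF polys_degree[OF 2(1)], of s e0 c] by (simp add: 2(2))
        qed
      qed
    qed
  qed
  then have "\<forall>f\<in>A. \<exists>S. finite S \<and> S \<subseteq> polys F n \<and> (\<exists>f'. rfun R3 G3 f' \<and> (\<forall>w e. rel S w e \<longrightarrow> f e = f' w))"
    unfolding ex_simps conj_assoc by (rule ballI)
  from bchoice[OF this] obtain SA where SA: "\<forall>f\<in>A. finite (SA f) \<and> SA f \<subseteq> polys F n \<and>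
    (\<exists>f'. rfun R3 G3 f' \<and> (\<forall>w e. rel (SA f) w e \<longrightarrow> f e = f' w))" by (rule exE)
  have "\<exists>S f'. finite S \<and> S \<subseteq> polys F n \<and> gfun R3 G3 f' \<and> (\<forall>w e. rel S w e \<longrightarrow> f e = f' w)"
    if "f \<in> B" for f
  proof -
    have "f \<in> gbase (evals F n) (lift G)" using that AB(4) by blast
    then show ?thesis
    proof (cases rule: gbase_evalsE)
      case 1
      then have "f \<in> G1" by (auto simp: gbase_def)
      then show ?thesis using G3I[of f] 1(2)
        by (intro exI[of _ "{}"] exI[of _ "\<lambda>w. f (fst (fst w))"]) (auto simp: rel_def)
    next
      case (2 h)
      show ?thesis
      proof (intro exI conjI allI impI)
        show "finite {h}" "{h} \<subseteq> polys F n" using 2(1) by simp_all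
        show "gfun R3 G3 (\<lambda>w. lead_val n (term_ac (h (param w)) (cent w) (snd (fst w)))
            (term_val (h (param w)) (cent w) (snd w)))"
          by (rule gfun_lead_val) (rule rfun_term_ac[OF 2(1)] gfun_term_val[OF 2(1)])+
        show "f e = lead_val n (term_ac (h (param w)) (cent w) (snd (fst w)))
            (term_val (h (param w)) (cent w) (snd w))" if "rel {h} w e" for w e
        proof -
          obtain e0 c s where "w = (((e0, c), ac s), v s)" "e = (e0, c + s)" "s \<noteq> 0"
            "pgood n (h e0) c (ac s) (v s)" using \<open>rel {h} w e\<close> unfolding rel_def by blast
          then show ?thesis using pgood_values(2)[OF polys_degree[OF 2(1)], of s e0 c] by (simp add: 2(2))
        qed
      qed
    qed
  qed
  then have "\<forall>f\<in>B. \<exists>S. finite S \<and> S \<subseteq> polys F n \<and> (\<exists>f'. gfun R3 G3 f' \<and> (\<forall>w e. rel S w e \<longrightarrow> f e = f' w))"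
    unfolding ex_simps conj_assoc by (rule ballI)
  from bchoice[OF this] obtain SB where SB: "\<forall>f\<in>B. finite (SB f) \<and> SB f \<subseteq> polys F n \<and>
    (\<exists>f'. gfun R3 G3 f' \<and> (\<forall>w e. rel (SB f) w e \<longrightarrow> f e = f' w))" by (rule exE)
  define S where "S = (\<Union>f\<in>A. SA f) \<union> (\<Union>f\<in>B. SB f)"
  have SAS: "SA f \<subseteq> S" if "f \<in> A" for f using that by (auto simp: S_def)
  have SBS: "SB f \<subseteq> S" if "f \<in> B" for f using that by (auto simp: S_def)
  have "\<exists>P1. definable R3 G3 P1 \<and> (\<forall>w e. rel S w e \<longrightarrow> (P e \<longleftrightarrow> P1 w))"
  proof (rule definable_transfer[OF AB(5)])
    show "\<exists>f'. rfun R3 G3 f' \<and> (\<forall>w e. rel S w e \<longrightarrow> f e = f' w)" if f: "f \<in> A" for f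
    proof -
      obtain f' where f': "rfun R3 G3 f'" "\<And>w e. rel (SA f) w e \<Longrightarrow> f e = f' w"
        using bspec[OF SA f] by (elim conjE exE) simp
      show ?thesis
      proof (intro exI conjI allI impI)
        fix w e assume "rel S w e"
        then have "rel (SA f) w e" using SAS[OF f] by (rule rel_mono)
        then show "f e = f' w" by (rule f'(2))
      qed (rule f'(1))
    qed
    show "\<exists>f'. gfun R3 G3 f' \<and> (\<forall>w e. rel S w e \<longrightarrow> f e = f' w)" if f: "f \<in> B" for f
    proof -
      obtain f' where f': "gfun R3 G3 f'" "\<And>w e. rel (SB f) w e \<Longrightarrow> f e = f' w"
        using bspec[OF SB f] by (elim conjE exE) simp
      show ?thesis
      proof (intro exI conjI allI impI)
        fix w e assume "rel S w e"
        then have "rel (SB f) w e" using SBS[OF f] by (rule rel_mono)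
        then show "f e = f' w" by (rule f'(2))
      qed (rule f'(1))
    qed
  qed
  then obtain P1 where P1: "definable R3 G3 P1" "\<And>w e. rel S w e \<Longrightarrow> P e \<longleftrightarrow> P1 w" by blast
  show ?thesis
  proof (rule that[of S P1])
    show "finite S" using AB(1,3) SA SB by (simp add: S_def)
    show "S \<subseteq> polys F n" using SA SB by (auto simp: S_def)
    fix e c s assume "s \<noteq> 0" "\<And>h. h \<in> S \<Longrightarrow> pgood n (h e) c (ac s) (v s)"
    then have "rel S (((e, c), ac s), v s) (e, c + s)" unfolding rel_def by blast
    then show "P (e, c + s) \<longleftrightarrow> P1 (((e, c), ac s), v s)" by (rule P1(2))
  qed (rule P1(1))
qed

abbreviation is_center :: "('e \<Rightarrow> 'k poly) set \<Rightarrow> 'e \<Rightarrow> 'k \<Rightarrow> bool" where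
  "is_center D e c \<equiv> c = 0 \<or> (\<exists>h\<in>D. h e \<noteq> 0 \<and> poly (h e) c = 0)"

text \<open>The set \<open>D\<close> of iterated derivatives supplies the centres uniformly in the parameters, with no
  increase of the degree.\<close>

lemma ex_centers:
  assumes S: "finite S" "S \<subseteq> polys F n"
  obtains D where "finite D" "D \<subseteq> polys F n"
    "\<And>e t. \<exists>c. is_center D e c \<and> (t \<noteq> c \<longrightarrow> (\<forall>h\<in>S. pgood n (h e) c (ac (t - c)) (v (t - c))))"
proof -
  define D where "D = (\<lambda>(h, i) e. (pderiv ^^ i) (h e :: 'k poly)) ` (S \<times> {..n})"
  have D: "(\<lambda>e. (pderiv ^^ i) (h e)) \<in> D" if "h \<in> S" "i \<le> n" for h i
    using that unfolding D_def by (intro image_eqI[of _ _ "(h, i)"]) auto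
  show ?thesis
  proof (rule that)
    show "finite D" using S by (simp add: D_def)
    show "D \<subseteq> polys F n"
    proof
      fix h' assume "h' \<in> D"
      then obtain h i where "h \<in> S" "h' = (\<lambda>e. (pderiv ^^ i) (h e))" unfolding D_def by force
      then show "h' \<in> polys F n" using S(2) polys_pderiv_iter[of h n i] by blast
    qed
    fix e t
    obtain c where c: "\<forall>p\<in>(\<lambda>h. h e) ` S. good_center p t (t - c)"
      "c = 0 \<or> (\<exists>p\<in>(\<lambda>h. h e) ` S. \<exists>i\<le>degree p. (pderiv ^^ i) p \<noteq> 0 \<and> poly ((pderiv ^^ i) p) c = 0)"
      using ex_common_good_center[OF finite_imageI[OF S(1), of "\<lambda>h. h e"], of t] by blast
    have "is_center D e c"
    proof (rule disjE[OF c(2)])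
      assume "\<exists>p\<in>(\<lambda>h. h e) ` S. \<exists>i\<le>degree p. (pderiv ^^ i) p \<noteq> 0 \<and> poly ((pderiv ^^ i) p) c = 0"
      then obtain h i where h: "h \<in> S" "i \<le> degree (h e)" "(pderiv ^^ i) (h e) \<noteq> 0"
        "poly ((pderiv ^^ i) (h e)) c = 0" by blast
      have "i \<le> n" using h(1,2) S(2) polys_degree[of h n e] by auto
      then have "\<exists>h\<in>D. h e \<noteq> 0 \<and> poly (h e) c = 0" using h by (intro bexI[OF _ D[OF h(1)]]) auto
      then show ?thesis ..
    qed (rule disjI1)
    moreover have "pgood n (h e) c (ac (t - c)) (v (t - c))" if "t \<noteq> c" "h \<in> S" for h
      using that c(1) S(2) by (intro good_center_imp_pgood) (auto intro: polys_degree)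
    ultimately show "\<exists>c. is_center D e c \<and> (t \<noteq> c \<longrightarrow> (\<forall>h\<in>S. pgood n (h e) c (ac (t - c)) (v (t - c))))"
      by blast
  qed
qed

lemma definable_subst_0:
  assumes "definable R1 G1 P" shows "definable R0 G0 (\<lambda>e. P (e, 0))"
proof (rule definable_comp[OF assms, of "\<lambda>e. (e, 0)"])
  have *: "(\<lambda>e. f (e, 0)) \<in> F" if f: "f \<in> all_evals F" for f
    using that unfolding all_evals_def by (auto simp: evals_iff poly_0_coeff_0 polys_coeff)
  show "f \<circ> (\<lambda>e. (e, 0)) \<in> R0" if "f \<in> R1" for f
    using that * unfolding rbase_def by (auto simp: comp_def)
  show "f \<circ> (\<lambda>e. (e, 0)) \<in> G0" if "f \<in> G1" for f
    using that * unfolding gbase_def by (auto simp: comp_def)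
qed

text \<open>The condition \<open>g e \<noteq> 0\<close> excludes the zero polynomial, for which the quantifier would range over the
  whole field.\<close>

definition roots_eliminable :: "nat \<Rightarrow> bool" where
  "roots_eliminable n \<longleftrightarrow> (\<forall>g\<in>polys F n. \<forall>P. definable R1 G1 P \<longrightarrow>
     definable R0 G0 (\<lambda>e. \<exists>c. g e \<noteq> 0 \<and> poly (g e) c = 0 \<and> P (e, c)))"

lemma definable_ex_center:
  assumes "roots_eliminable n" "finite D" "D \<subseteq> polys F n" "definable R1 G1 P"
  shows "definable R0 G0 (\<lambda>e. \<exists>c. is_center D e c \<and> P (e, c))"
proof -
  have "definable R0 G0 (\<lambda>e. P (e, 0) \<or> (\<exists>h\<in>D. \<exists>c. h e \<noteq> 0 \<and> poly (h e) c = 0 \<and> P (e, c)))"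
    using assms by (intro definable_or definable_subst_0 definable_bex) (auto simp: roots_eliminable_def)
  then show ?thesis by (rule back_subst[of "definable R0 G0"]) blast
qed

lemma definable_ex_rv:
  assumes "definable R3 G3 Q"
  shows "definable R1 G1 (\<lambda>e. \<exists>\<rho> \<gamma>. Q ((e, \<rho>), \<gamma>))"
  by (rule definable_exR, rule definable_exV[where Q = Q], rule assms)

lemma definable_coeff_eq_0: "h \<in> polys F n \<Longrightarrow> definable R0 G0 (\<lambda>e. coeff (h e) i = 0)"
proof -
  assume "h \<in> polys F n"
  then have "(\<lambda>e. ac (coeff (h e) i)) \<in> R0" by (intro rbaseI polys_coeff)
  then have "definable R0 G0 (\<lambda>e. ac (coeff (h e) i) = 0)"
    by (intro definable_eqR rfun_const) (rule rfun_base)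
  then show ?thesis by simp
qed

lemma definable_root: "h \<in> polys F n \<Longrightarrow> definable R1 G1 (\<lambda>e. poly (h (fst e)) (snd e) = 0)"
proof -
  assume "h \<in> polys F n"
  then have "(\<lambda>e. ac (poly (h (fst e)) (snd e))) \<in> R1" by (intro rbaseI all_evalsI)
  then have "definable R1 G1 (\<lambda>e. ac (poly (h (fst e)) (snd e)) = 0)"
    by (intro definable_eqR rfun_const) (rule rfun_base)
  then show ?thesis by simp
qed

text \<open>At a root of \<open>g\<close> the leading term of \<open>h\<close> is that of the pseudo-remainder divided by a power of the
  leading coefficient. The value needs a case distinction because \<open>val0 0 = 0\<close>.\<close>

lemma definable_mod:
  assumes g: "g \<in> polys F (Suc n)" and P: "definable R1 G1 P"
  obtains P' where "definable (rbase (evals F n) (lift R)) (gbase (evals F n) (lift G)) P'"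
    "\<And>e c. coeff (g e) (Suc n) \<noteq> 0 \<Longrightarrow> poly (g e) c = 0 \<Longrightarrow> P (e, c) \<longleftrightarrow> P' (e, c)"
proof -
  let ?R = "rbase (evals F n) (lift R)" and ?G = "gbase (evals F n) (lift G)"
  let ?l = "\<lambda>e. coeff (g e) (Suc n)"
  define rel where "rel d e \<longleftrightarrow> d = e \<and> ?l (fst e) \<noteq> 0 \<and> poly (g (fst e)) (snd e) = 0" for d e :: "'e \<times> 'k"
  have ev: "rfun ?R ?G (\<lambda>e. ac (poly (h (fst e)) (snd e)))" "gfun ?R ?G (\<lambda>e. val0 (poly (h (fst e)) (snd e)))"
    if "h \<in> polys F n" for h
    by (intro rfun_base gfun_base rbaseI gbaseI evalsI that)+
  have l: "rfun ?R ?G (\<lambda>e. ac (?l (fst e)))" "gfun ?R ?G (\<lambda>e. val0 (?l (fst e)))"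
    using ev[OF polys_const[OF polys_coeff[OF g, of "Suc n"]]] by simp_all
  have "\<exists>P'. definable ?R ?G P' \<and> (\<forall>d e. rel d e \<longrightarrow> (P e \<longleftrightarrow> P' d))"
  proof (rule definable_transfer[OF P])
    fix f assume "f \<in> R1"
    then obtain m where "f \<in> rbase (evals F m) (lift R)" using rbase_all_evals by blast
    then show "\<exists>f'. rfun ?R ?G f' \<and> (\<forall>d e. rel d e \<longrightarrow> f e = f' d)"
    proof (cases rule: rbase_evalsE)
      case 1
      then have "rfun ?R ?G f" by (intro rfun_base) (auto simp: rbase_def)
      then show ?thesis by (auto simp: rel_def)
    next
      case (2 h)
      obtain k r where r: "r \<in> polys F n"
        "\<And>e c. poly (g e) c = 0 \<Longrightarrow> poly (r e) c = ?l e ^ k * poly (h e) c"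
        using pseudo_division[OF g 2(1)] by blast
      show ?thesis
      proof (intro exI conjI allI impI)
        show "rfun ?R ?G (\<lambda>e. ac (poly (r (fst e)) (snd e)) / ac (?l (fst e)) ^ k)"
          by (intro rfun_divide rfun_power ev r(1) l)
        show "f e = ac (poly (r (fst d)) (snd d)) / ac (?l (fst d)) ^ k" if "rel d e" for d e
          using that r(2) by (simp add: rel_def 2(2) ac_mult ac_power)
      qed
    qed
  next
    fix f assume "f \<in> G1"
    then obtain m where "f \<in> gbase (evals F m) (lift G)" using gbase_all_evals by blast
    then show "\<exists>f'. gfun ?R ?G f' \<and> (\<forall>d e. rel d e \<longrightarrow> f e = f' d)"
    proof (cases rule: gbase_evalsE)
      case 1
      then have "gfun ?R ?G f" by (intro gfun_base) (auto simp: gbase_def)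
      then show ?thesis by (auto simp: rel_def)
    next
      case (2 h)
      obtain k r where r: "r \<in> polys F n"
        "\<And>e c. poly (g e) c = 0 \<Longrightarrow> poly (r e) c = ?l e ^ k * poly (h e) c"
        using pseudo_division[OF g 2(1)] by blast
      show ?thesis
      proof (intro exI conjI allI impI)
        show "gfun ?R ?G (\<lambda>e. if ac (poly (r (fst e)) (snd e)) = 0 then 0
            else val0 (poly (r (fst e)) (snd e)) + - nmul k (val0 (?l (fst e))))"
          by (intro gfun_if gfun_const gfun_add gfun_minus gfun_nmul definable_eqR rfun_const ev r(1) l)
        show "f e = (if ac (poly (r (fst d)) (snd d)) = 0 then 0
            else val0 (poly (r (fst d)) (snd d)) + - nmul k (val0 (?l (fst d))))" if "rel d e" for d e
          using that r(2) by (auto simp: rel_def 2(2) val0_def v_mult v_power)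
      qed
    qed
  qed
  then obtain P' where "definable ?R ?G P'" "\<And>d e. rel d e \<Longrightarrow> P e \<longleftrightarrow> P' d" by blast
  then show ?thesis using that[of P'] by (simp add: rel_def)
qed

text \<open>
  Induction on the formal degree. If the leading coefficient vanishes, drop it. Otherwise pass to a
  condition \<open>P'\<close> of degree at most \<open>n\<close> in the root \<open>t\<close>, and describe \<open>t\<close> by a common good centre \<open>c\<close> of
  the polynomials in \<open>P'\<close> and of the derivative of \<open>g\<close>: either \<open>t = c\<close>, or \<open>t - c\<close> has a leading term
  \<open>(\<rho>, \<gamma>)\<close> for which these polynomials are good at \<open>c\<close> and \<open>g\<close> is not. Conversely, such a leading term
  belongs to a root of \<open>g\<close>. The centre is \<open>0\<close> or a root of a polynomial of degree at most \<open>n\<close>, so the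
  induction hypothesis removes it.
\<close>

lemma roots_eliminable: "roots_eliminable n"
proof (induction n)
  case 0
  have no_root: "\<not> (g e \<noteq> 0 \<and> poly (g e) c = 0)" if g: "g \<in> polys F 0" for g e c
  proof -
    obtain a where "g e = [:a:]" using polys_degree[OF g, of e] by (auto elim: degree_eq_zeroE)
    then show ?thesis by simp
  qed
  show ?case unfolding roots_eliminable_def
  proof (intro ballI allI impI)
    fix g P assume "g \<in> polys F 0"
    then have "(\<lambda>e. \<exists>c. g e \<noteq> 0 \<and> poly (g e) c = 0 \<and> P (e, c)) = (\<lambda>e. False)"
      using no_root by blast
    then show "definable R0 G0 (\<lambda>e. \<exists>c. g e \<noteq> 0 \<and> poly (g e) c = 0 \<and> P (e, c))" by simp
  qed
next
  case (Suc n)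
  show ?case unfolding roots_eliminable_def
  proof (intro ballI allI impI)
    fix g P assume g: "g \<in> polys F (Suc n)" and P: "definable R1 G1 P"
    let ?l = "\<lambda>e. coeff (g e) (Suc n)"
    \<comment> \<open>where the leading coefficient vanishes, \<open>g\<close> coincides with \<open>g0\<close>, which has lower formal degree\<close>
    define g0 where "g0 e = g e - monom (?l e) (Suc n)" for e
    have g0': "g0 \<in> polys F (Suc n)"
      unfolding g0_def by (intro polys_diff g polys_monom polys_coeff[OF g])
    have g0: "g0 \<in> polys F n"
    proof (rule polysI)
      fix e
      have "coeff (g0 e) (Suc n) = 0" by (simp add: g0_def)
      then show "degree (g0 e) \<le> n"
        using polys_degree[OF g0', of e] by (metis degree_0 le_Suc_eq le0 leading_coeff_0_iff)
    qed (rule polys_coeff[OF g0'])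
    have A: "definable R0 G0 (\<lambda>e. \<exists>c. g0 e \<noteq> 0 \<and> poly (g0 e) c = 0 \<and> P (e, c))"
      using Suc.IH g0 P by (simp add: roots_eliminable_def)
    obtain P' where P': "definable (rbase (evals F n) (lift R)) (gbase (evals F n) (lift G)) P'"
      "\<And>e c. ?l e \<noteq> 0 \<Longrightarrow> poly (g e) c = 0 \<Longrightarrow> P (e, c) \<longleftrightarrow> P' (e, c)"
      using definable_mod[OF g P] by blast
    obtain S1 P1 where S1: "finite S1" "S1 \<subseteq> polys F n" and P1: "definable R3 G3 P1"
      "\<And>e c s. s \<noteq> 0 \<Longrightarrow> (\<And>h. h \<in> S1 \<Longrightarrow> pgood n (h e) c (ac s) (v s)) \<Longrightarrow>
        P' (e, c + s) \<longleftrightarrow> P1 (((e, c), ac s), v s)"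
      using center_form[OF P'(1)] by blast
    define g' where "g' e = pderiv (g e)" for e
    have g': "g' \<in> polys F n" using polys_pderiv[OF g] by (simp add: g'_def[abs_def])
    define S where "S = insert g' S1"
    have S: "finite S" "S \<subseteq> polys F n" using S1 g' by (auto simp: S_def)
    obtain D where D: "finite D" "D \<subseteq> polys F n"
      "\<And>e t. \<exists>c. is_center D e c \<and> (t \<noteq> c \<longrightarrow> (\<forall>h\<in>S. pgood n (h e) c (ac (t - c)) (v (t - c))))"
      using ex_centers[OF S] by blast
    define Q where "Q w \<longleftrightarrow> snd (fst w) \<noteq> 0 \<and>
      (\<forall>h\<in>S. pgood n (h (param w)) (cent w) (snd (fst w)) (snd w)) \<and>
      \<not> pgood (Suc n) (g (param w)) (cent w) (snd (fst w)) (snd w) \<and> P1 w" for w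
    define P2 where "P2 e \<longleftrightarrow> poly (g (fst e)) (snd e) = 0 \<and> P' e \<or> (\<exists>\<rho> \<gamma>. Q ((e, \<rho>), \<gamma>))" for e
    have "definable R3 G3 Q"
      unfolding Q_def using S
      by (intro definable_and definable_not definable_eqR R3_snd rfun_const definable_ball
          definable_pgood[OF g] definable_pgood[of _ n] P1(1)) auto
    then have "definable R1 G1 P2"
      unfolding P2_def
      by (intro definable_or definable_and definable_root[OF g] definable_ex_rv
          definable_mono[OF P'(1)] rbase_mono gbase_mono evals_subset)
    then have B: "definable R0 G0 (\<lambda>e. \<exists>c. is_center D e c \<and> P2 (e, c))"
      by (rule definable_ex_center[OF Suc.IH D(1,2)])
    have eq: "(\<exists>c. g e \<noteq> 0 \<and> poly (g e) c = 0 \<and> P (e, c)) \<longleftrightarrow> (\<exists>c. is_center D e c \<and> P2 (e, c))"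
      if l: "?l e \<noteq> 0" for e
    proof
      assume "\<exists>c. g e \<noteq> 0 \<and> poly (g e) c = 0 \<and> P (e, c)"
      then obtain t where t: "g e \<noteq> 0" "poly (g e) t = 0" "P (e, t)" by blast
      then have "P' (e, t)" using P'(2)[OF l] by blast
      obtain c where c: "is_center D e c" "t \<noteq> c \<longrightarrow> (\<forall>h\<in>S. pgood n (h e) c (ac (t - c)) (v (t - c)))"
        using D(3) by blast
      have "P2 (e, c)"
      proof (cases "t = c")
        case True
        then show ?thesis using t \<open>P' (e, t)\<close> by (simp add: P2_def)
      next
        case False
        define s where "s = t - c"
        have s: "s \<noteq> 0" "t = c + s" using False by (simp_all add: s_def)
        have gd: "\<forall>h\<in>S. pgood n (h e) c (ac s) (v s)" using c(2) False by (simp add: s_def)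
        have "\<not> pgood (Suc n) (g e) c (ac s) (v s)"
          using t s polys_degree[OF g] by (intro not_pgood_root) auto
        moreover have "P1 (((e, c), ac s), v s)"
          using P1(2)[OF s(1), of e c] gd \<open>P' (e, t)\<close> s(2) by (simp add: S_def)
        ultimately have "Q (((e, c), ac s), v s)" using gd s by (simp add: Q_def)
        then show ?thesis by (auto simp: P2_def)
      qed
      then show "\<exists>c. is_center D e c \<and> P2 (e, c)" using c(1) by blast
    next
      assume "\<exists>c. is_center D e c \<and> P2 (e, c)"
      then obtain c where c: "P2 (e, c)" by blast
      have ge: "g e \<noteq> 0" using l by auto
      from c consider "poly (g e) c = 0" "P' (e, c)" | \<rho> \<gamma> where "Q (((e, c), \<rho>), \<gamma>)"
        by (auto simp: P2_def)
      then show "\<exists>c. g e \<noteq> 0 \<and> poly (g e) c = 0 \<and> P (e, c)"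
      proof cases
        case 1
        then show ?thesis using ge P'(2)[OF l] by blast
      next
        case 2
        then have q: "\<rho> \<noteq> 0" "\<forall>h\<in>S. pgood n (h e) c \<rho> \<gamma>" "\<not> pgood (Suc n) (g e) c \<rho> \<gamma>"
          "P1 (((e, c), \<rho>), \<gamma>)" by (auto simp: Q_def)
        obtain s where s: "s \<noteq> 0" "ac s = \<rho>" "v s = \<gamma>" using rv_surj[OF q(1)] by blast
        have "pgood n (pderiv (g e)) c (ac s) (v s)" using q(2) s by (simp add: S_def g'_def)
        moreover have "degree (pderiv (g e)) \<le> n" using polys_degree[OF g'] by (simp add: g'_def)
        ultimately obtain s' where s': "s' \<noteq> 0" "ac s' = ac s" "v s' = v s" "poly (g e) (c + s') = 0"
          using ex_root_if_not_pgood[of "g e" "Suc n" n s c] polys_degree[OF g] s q(3) by blast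
        have "P' (e, c + s')"
          using P1(2)[OF s'(1), of e c] q(2,4) s s' by (simp add: S_def)
        then show ?thesis using ge s'(4) P'(2)[OF l s'(4)] by blast
      qed
    qed
    have "definable R0 G0 (\<lambda>e. ?l e = 0 \<and> (\<exists>c. g0 e \<noteq> 0 \<and> poly (g0 e) c = 0 \<and> P (e, c)) \<or>
        ?l e \<noteq> 0 \<and> (\<exists>c. is_center D e c \<and> P2 (e, c)))"
      by (intro definable_or definable_and definable_not A B definable_coeff_eq_0[OF g])
    moreover have "g0 e = g e" if "?l e = 0" for e using that by (simp add: g0_def)
    then have "(?l e = 0 \<and> (\<exists>c. g0 e \<noteq> 0 \<and> poly (g0 e) c = 0 \<and> P (e, c)) \<or>
        ?l e \<noteq> 0 \<and> (\<exists>c. is_center D e c \<and> P2 (e, c))) \<longleftrightarrow>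
        (\<exists>c. g e \<noteq> 0 \<and> poly (g e) c = 0 \<and> P (e, c))" for e
      using eq[of e] by (cases "?l e = 0") auto
    ultimately show "definable R0 G0 (\<lambda>e. \<exists>c. g e \<noteq> 0 \<and> poly (g e) c = 0 \<and> P (e, c))" by simp
  qed
qed

lemma definable_bounded_degree:
  assumes "definable R1 G1 P"
  obtains n where "definable (rbase (evals F n) (lift R)) (gbase (evals F n) (lift G)) P"
proof -
  obtain A B where AB: "finite A" "A \<subseteq> R1" "finite B" "B \<subseteq> G1" "definable A B P"
    using assms by (rule definable_finite)
  let ?R = "\<lambda>n. rbase (evals F n) (lift R)" and ?G = "\<lambda>n. gbase (evals F n) (lift G)"
  have "\<exists>n. f \<in> ?R n" if "f \<in> A" for f using that AB(2) rbase_all_evals by blast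
  then obtain a where a: "\<And>f. f \<in> A \<Longrightarrow> f \<in> ?R (a f)" by metis
  have "\<exists>n. f \<in> ?G n" if "f \<in> B" for f using that AB(4) gbase_all_evals by blast
  then obtain b where b: "\<And>f. f \<in> B \<Longrightarrow> f \<in> ?G (b f)" by metis
  define n where "n = Max (insert 0 (a ` A \<union> b ` B))"
  have "A \<subseteq> ?R n"
  proof
    fix f assume f: "f \<in> A"
    then have "a f \<le> n" unfolding n_def using AB(1,3) by (intro Max_ge) auto
    then show "f \<in> ?R n" using a[OF f] rbase_mono[OF evals_mono] by blast
  qed
  moreover have "B \<subseteq> ?G n"
  proof
    fix f assume f: "f \<in> B"
    then have "b f \<le> n" unfolding n_def using AB(1,3) by (intro Max_ge) auto
    then show "f \<in> ?G n" using b[OF f] gbase_mono[OF evals_mono] by blast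
  qed
  ultimately show ?thesis using definable_mono[OF AB(5)] that by blast
qed

text \<open>The same description by centres, now for an arbitrary field element \<open>t\<close>; the centres are roots, and
  \<open>roots_eliminable\<close> applies to them.\<close>

theorem definable_ex_field:
  assumes P: "definable R1 G1 P"
  shows "definable R0 G0 (\<lambda>e. \<exists>t. P (e, t))"
proof -
  obtain n where n: "definable (rbase (evals F n) (lift R)) (gbase (evals F n) (lift G)) P"
    using definable_bounded_degree[OF P] by blast
  obtain S P1 where S: "finite S" "S \<subseteq> polys F n" and P1: "definable R3 G3 P1"
    "\<And>e c s. s \<noteq> 0 \<Longrightarrow> (\<And>h. h \<in> S \<Longrightarrow> pgood n (h e) c (ac s) (v s)) \<Longrightarrow>
      P (e, c + s) \<longleftrightarrow> P1 (((e, c), ac s), v s)"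
    using center_form[OF n] by blast
  obtain D where D: "finite D" "D \<subseteq> polys F n"
    "\<And>e t. \<exists>c. is_center D e c \<and> (t \<noteq> c \<longrightarrow> (\<forall>h\<in>S. pgood n (h e) c (ac (t - c)) (v (t - c))))"
    using ex_centers[OF S] by blast
  define Q where "Q w \<longleftrightarrow> snd (fst w) \<noteq> 0 \<and>
    (\<forall>h\<in>S. pgood n (h (param w)) (cent w) (snd (fst w)) (snd w)) \<and> P1 w" for w
  define P2 where "P2 e \<longleftrightarrow> P e \<or> (\<exists>\<rho> \<gamma>. Q ((e, \<rho>), \<gamma>))" for e
  have "definable R3 G3 Q"
    unfolding Q_def using S
    by (intro definable_and definable_not definable_eqR R3_snd rfun_const definable_ball
        definable_pgood[of _ n] P1(1)) auto
  then have "definable R1 G1 P2"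
    unfolding P2_def by (intro definable_or definable_ex_rv P)
  then have "definable R0 G0 (\<lambda>e. \<exists>c. is_center D e c \<and> P2 (e, c))"
    by (rule definable_ex_center[OF roots_eliminable D(1,2)])
  moreover have "(\<exists>c. is_center D e c \<and> P2 (e, c)) \<longleftrightarrow> (\<exists>t. P (e, t))" for e
  proof
    assume "\<exists>t. P (e, t)"
    then obtain t where t: "P (e, t)" by blast
    obtain c where c: "is_center D e c" "t \<noteq> c \<longrightarrow> (\<forall>h\<in>S. pgood n (h e) c (ac (t - c)) (v (t - c)))"
      using D(3) by blast
    have "P2 (e, c)"
    proof (cases "t = c")
      case False
      define s where "s = t - c"
      have s: "s \<noteq> 0" "t = c + s" using False by (simp_all add: s_def)
      have gd: "\<forall>h\<in>S. pgood n (h e) c (ac s) (v s)" using c(2) False by (simp add: s_def)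
      moreover have "P1 (((e, c), ac s), v s)" using P1(2)[OF s(1), of e c] gd t s(2) by simp
      ultimately have "Q (((e, c), ac s), v s)" using s by (simp add: Q_def)
      then show ?thesis by (auto simp: P2_def)
    qed (use t in \<open>simp add: P2_def\<close>)
    then show "\<exists>c. is_center D e c \<and> P2 (e, c)" using c(1) by blast
  next
    assume "\<exists>c. is_center D e c \<and> P2 (e, c)"
    then obtain c where "P2 (e, c)" by blast
    then consider "P (e, c)" | \<rho> \<gamma> where "Q (((e, c), \<rho>), \<gamma>)" by (auto simp: P2_def)
    then show "\<exists>t. P (e, t)"
    proof cases
      case 2
      then have q: "\<rho> \<noteq> 0" "\<forall>h\<in>S. pgood n (h e) c \<rho> \<gamma>" "P1 (((e, c), \<rho>), \<gamma>)"
        by (auto simp: Q_def)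
      obtain s where s: "s \<noteq> 0" "ac s = \<rho>" "v s = \<gamma>" using rv_surj[OF q(1)] by blast
      then have "P (e, c + s)" using P1(2)[OF s(1), of e c] q by simp
      then show ?thesis by blast
    qed blast
  qed
  ultimately show ?thesis by simp
qed

end

end

end


section \<open>Free variables of special formulas\<close>

lemma ac_subst_cases:
  "length qs = length us \<Longrightarrow>
    ac_subst us qs i = RVar i \<and> i \<notin> set us \<or> (\<exists>q\<in>set qs. ac_subst us qs i = Ac q)"
  unfolding ac_subst_def
  by (auto split: option.split dest: map_of_SomeD set_zip_rightD simp: map_of_zip_is_None)

lemma val_subst_cases:
  "length qs = length us \<Longrightarrow>
    val_subst us qs i = VVar i \<and> i \<notin> set us \<or> (\<exists>q\<in>set qs. val_subst us qs i = Val q)"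
  unfolding val_subst_def
  by (auto split: option.split dest: map_of_SomeD set_zip_rightD simp: map_of_zip_is_None)

lemma fm_subst_r_syntax:
  assumes "pure_rfm \<psi>" "\<forall>i. \<sigma> i = RVar i \<or> (\<exists>q. \<sigma> i = Ac q)"
  shows "field_quantifier_free (fm_subst_r \<sigma> \<psi>) \<and> freeV (fm_subst_r \<sigma> \<psi>) = {} \<and>
    freeF (fm_subst_r \<sigma> \<psi>) \<subseteq> (\<Union>i\<in>freeR \<psi>. fvars_r (\<sigma> i)) \<and>
    freeR (fm_subst_r \<sigma> \<psi>) \<subseteq> (\<Union>i\<in>freeR \<psi>. rvars (\<sigma> i))"
    (is "?Q \<sigma> \<psi>")
  using assms
proof (induction \<psi> arbitrary: \<sigma>)
  case (ExR i \<psi>)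
  let ?\<sigma> = "\<sigma>(i := RVar i)"
  have "\<forall>j. ?\<sigma> j = RVar j \<or> (\<exists>q. ?\<sigma> j = Ac q)" using ExR.prems(2) by simp
  moreover have "pure_rfm \<psi>" using ExR.prems(1) by simp
  ultimately have IH: "?Q ?\<sigma> \<psi>" by (intro ExR.IH)
  have "(\<Union>j\<in>freeR \<psi>. fvars_r (?\<sigma> j)) \<subseteq> (\<Union>j\<in>freeR \<psi> - {i}. fvars_r (\<sigma> j))"
    "(\<Union>j\<in>freeR \<psi>. rvars (?\<sigma> j)) - {i} \<subseteq> (\<Union>j\<in>freeR \<psi> - {i}. rvars (\<sigma> j))"
    by (auto split: if_splits)
  with IH show ?case
    unfolding fm_subst_r.simps freeF.simps freeR.simps freeV.simps field_quantifier_free.simps by blast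
next
  case (And \<phi>1 \<phi>2)
  then show ?case
    using And.IH(1)[OF _ And.prems(2)] And.IH(2)[OF _ And.prems(2)]
    by (simp add: UN_Un le_supI1 le_supI2)
next
  case (Or \<phi>1 \<phi>2)
  then show ?case
    using Or.IH(1)[OF _ Or.prems(2)] Or.IH(2)[OF _ Or.prems(2)]
    by (simp add: UN_Un le_supI1 le_supI2)
qed (simp_all add: rterm_subst_syntax UN_Un)

lemma fm_subst_v_syntax:
  assumes "pure_vfm \<theta>" "\<forall>i. \<sigma> i = VVar i \<or> (\<exists>q. \<sigma> i = Val q)"
  shows "field_quantifier_free (fm_subst_v \<sigma> \<theta>) \<and> freeR (fm_subst_v \<sigma> \<theta>) = {} \<and>
    freeF (fm_subst_v \<sigma> \<theta>) \<subseteq> (\<Union>i\<in>freeV \<theta>. fvars_v (\<sigma> i)) \<and>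
    freeV (fm_subst_v \<sigma> \<theta>) \<subseteq> (\<Union>i\<in>freeV \<theta>. vvars (\<sigma> i))"
    (is "?Q \<sigma> \<theta>")
  using assms
proof (induction \<theta> arbitrary: \<sigma>)
  case (ExV i \<theta>)
  let ?\<sigma> = "\<sigma>(i := VVar i)"
  have "\<forall>j. ?\<sigma> j = VVar j \<or> (\<exists>q. ?\<sigma> j = Val q)" using ExV.prems(2) by simp
  moreover have "pure_vfm \<theta>" using ExV.prems(1) by simp
  ultimately have IH: "?Q ?\<sigma> \<theta>" by (intro ExV.IH)
  have "(\<Union>j\<in>freeV \<theta>. fvars_v (?\<sigma> j)) \<subseteq> (\<Union>j\<in>freeV \<theta> - {i}. fvars_v (\<sigma> j))"
    "(\<Union>j\<in>freeV \<theta>. vvars (?\<sigma> j)) - {i} \<subseteq> (\<Union>j\<in>freeV \<theta> - {i}. vvars (\<sigma> j))"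
    by (auto split: if_splits)
  with IH show ?case
    unfolding fm_subst_v.simps freeF.simps freeR.simps freeV.simps field_quantifier_free.simps by blast
next
  case (And \<phi>1 \<phi>2)
  then show ?case
    using And.IH(1)[OF _ And.prems(2)] And.IH(2)[OF _ And.prems(2)]
    by (simp add: UN_Un le_supI1 le_supI2)
next
  case (Or \<phi>1 \<phi>2)
  then show ?case
    using Or.IH(1)[OF _ Or.prems(2)] Or.IH(2)[OF _ Or.prems(2)]
    by (simp add: UN_Un le_supI1 le_supI2)
qed (simp_all add: vterm_subst_syntax UN_Un)

lemma special_rfm_syntax:
  assumes "special_rfm xs ys \<psi>"
  shows "field_quantifier_free \<psi>" "freeF \<psi> \<subseteq> set xs" "freeR \<psi> \<subseteq> set ys" "freeV \<psi> = {}"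
proof -
  obtain \<psi>' us qs where s: "pure_rfm \<psi>'" "length qs = length us" "freeR \<psi>' \<subseteq> set us \<union> set ys"
    "\<forall>q\<in>set qs. fvars q \<subseteq> set xs" "\<psi> = fm_subst_r (ac_subst us qs) \<psi>'"
    using assms unfolding special_rfm_def by blast
  note C = ac_subst_cases[OF s(2)]
  have "\<forall>i. ac_subst us qs i = RVar i \<or> (\<exists>q. ac_subst us qs i = Ac q)" using C by blast
  note S = fm_subst_r_syntax[OF s(1) this, folded s(5)]
  show "field_quantifier_free \<psi>" "freeV \<psi> = {}" using S by blast+
  have "fvars_r (ac_subst us qs i) \<subseteq> set xs" for i
    using C[of i] s(4) by (elim disjE bexE conjE) simp_all
  then show "freeF \<psi> \<subseteq> set xs" using S by blast
  have "rvars (ac_subst us qs i) \<subseteq> set ys" if "i \<in> freeR \<psi>'" for i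
    using C[of i] subsetD[OF s(3) that] by (elim disjE bexE conjE) simp_all
  then show "freeR \<psi> \<subseteq> set ys" using S by blast
qed

lemma special_vfm_syntax:
  assumes "special_vfm xs zs \<theta>"
  shows "field_quantifier_free \<theta>" "freeF \<theta> \<subseteq> set xs" "freeV \<theta> \<subseteq> set zs" "freeR \<theta> = {}"
proof -
  obtain \<theta>' us qs where s: "pure_vfm \<theta>'" "length qs = length us" "freeV \<theta>' \<subseteq> set us \<union> set zs"
    "\<forall>q\<in>set qs. fvars q \<subseteq> set xs" "\<theta> = fm_subst_v (val_subst us qs) \<theta>'"
    using assms unfolding special_vfm_def by blast
  note C = val_subst_cases[OF s(2)]
  have "\<forall>i. val_subst us qs i = VVar i \<or> (\<exists>q. val_subst us qs i = Val q)" using C by blast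
  note S = fm_subst_v_syntax[OF s(1) this, folded s(5)]
  show "field_quantifier_free \<theta>" "freeR \<theta> = {}" using S by blast+
  have "fvars_v (val_subst us qs i) \<subseteq> set xs" for i
    using C[of i] s(4) by (elim disjE bexE conjE) simp_all
  then show "freeF \<theta> \<subseteq> set xs" using S by blast
  have "vvars (val_subst us qs i) \<subseteq> set zs" if "i \<in> freeV \<theta>'" for i
    using C[of i] subsetD[OF s(3) that] by (elim disjE bexE conjE) simp_all
  then show "freeV \<theta> \<subseteq> set zs" using S by blast
qed

lemma Disj_syntax:
  "(\<forall>\<phi>\<in>set \<phi>s. field_quantifier_free \<phi>) \<Longrightarrow> field_quantifier_free (Disj \<phi>s)"
  "freeF (Disj \<phi>s) = (\<Union>\<phi>\<in>set \<phi>s. freeF \<phi>)"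
  "freeR (Disj \<phi>s) = (\<Union>\<phi>\<in>set \<phi>s. freeR \<phi>)"
  "freeV (Disj \<phi>s) = (\<Union>\<phi>\<in>set \<phi>s. freeV \<phi>)"
  unfolding Disj_def by (induction \<phi>s) auto

lemma free_foldr_All:
  "freeF (foldr AllF xs \<phi>) = freeF \<phi> - set xs"
  "freeR (foldr AllF xs \<phi>) = freeR \<phi>"
  "freeV (foldr AllF xs \<phi>) = freeV \<phi>"
  "freeF (foldr AllR xs \<phi>) = freeF \<phi>"
  "freeR (foldr AllR xs \<phi>) = freeR \<phi> - set xs"
  "freeV (foldr AllR xs \<phi>) = freeV \<phi>"
  "freeF (foldr AllV xs \<phi>) = freeF \<phi>"
  "freeR (foldr AllV xs \<phi>) = freeR \<phi>"
  "freeV (foldr AllV xs \<phi>) = freeV \<phi> - set xs"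
  by (induction xs) (auto simp: AllF_def AllR_def AllV_def)

lemma sat_foldr_All:
  assumes "\<And>x y z. sat K x y z \<phi>"
  shows "sat K x y z (foldr AllF xs \<phi>)" "sat K x y z (foldr AllR xs \<phi>)" "sat K x y z (foldr AllV xs \<phi>)"
  using assms by (induction xs arbitrary: x y z) (auto simp: AllF_def AllR_def AllV_def)

locale henselian_ovf_ac_structure = henselian_ovf_ac v res ac K
  for v :: "'k::linordered_field \<Rightarrow> 'g::linordered_ab_group_add"
    and res ac :: "'k \<Rightarrow> 'r::linordered_field" and K :: "('k, 'r, 'g) ovf_ac" +
  assumes compatible: "compatible_ac ac"
    and K: "K = ovf_ac_structure v res ac"
begin

lemma ang_K [simp]: "ang K = ac" and val_K [simp]: "val K = val0"
  by (auto simp: K ovf_ac_structure_def val0_def)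

lemma residue_K: "residue K a = (if val0 a = 0 then ac a else 0)"
proof (cases "vle 1 a")
  case True
  then have "residue K a = res a" by (simp add: K ovf_ac_structure_def val_ring_iff)
  moreover have "res a = (if val0 a = 0 then ac a else 0)"
  proof (cases "a = 0")
    case False
    then have "vle a 1 \<longleftrightarrow> v a = 0" using True by (auto simp: vle_def)
    then show ?thesis using False True ac_unit[of a] res_eq_0[of a] by (auto simp: val0_def)
  qed simp
  ultimately show ?thesis by simp
next
  case False
  then have "a \<noteq> 0" "v a \<noteq> 0" by (auto simp: vle_def)
  then show ?thesis using False by (simp add: K ovf_ac_structure_def val_ring_iff val0_def)
qed

lemma less_iff_ac: "a < b \<longleftrightarrow> 0 < ac (b + - a)"
proof -
  have "a < b \<longleftrightarrow> 0 < b + - a" by simp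
  then show ?thesis using compatible by (simp only: compatible_ac_def)
qed

section \<open>Definability of satisfaction\<close>

type_synonym ('a, 'b, 'c) env = "(nat \<Rightarrow> 'a) \<times> (nat \<Rightarrow> 'b) \<times> (nat \<Rightarrow> 'c)"

definition field_funs :: "nat set \<Rightarrow> (('k, 'r, 'g) env \<Rightarrow> 'k) set" where
  "field_funs X = (\<lambda>q e. eval_f (fst e) q) ` {q. fvars q \<subseteq> X}"

definition residue_vars :: "nat set \<Rightarrow> (('k, 'r, 'g) env \<Rightarrow> 'r) set" where
  "residue_vars Y = (\<lambda>i e. fst (snd e) i) ` Y"

definition value_vars :: "nat set \<Rightarrow> (('k, 'r, 'g) env \<Rightarrow> 'g) set" where
  "value_vars Z = (\<lambda>i e. snd (snd e) i) ` Z"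

abbreviation "rbase_on X Y \<equiv> rbase (field_funs X) (residue_vars Y)"
abbreviation "gbase_on X Z \<equiv> gbase (field_funs X) (value_vars Z)"

lemma field_funsI: "fvars q \<subseteq> X \<Longrightarrow> (\<lambda>e. eval_f (fst e) q) \<in> field_funs X"
  by (auto simp: field_funs_def)

lemma field_funsE: "f \<in> field_funs X \<Longrightarrow> (\<And>q. fvars q \<subseteq> X \<Longrightarrow> f = (\<lambda>e. eval_f (fst e) q) \<Longrightarrow> thesis) \<Longrightarrow> thesis"
  by (auto simp: field_funs_def)

lemma fun_ring_field_funs: "fun_ring (field_funs X)"
  unfolding fun_ring_def
proof (intro conjI ballI)
  show "(\<lambda>e. 0) \<in> field_funs X" using field_funsI[of FZero X] by simp
  show "(\<lambda>e. 1) \<in> field_funs X" using field_funsI[of FOne X] by simp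
  fix f assume "f \<in> field_funs X"
  then obtain q where q: "fvars q \<subseteq> X" "f = (\<lambda>e. eval_f (fst e) q)" by (rule field_funsE)
  then show "(\<lambda>e. - f e) \<in> field_funs X" using field_funsI[of "FMinus q" X] by simp
  fix g assume "g \<in> field_funs X"
  then obtain r where r: "fvars r \<subseteq> X" "g = (\<lambda>e. eval_f (fst e) r)" by (rule field_funsE)
  show "(\<lambda>e. f e + g e) \<in> field_funs X" "(\<lambda>e. f e * g e) \<in> field_funs X"
    using q r field_funsI[of "FAdd q r" X] field_funsI[of "FMul q r" X] by simp_all
qed

lemma rfun_ac_eval: "fvars q \<subseteq> X \<Longrightarrow> rfun (rbase_on X Y) G (\<lambda>e. ac (eval_f (fst e) q))"
  by (intro rfun_base rbaseI field_funsI)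

lemma gfun_val_eval: "fvars q \<subseteq> X \<Longrightarrow> gfun R (gbase_on X Z) (\<lambda>e. val0 (eval_f (fst e) q))"
  by (intro gfun_base gbaseI field_funsI)

lemma rfun_eval_r:
  "fvars_r t \<subseteq> X \<Longrightarrow> rvars t \<subseteq> Y \<Longrightarrow> rfun (rbase_on X Y) (gbase_on X Z) (\<lambda>e. eval_r K (fst e) (fst (snd e)) t)"
proof (induction t)
  case (RVar i)
  then show ?case by (intro rfun_base) (auto simp: rbase_def residue_vars_def)
next
  case (Res t)
  then show ?case unfolding eval_r.simps residue_K
    by (intro rfun_if definable_eqV gfun_const rfun_const rfun_ac_eval gfun_val_eval) simp_all
qed (simp_all add: rfun_const rfun_add rfun_minus rfun_mult rfun_ac_eval)

lemma gfun_eval_v: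
  "fvars_v t \<subseteq> X \<Longrightarrow> vvars t \<subseteq> Z \<Longrightarrow> gfun (rbase_on X Y) (gbase_on X Z) (\<lambda>e. eval_v K (fst e) (snd (snd e)) t)"
proof (induction t)
  case (VVar i)
  then show ?case by (intro gfun_base) (auto simp: gbase_def value_vars_def)
qed (simp_all add: gfun_const gfun_add gfun_minus gfun_val_eval)

lemma eval_f_upd_poly:
  "fvars q \<subseteq> insert i X \<Longrightarrow> \<exists>n. \<exists>h\<in>polys (field_funs X) n. \<forall>e t. eval_f ((fst e)(i := t)) q = poly (h e) t"
proof (induction q)
  case (FVar j)
  note R = fun_ring_field_funs[of X]
  show ?case
  proof (cases "j = i")
    case True
    have "(\<lambda>e. monom 1 1) \<in> polys (field_funs X) 1" by (rule polys_monom[OF R F_1[OF R]])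
    then show ?thesis using True by (intro exI[of _ 1] bexI[of _ "\<lambda>e. monom 1 1"]) (simp_all add: poly_monom)
  next
    case False
    then have "(\<lambda>e. [:eval_f (fst e) (FVar j):]) \<in> polys (field_funs X) 0"
      using FVar by (intro polys_const[OF R] field_funsI) auto
    then show ?thesis using False by (intro exI bexI[of _ "\<lambda>e. [:eval_f (fst e) (FVar j):]"]) simp_all
  qed
next
  case FZero
  note R = fun_ring_field_funs[of X]
  show ?case by (intro exI[of _ 0] bexI[OF _ polys_const[OF R F_0[OF R]]]) simp
next
  case FOne
  note R = fun_ring_field_funs[of X]
  show ?case by (intro exI[of _ 0] bexI[OF _ polys_const[OF R F_1[OF R]]]) simp
next
  case (FAdd q r)
  then have sub: "fvars q \<subseteq> insert i X" "fvars r \<subseteq> insert i X" by auto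
  note R = fun_ring_field_funs[of X]
  obtain n h where h: "h \<in> polys (field_funs X) n" "\<And>e t. eval_f ((fst e)(i := t)) q = poly (h e) t"
    using FAdd.IH(1)[OF sub(1)] by blast
  obtain m h' where h': "h' \<in> polys (field_funs X) m" "\<And>e t. eval_f ((fst e)(i := t)) r = poly (h' e) t"
    using FAdd.IH(2)[OF sub(2)] by blast
  have hm: "h \<in> polys (field_funs X) (max n m)" "h' \<in> polys (field_funs X) (max n m)"
    using h(1) h'(1) polys_mono[of n "max n m" "field_funs X"] polys_mono[of m "max n m" "field_funs X"] by auto
  have "eval_f ((fst e)(i := t)) (FAdd q r) = poly (h e + h' e) t" for e :: "('k, 'r, 'g) env" and t
    using h(2)[of e t] h'(2)[of e t] by simp
  then show ?case using polys_add[OF R hm]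
    by (intro exI[of _ "max n m"] bexI[of _ "\<lambda>e. h e + h' e"] allI)
next
  case (FMinus q)
  note R = fun_ring_field_funs[of X]
  obtain n h where h: "h \<in> polys (field_funs X) n" "\<And>e t. eval_f ((fst e)(i := t)) q = poly (h e) t"
    using FMinus.IH FMinus.prems unfolding fvars.simps by blast
  have "eval_f ((fst e)(i := t)) (FMinus q) = poly ([:0:] - h e) t" for e :: "('k, 'r, 'g) env" and t
    using h(2)[of e t] by simp
  then show ?case using polys_diff[OF R polys_const[OF R F_0[OF R]] h(1)]
    by (intro exI[of _ "n"] bexI[of _ "\<lambda>e. [:0:] - h e"] allI)
next
  case (FMul q r)
  then have sub: "fvars q \<subseteq> insert i X" "fvars r \<subseteq> insert i X" by auto
  note R = fun_ring_field_funs[of X]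
  obtain n h where h: "h \<in> polys (field_funs X) n" "\<And>e t. eval_f ((fst e)(i := t)) q = poly (h e) t"
    using FMul.IH(1)[OF sub(1)] by blast
  obtain m h' where h': "h' \<in> polys (field_funs X) m" "\<And>e t. eval_f ((fst e)(i := t)) r = poly (h' e) t"
    using FMul.IH(2)[OF sub(2)] by blast
  have "eval_f ((fst e)(i := t)) (FMul q r) = poly (h e * h' e) t" for e :: "('k, 'r, 'g) env" and t
    using h(2)[of e t] h'(2)[of e t] by simp
  then show ?case using polys_mult[OF R h(1) h'(1)]
    by (intro exI[of _ "n + m"] bexI[of _ "\<lambda>e. h e * h' e"] allI)
qed

lemma eval_f_upd_evals:
  assumes "f \<in> field_funs (insert i X)"
  shows "(\<lambda>w. f ((fst (fst w))(i := snd w), snd (fst w))) \<in> all_evals (field_funs X)"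
proof -
  obtain q where q: "fvars q \<subseteq> insert i X" "f = (\<lambda>e. eval_f (fst e) q)" using assms by (rule field_funsE)
  obtain n h where h: "h \<in> polys (field_funs X) n"
    "\<And>(e :: ('k, 'r, 'g) env) t. eval_f ((fst e)(i := t)) q = poly (h e) t"
    using eval_f_upd_poly[OF q(1)] by blast
  show ?thesis using all_evalsI[OF fun_ring_field_funs h(1)] by (simp add: q(2) h(2))
qed

text \<open>The step for the field quantifier is \<open>definable_ex_field\<close>, where the quantified variable becomes the
  last component of the parameters.\<close>

lemma definable_sat:
  "freeF \<phi> \<subseteq> X \<Longrightarrow> freeR \<phi> \<subseteq> Y \<Longrightarrow> freeV \<phi> \<subseteq> Z \<Longrightarrow>
    definable (rbase_on X Y) (gbase_on X Z) (\<lambda>e. sat K (fst e) (fst (snd e)) (snd (snd e)) \<phi>)"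
proof (induction \<phi> arbitrary: X Y Z)
  case Falsum
  then show ?case by simp
next
  case (EqF s t)
  then have "definable (rbase_on X Y) (gbase_on X Z) (\<lambda>e. ac (eval_f (fst e) (FAdd s (FMinus t))) = 0)"
    by (intro definable_eqR rfun_const rfun_ac_eval) auto
  then show ?case by simp
next
  case (LessF s t)
  then have "definable (rbase_on X Y) (gbase_on X Z) (\<lambda>e. 0 < ac (eval_f (fst e) (FAdd t (FMinus s))))"
    by (intro definable_lessR rfun_const rfun_ac_eval) auto
  then show ?case by (simp add: less_iff_ac)
next
  case (EqR s t)
  then show ?case by (auto intro!: definable_eqR rfun_eval_r)
next
  case (LessR s t)
  then show ?case by (auto intro!: definable_lessR rfun_eval_r)
next
  case (EqV s t)
  then show ?case by (auto intro!: definable_eqV gfun_eval_v)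
next
  case (LessV s t)
  then show ?case by (auto intro!: definable_lessV gfun_eval_v)
next
  case (Neg \<phi>)
  then show ?case by (auto intro!: definable_not)
next
  case (And \<phi> \<psi>)
  then show ?case by (auto intro!: definable_and)
next
  case (Or \<phi> \<psi>)
  then show ?case by (auto intro!: definable_or)
next
  case (ExF i \<phi>)
  then have IH: "definable (rbase_on (insert i X) Y) (gbase_on (insert i X) Z)
      (\<lambda>e. sat K (fst e) (fst (snd e)) (snd (snd e)) \<phi>)"
    by (intro ExF.IH) auto
  let ?h = "\<lambda>w. ((fst (fst w))(i := snd w), snd (fst w))"
  have "definable (rbase (all_evals (field_funs X)) (lift (residue_vars Y))) (gbase (all_evals (field_funs X)) (lift (value_vars Z)))
      (\<lambda>w. sat K (fst (?h w)) (fst (snd (?h w))) (snd (snd (?h w))) \<phi>)"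
  proof (rule definable_comp[OF IH, of ?h])
    fix f assume "f \<in> rbase_on (insert i X) Y"
    then show "f \<circ> ?h \<in> rbase (all_evals (field_funs X)) (lift (residue_vars Y))"
      unfolding rbase_def residue_vars_def using eval_f_upd_evals[of _ i X] by (auto simp: comp_def image_iff)
  next
    fix f assume "f \<in> gbase_on (insert i X) Z"
    then show "f \<circ> ?h \<in> gbase (all_evals (field_funs X)) (lift (value_vars Z))"
      unfolding gbase_def value_vars_def using eval_f_upd_evals[of _ i X] by (auto simp: comp_def image_iff)
  qed
  from definable_ex_field[OF fun_ring_field_funs this] show ?case by simp
next
  case (ExR i \<phi>)
  then have IH: "definable (rbase_on X (insert i Y)) (gbase_on X Z)
      (\<lambda>e. sat K (fst e) (fst (snd e)) (snd (snd e)) \<phi>)"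
    by (intro ExR.IH) auto
  let ?h = "\<lambda>w. (fst (fst w), (fst (snd (fst w)))(i := snd w), snd (snd (fst w)))"
  have "definable (insert snd (lift (rbase_on X Y))) (lift (gbase_on X Z))
      (\<lambda>w. sat K (fst (?h w)) (fst (snd (?h w))) (snd (snd (?h w))) \<phi>)"
  proof (rule definable_comp[OF IH, of ?h])
    fix f assume "f \<in> rbase_on X (insert i Y)"
    then consider j where "j \<in> Y" "j \<noteq> i" "f = (\<lambda>e. fst (snd e) j)" | "f = (\<lambda>e. fst (snd e) i)"
      | q where "fvars q \<subseteq> X" "f = (\<lambda>e. ac (eval_f (fst e) q))"
      unfolding rbase_def residue_vars_def field_funs_def by blast
    then show "f \<circ> ?h \<in> insert snd (lift (rbase_on X Y))"
    proof cases
      case (1 j)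
      then have "f \<in> rbase_on X Y" by (auto simp: rbase_def residue_vars_def)
      moreover have "f \<circ> ?h = f \<circ> fst" using 1 by (simp add: comp_def)
      ultimately show ?thesis by simp
    next
      case 2
      then show ?thesis by (simp add: comp_def)
    next
      case (3 q)
      then have "f \<in> rbase_on X Y" by (auto simp: rbase_def field_funs_def)
      moreover have "f \<circ> ?h = f \<circ> fst" using 3 by (simp add: comp_def)
      ultimately show ?thesis by simp
    qed
  next
    fix f assume f: "f \<in> gbase_on X Z"
    moreover have "f \<circ> ?h = f \<circ> fst" using f by (auto simp: gbase_def value_vars_def field_funs_def comp_def)
    ultimately show "f \<circ> ?h \<in> lift (gbase_on X Z)" by simp
  qed
  from definable_exR[OF this] show ?case by simp
next
  case (ExV i \<phi>)
  then have IH: "definable (rbase_on X Y) (gbase_on X (insert i Z))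
      (\<lambda>e. sat K (fst e) (fst (snd e)) (snd (snd e)) \<phi>)"
    by (intro ExV.IH) auto
  let ?h = "\<lambda>w. (fst (fst w), fst (snd (fst w)), (snd (snd (fst w)))(i := snd w))"
  have "definable (lift (rbase_on X Y)) (insert snd (lift (gbase_on X Z)))
      (\<lambda>w. sat K (fst (?h w)) (fst (snd (?h w))) (snd (snd (?h w))) \<phi>)"
  proof (rule definable_comp[OF IH, of ?h])
    fix f assume "f \<in> gbase_on X (insert i Z)"
    then consider j where "j \<in> Z" "j \<noteq> i" "f = (\<lambda>e. snd (snd e) j)" | "f = (\<lambda>e. snd (snd e) i)"
      | q where "fvars q \<subseteq> X" "f = (\<lambda>e. val0 (eval_f (fst e) q))"
      unfolding gbase_def value_vars_def field_funs_def by blast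
    then show "f \<circ> ?h \<in> insert snd (lift (gbase_on X Z))"
    proof cases
      case (1 j)
      then have "f \<in> gbase_on X Z" by (auto simp: gbase_def value_vars_def)
      moreover have "f \<circ> ?h = f \<circ> fst" using 1 by (simp add: comp_def)
      ultimately show ?thesis by simp
    next
      case 2
      then show ?thesis by (simp add: comp_def)
    next
      case (3 q)
      then have "f \<in> gbase_on X Z" by (auto simp: gbase_def field_funs_def)
      moreover have "f \<circ> ?h = f \<circ> fst" using 3 by (simp add: comp_def)
      ultimately show ?thesis by simp
    qed
  next
    fix f assume f: "f \<in> rbase_on X Y"
    moreover have "f \<circ> ?h = f \<circ> fst" using f by (auto simp: rbase_def residue_vars_def field_funs_def comp_def)
    ultimately show "f \<circ> ?h \<in> lift (rbase_on X Y)" by simp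
  qed
  from definable_exV[OF this] show ?case by simp
qed

section \<open>Separation of residue field and value group\<close>

lemma pure_rfm_pure_fm: "pure_rfm \<psi> \<Longrightarrow> pure_fm \<psi> \<and> freeV \<psi> = {}"
  by (induction \<psi>) auto

lemma pure_vfm_pure_fm: "pure_vfm \<psi> \<Longrightarrow> pure_fm \<psi> \<and> freeR \<psi> = {}"
  by (induction \<psi>) auto

lemma psat_pure_rfm: "pure_rfm \<psi> \<Longrightarrow> psat y z \<psi> \<longleftrightarrow> psat y z' \<psi>"
  using pure_rfm_pure_fm by (intro sat_cong) auto

lemma psat_pure_vfm: "pure_vfm \<theta> \<Longrightarrow> psat y z \<theta> \<longleftrightarrow> psat y' z \<theta>"
  using pure_vfm_pure_fm by (intro sat_cong) auto

definition sep_pair :: "nat set \<Rightarrow> nat set \<Rightarrow> fm \<times> fm \<Rightarrow> bool" where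
  "sep_pair A B p \<longleftrightarrow> pure_rfm (fst p) \<and> freeR (fst p) \<subseteq> A \<and> pure_vfm (snd p) \<and> freeV (snd p) \<subseteq> B"

definition sat_pair :: "(nat \<Rightarrow> 'r) \<Rightarrow> (nat \<Rightarrow> 'g) \<Rightarrow> fm \<times> fm \<Rightarrow> bool" where
  "sat_pair y z p \<longleftrightarrow> psat y z (fst p) \<and> psat y z (snd p)"

definition separated :: "nat set \<Rightarrow> nat set \<Rightarrow> ((nat \<Rightarrow> 'r) \<Rightarrow> (nat \<Rightarrow> 'g) \<Rightarrow> bool) \<Rightarrow> bool" where
  "separated A B Q \<longleftrightarrow>
     (\<exists>L. (\<forall>p\<in>set L. sep_pair A B p) \<and> (\<forall>y z. Q y z \<longleftrightarrow> (\<exists>p\<in>set L. sat_pair y z p)))"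

lemma separatedI:
  "(\<And>p. p \<in> set L \<Longrightarrow> sep_pair A B p) \<Longrightarrow> (\<And>y z. Q y z \<longleftrightarrow> (\<exists>p\<in>set L. sat_pair y z p)) \<Longrightarrow>
    separated A B Q"
  unfolding separated_def by (intro exI[of _ L]) simp

lemma separated_mono:
  assumes "separated A B Q" "A \<subseteq> A'" "B \<subseteq> B'" shows "separated A' B' Q"
proof -
  obtain L where L: "\<forall>p\<in>set L. sep_pair A B p" "\<And>y z. Q y z \<longleftrightarrow> (\<exists>p\<in>set L. sat_pair y z p)"
    using assms(1) unfolding separated_def by blast
  show ?thesis
  proof (rule separatedI[of L])
    fix p assume "p \<in> set L"
    then have "sep_pair A B p" using L(1) by blast
    then show "sep_pair A' B' p" using assms(2,3) unfolding sep_pair_def by blast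
  qed (rule L(2))
qed

lemma separated_r: "pure_rfm \<psi> \<Longrightarrow> freeR \<psi> \<subseteq> A \<Longrightarrow> separated A B (\<lambda>y z. psat y z \<psi>)"
  by (rule separatedI[of "[(\<psi>, Neg Falsum)]"]) (simp_all add: sep_pair_def sat_pair_def)

lemma separated_v: "pure_vfm \<theta> \<Longrightarrow> freeV \<theta> \<subseteq> B \<Longrightarrow> separated A B (\<lambda>y z. psat y z \<theta>)"
  by (rule separatedI[of "[(Neg Falsum, \<theta>)]"]) (simp_all add: sep_pair_def sat_pair_def)

lemma separated_or:
  assumes "separated A B P" "separated A B Q" shows "separated A B (\<lambda>y z. P y z \<or> Q y z)"
proof -
  obtain L where L: "\<forall>p\<in>set L. sep_pair A B p" "\<And>y z. P y z \<longleftrightarrow> (\<exists>p\<in>set L. sat_pair y z p)"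
    using assms(1) unfolding separated_def by blast
  obtain M where M: "\<forall>p\<in>set M. sep_pair A B p" "\<And>y z. Q y z \<longleftrightarrow> (\<exists>p\<in>set M. sat_pair y z p)"
    using assms(2) unfolding separated_def by blast
  show ?thesis
    by (rule separatedI[of "L @ M"]) (use L(1) M(1) in \<open>auto simp: L(2) M(2)\<close>)
qed

lemma separated_and:
  assumes "separated A B P" "separated A B Q" shows "separated A B (\<lambda>y z. P y z \<and> Q y z)"
proof -
  obtain L where L: "\<forall>p\<in>set L. sep_pair A B p" "\<And>y z. P y z \<longleftrightarrow> (\<exists>p\<in>set L. sat_pair y z p)"
    using assms(1) unfolding separated_def by blast
  obtain M where M: "\<forall>p\<in>set M. sep_pair A B p" "\<And>y z. Q y z \<longleftrightarrow> (\<exists>p\<in>set M. sat_pair y z p)"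
    using assms(2) unfolding separated_def by blast
  define a where "a = (\<lambda>(p, q). (And (fst p) (fst q), And (snd p) (snd q)))"
  have 1: "sep_pair A B (a (p, q))" if "sep_pair A B p" "sep_pair A B q" for p q
    using that by (simp add: a_def sep_pair_def)
  have 2: "sat_pair y z (a (p, q)) \<longleftrightarrow> sat_pair y z p \<and> sat_pair y z q" for y z p q
    by (auto simp: a_def sat_pair_def)
  show ?thesis
  proof (rule separatedI[of "map a (List.product L M)"])
    show "sep_pair A B p" if "p \<in> set (map a (List.product L M))" for p
      using that L(1) M(1) 1 by auto
    show "P y z \<and> Q y z \<longleftrightarrow> (\<exists>p\<in>set (map a (List.product L M)). sat_pair y z p)" for y z
      unfolding L(2) M(2) by (auto simp: 2)
  qed
qed

text \<open>The negation of a disjunction is a conjunction of disjunctions \<open>\<not> \<psi> \<or> \<not> \<theta>\<close>, which are separated.\<close>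

lemma separated_not:
  assumes "separated A B P" shows "separated A B (\<lambda>y z. \<not> P y z)"
proof -
  obtain L where L: "\<forall>p\<in>set L. sep_pair A B p" "\<And>y z. P y z \<longleftrightarrow> (\<exists>p\<in>set L. sat_pair y z p)"
    using assms(1) unfolding separated_def by blast
  have "separated A B (\<lambda>y z. \<not> (\<exists>p\<in>set L. sat_pair y z p))"
    using L(1)
  proof (induction L)
    case Nil
    have "separated A B (\<lambda>y z. psat y z (Neg Falsum))" by (rule separated_r) simp_all
    then show ?case by simp
  next
    case (Cons p L)
    have "separated A B (\<lambda>y z. psat y z (Neg (fst p)))" "separated A B (\<lambda>y z. psat y z (Neg (snd p)))"
      using Cons.prems by (intro separated_r separated_v; simp add: sep_pair_def)+
    moreover have "separated A B (\<lambda>y z. \<not> (\<exists>p\<in>set L. sat_pair y z p))" using Cons by simp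
    ultimately have "separated A B (\<lambda>y z. (psat y z (Neg (fst p)) \<or> psat y z (Neg (snd p))) \<and>
        \<not> (\<exists>p\<in>set L. sat_pair y z p))"
      by (intro separated_and separated_or)
    then show ?case by (simp add: sat_pair_def)
  qed
  then show ?thesis by (simp only: L(2))
qed

text \<open>The quantifier distributes over the disjunction and does not affect the value group formula.\<close>

lemma separated_exR:
  assumes "separated A B Q" shows "separated (A - {i}) B (\<lambda>y z. \<exists>a. Q (y(i := a)) z)"
proof -
  obtain L where L: "\<forall>p\<in>set L. sep_pair A B p" "\<And>y z. Q y z \<longleftrightarrow> (\<exists>p\<in>set L. sat_pair y z p)"
    using assms(1) unfolding separated_def by blast
  show ?thesis
  proof (rule separatedI[of "map (\<lambda>p. (ExR i (fst p), snd p)) L"])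
    show "sep_pair (A - {i}) B p" if "p \<in> set (map (\<lambda>p. (ExR i (fst p), snd p)) L)" for p
    proof -
      from that obtain q where "q \<in> set L" "p = (ExR i (fst q), snd q)" by auto
      moreover then have "sep_pair A B q" using L(1) by blast
      ultimately show ?thesis by (auto simp: sep_pair_def)
    qed
    fix y z
    have "(\<exists>a. sat_pair (y(i := a)) z p) \<longleftrightarrow> sat_pair y z (ExR i (fst p), snd p)" if "p \<in> set L" for p
      using that L(1) psat_pure_vfm[of "snd p" _ z y] by (auto simp: sat_pair_def sep_pair_def)
    then show "(\<exists>a. Q (y(i := a)) z) \<longleftrightarrow> (\<exists>p\<in>set (map (\<lambda>p. (ExR i (fst p), snd p)) L). sat_pair y z p)"
      unfolding L(2) by (simp del: split_paired_Ex split_paired_Bex_Sigma) blast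
  qed
qed

lemma separated_exV:
  assumes "separated A B Q" shows "separated A (B - {i}) (\<lambda>y z. \<exists>a. Q y (z(i := a)))"
proof -
  obtain L where L: "\<forall>p\<in>set L. sep_pair A B p" "\<And>y z. Q y z \<longleftrightarrow> (\<exists>p\<in>set L. sat_pair y z p)"
    using assms(1) unfolding separated_def by blast
  show ?thesis
  proof (rule separatedI[of "map (\<lambda>p. (fst p, ExV i (snd p))) L"])
    show "sep_pair A (B - {i}) p" if "p \<in> set (map (\<lambda>p. (fst p, ExV i (snd p))) L)" for p
    proof -
      from that obtain q where "q \<in> set L" "p = (fst q, ExV i (snd q))" by auto
      moreover then have "sep_pair A B q" using L(1) by blast
      ultimately show ?thesis by (auto simp: sep_pair_def)
    qed
    fix y z
    have "(\<exists>a. sat_pair y (z(i := a)) p) \<longleftrightarrow> sat_pair y z (fst p, ExV i (snd p))" if "p \<in> set L" for p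
      using that L(1) psat_pure_rfm[of "fst p" y _ z] by (auto simp: sat_pair_def sep_pair_def)
    then show "(\<exists>a. Q y (z(i := a))) \<longleftrightarrow> (\<exists>p\<in>set (map (\<lambda>p. (fst p, ExV i (snd p))) L). sat_pair y z p)"
      unfolding L(2) by (simp del: split_paired_Ex split_paired_Bex_Sigma) blast
  qed
qed

lemma separated_pure: "pure_fm \<phi> \<Longrightarrow> separated (freeR \<phi>) (freeV \<phi>) (\<lambda>y z. psat y z \<phi>)"
proof (induction \<phi>)
  case (Neg \<phi>)
  then show ?case by (simp add: separated_not)
next
  case (And \<phi> \<psi>)
  then have "separated (freeR (And \<phi> \<psi>)) (freeV (And \<phi> \<psi>)) (\<lambda>y z. psat y z \<phi>)"
    "separated (freeR (And \<phi> \<psi>)) (freeV (And \<phi> \<psi>)) (\<lambda>y z. psat y z \<psi>)"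
    by (auto elim: separated_mono)
  then show ?case unfolding sat.simps by (rule separated_and)
next
  case (Or \<phi> \<psi>)
  then have "separated (freeR (Or \<phi> \<psi>)) (freeV (Or \<phi> \<psi>)) (\<lambda>y z. psat y z \<phi>)"
    "separated (freeR (Or \<phi> \<psi>)) (freeV (Or \<phi> \<psi>)) (\<lambda>y z. psat y z \<psi>)"
    by (auto elim: separated_mono)
  then show ?case unfolding sat.simps by (rule separated_or)
next
  case (ExR i \<phi>)
  then show ?case using separated_exR by simp
next
  case (ExV i \<phi>)
  then show ?case using separated_exV by simp
next
  case Falsum
  then show ?case by (intro separated_r) simp_all
next
  case (EqR s t)
  then show ?case by (intro separated_r) simp_all
next
  case (LessR s t)
  then show ?case by (intro separated_r) simp_all
next
  case (EqV s t)
  then show ?case by (intro separated_v) simp_all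
next
  case (LessV s t)
  then show ?case by (intro separated_v) simp_all
qed simp_all

section \<open>Special formulas\<close>

lemma sat_subst_r:
  "pure_rfm \<psi> \<Longrightarrow> \<forall>i. \<sigma> i = RVar i \<or> (\<exists>q. \<sigma> i = Ac q) \<Longrightarrow>
    sat K x y z (fm_subst_r \<sigma> \<psi>) \<longleftrightarrow> psat (\<lambda>i. eval_r K x y (\<sigma> i)) z' \<psi>"
proof (induction \<psi> arbitrary: \<sigma> y)
  case (ExR i \<psi>)
  have "sat K x (y(i := a)) z (fm_subst_r (\<sigma>(i := RVar i)) \<psi>) \<longleftrightarrow>
      psat ((\<lambda>i. eval_r K x y (\<sigma> i))(i := a)) z' \<psi>" for a
  proof -
    have upd: "(\<lambda>j. eval_r K x (y(i := a)) ((\<sigma>(i := RVar i)) j)) = (\<lambda>i. eval_r K x y (\<sigma> i))(i := a)"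
    proof
      fix j
      show "eval_r K x (y(i := a)) ((\<sigma>(i := RVar i)) j) = ((\<lambda>i. eval_r K x y (\<sigma> i))(i := a)) j"
        using ExR.prems(2)[rule_format, of j] by auto
    qed
    have "pure_rfm \<psi>" using ExR.prems(1) by simp
    moreover have "\<forall>j. (\<sigma>(i := RVar i)) j = RVar j \<or> (\<exists>q. (\<sigma>(i := RVar i)) j = Ac q)"
      using ExR.prems(2) by simp
    ultimately show ?thesis using ExR.IH[of "\<sigma>(i := RVar i)" "y(i := a)"] unfolding upd by blast
  qed
  then show ?case by simp
qed (simp_all add: eval_rterm_subst[where x' = "\<lambda>_. 0"])

lemma sat_subst_v:
  "pure_vfm \<psi> \<Longrightarrow> \<forall>i. \<sigma> i = VVar i \<or> (\<exists>q. \<sigma> i = Val q) \<Longrightarrow>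
    sat K x y z (fm_subst_v \<sigma> \<psi>) \<longleftrightarrow> psat y' (\<lambda>i. eval_v K x z (\<sigma> i)) \<psi>"
proof (induction \<psi> arbitrary: \<sigma> z)
  case (ExV i \<psi>)
  have "sat K x y (z(i := a)) (fm_subst_v (\<sigma>(i := VVar i)) \<psi>) \<longleftrightarrow>
      psat y' ((\<lambda>i. eval_v K x z (\<sigma> i))(i := a)) \<psi>" for a
  proof -
    have upd: "(\<lambda>j. eval_v K x (z(i := a)) ((\<sigma>(i := VVar i)) j)) = (\<lambda>i. eval_v K x z (\<sigma> i))(i := a)"
    proof
      fix j
      show "eval_v K x (z(i := a)) ((\<sigma>(i := VVar i)) j) = ((\<lambda>i. eval_v K x z (\<sigma> i))(i := a)) j"
        using ExV.prems(2)[rule_format, of j] by auto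
    qed
    have "pure_vfm \<psi>" using ExV.prems(1) by simp
    moreover have "\<forall>j. (\<sigma>(i := VVar i)) j = VVar j \<or> (\<exists>q. (\<sigma>(i := VVar i)) j = Val q)"
      using ExV.prems(2) by simp
    ultimately show ?thesis using ExV.IH[of "\<sigma>(i := VVar i)" "z(i := a)"] unfolding upd by blast
  qed
  then show ?case by simp
qed (simp_all add: eval_vterm_subst[where x' = "\<lambda>_. 0"])

text \<open>The variables \<open>M + i\<close> stand for the terms \<open>Ac (q i)\<close> or \<open>Val (q i)\<close>; a large \<open>M\<close> keeps them apart from the
  given variables.\<close>

lemma ex_numbering:
  fixes M :: nat and q :: "nat \<Rightarrow> fterm"
  assumes "finite J"
  shows "\<exists>us qs. distinct us \<and> length qs = length us \<and> set us = (\<lambda>i. M + i) ` J \<and>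
    (\<forall>i\<in>J. map_of (zip us qs) (M + i) = Some (q i)) \<and> set qs = q ` J"
proof -
  have "map_of (zip (map (\<lambda>i. M + i) xs) (map q xs)) (M + i) = Some (q i)" if "i \<in> set xs" for xs i
    using that by (induction xs) auto
  then show ?thesis using assms
    by (intro exI[of _ "map (\<lambda>i. M + i) (sorted_list_of_set J)"] exI[of _ "map q (sorted_list_of_set J)"])
      (simp add: distinct_map)
qed

text \<open>
  The functions used by a definable predicate are coordinates or leading terms of polynomials. First
  rename the variables of the formula such that a coordinate gets its own variable and a polynomial a
  fresh one, then separate the formula. Substituting \<open>Ac q\<close> and \<open>Val q\<close> for the fresh variables gives
  special formulas.
\<close>

lemma special_formulas:
  assumes P: "definable (rbase_on (set xs) (set ys)) (gbase_on (set xs) (set zs))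
    (\<lambda>e. P (fst e) (fst (snd e)) (snd (snd e)))"
  shows "\<exists>L. (\<forall>(\<psi>, \<theta>)\<in>set L. special_rfm xs ys \<psi> \<and> special_vfm xs zs \<theta>) \<and>
    (\<forall>x y z. P x y z \<longleftrightarrow> (\<exists>(\<psi>, \<theta>)\<in>set L. sat K x y z \<psi> \<and> sat K x y z \<theta>))"
proof -
  obtain \<phi> b c where \<phi>: "pure_fm \<phi>" "\<And>i. i \<in> freeR \<phi> \<Longrightarrow> b i \<in> rbase_on (set xs) (set ys)"
    "\<And>i. i \<in> freeV \<phi> \<Longrightarrow> c i \<in> gbase_on (set xs) (set zs)"
    "\<And>e. P (fst e) (fst (snd e)) (snd (snd e)) \<longleftrightarrow> psat (\<lambda>i. b i e) (\<lambda>i. c i e) \<phi>"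
    using P unfolding definable_def by blast
  define M where "M = Suc (Max (insert 0 (set ys \<union> set zs)))"
  have M: "k < M" if "k \<in> set ys \<union> set zs" for k
    using that by (auto simp: M_def less_Suc_eq_le intro!: Max_ge)
  define JR where "JR = {i \<in> freeR \<phi>. \<not> (\<exists>j\<in>set ys. b i = (\<lambda>e. fst (snd e) j))}"
  define JV where "JV = {i \<in> freeV \<phi>. \<not> (\<exists>j\<in>set zs. c i = (\<lambda>e. snd (snd e) j))}"
  have fin: "finite JR" "finite JV" by (simp_all add: JR_def JV_def)
  have "\<forall>i. \<exists>j. i \<in> freeR \<phi> - JR \<longrightarrow> j \<in> set ys \<and> b i = (\<lambda>e. fst (snd e) j)" by (auto simp: JR_def)
  then obtain r where r: "\<And>i. i \<in> freeR \<phi> - JR \<Longrightarrow> r i \<in> set ys \<and> b i = (\<lambda>e. fst (snd e) (r i))" by metis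
  have "\<forall>i. \<exists>j. i \<in> freeV \<phi> - JV \<longrightarrow> j \<in> set zs \<and> c i = (\<lambda>e. snd (snd e) j)" by (auto simp: JV_def)
  then obtain w where w: "\<And>i. i \<in> freeV \<phi> - JV \<Longrightarrow> w i \<in> set zs \<and> c i = (\<lambda>e. snd (snd e) (w i))" by metis
  have "\<exists>q. fvars q \<subseteq> set xs \<and> b i = (\<lambda>e. ac (eval_f (fst e) q))" if "i \<in> JR" for i
    using that \<phi>(2)[of i] unfolding JR_def rbase_def residue_vars_def field_funs_def by blast
  then obtain q where q: "\<And>i. i \<in> JR \<Longrightarrow> fvars (q i) \<subseteq> set xs \<and> b i = (\<lambda>e. ac (eval_f (fst e) (q i)))" by metis
  have "\<exists>q. fvars q \<subseteq> set xs \<and> c i = (\<lambda>e. val0 (eval_f (fst e) q))" if "i \<in> JV" for i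
    using that \<phi>(3)[of i] unfolding JV_def gbase_def value_vars_def field_funs_def by blast
  then obtain p where p: "\<And>i. i \<in> JV \<Longrightarrow> fvars (p i) \<subseteq> set xs \<and> c i = (\<lambda>e. val0 (eval_f (fst e) (p i)))" by metis
  define \<sigma> where "\<sigma> i = (if i \<in> JR then M + i else r i)" for i
  define \<tau> where "\<tau> i = (if i \<in> JV then M + i else w i)" for i
  obtain \<phi>' where \<phi>': "pure_fm \<phi>'" "freeR \<phi>' \<subseteq> (\<Union>i\<in>freeR \<phi>. {\<sigma> i})" "freeV \<phi>' \<subseteq> (\<Union>i\<in>freeV \<phi>. {\<tau> i})"
    "\<And>y z. psat y z \<phi>' \<longleftrightarrow> psat (\<lambda>i. y (\<sigma> i)) (\<lambda>i. z (\<tau> i)) \<phi>"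
    using subst_fm[OF \<phi>(1), of "\<lambda>i. RVar (\<sigma> i)" "\<lambda>i. VVar (\<tau> i)"] by auto
  obtain us qs where U: "distinct us" "length qs = length us" "set us = (\<lambda>i. M + i) ` JR"
    "\<forall>i\<in>JR. map_of (zip us qs) (M + i) = Some (q i)" "set qs = q ` JR"
    using ex_numbering[OF fin(1), of M q] by blast
  obtain vs ps where V: "distinct vs" "length ps = length vs" "set vs = (\<lambda>i. M + i) ` JV"
    "\<forall>i\<in>JV. map_of (zip vs ps) (M + i) = Some (p i)" "set ps = p ` JV"
    using ex_numbering[OF fin(2), of M p] by blast
  have disj: "set us \<inter> set ys = {}" "set vs \<inter> set zs = {}"
    using M[of "M + _"] unfolding U(3) V(3) by auto
  have "\<sigma> i \<in> set us \<union> set ys" if "i \<in> freeR \<phi>" for i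
    unfolding U(3) using r[of i] that by (cases "i \<in> JR") (auto simp: \<sigma>_def)
  then have freeR: "freeR \<phi>' \<subseteq> set us \<union> set ys" using \<phi>'(2) by blast
  have "\<tau> i \<in> set vs \<union> set zs" if "i \<in> freeV \<phi>" for i
    unfolding V(3) using w[of i] that by (cases "i \<in> JV") (auto simp: \<tau>_def)
  then have freeV: "freeV \<phi>' \<subseteq> set vs \<union> set zs" using \<phi>'(3) by blast
  have qs: "\<forall>q\<in>set qs. fvars q \<subseteq> set xs" and ps: "\<forall>q\<in>set ps. fvars q \<subseteq> set xs"
    using q p by (auto simp: U(5) V(5))
  have b: "b i (x, y, z) = eval_r K x y (ac_subst us qs (\<sigma> i))" if i: "i \<in> freeR \<phi>" for i x y z
  proof (cases "i \<in> JR")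
    case True
    then show ?thesis using q[OF True] bspec[OF U(4) True] by (simp add: \<sigma>_def ac_subst_def)
  next
    case False
    then have ri: "r i \<in> set ys" "b i = (\<lambda>e. fst (snd e) (r i))" using r[of i] i by auto
    then have "r i \<notin> set us" using disj by auto
    then have "map_of (zip us qs) (r i) = None" using U(2) by (simp add: map_of_zip_is_None)
    then show ?thesis using False ri by (simp add: \<sigma>_def ac_subst_def)
  qed
  have c: "c i (x, y, z) = eval_v K x z (val_subst vs ps (\<tau> i))" if i: "i \<in> freeV \<phi>" for i x y z
  proof (cases "i \<in> JV")
    case True
    then show ?thesis using p[OF True] bspec[OF V(4) True] by (simp add: \<tau>_def val_subst_def)
  next
    case False
    then have wi: "w i \<in> set zs" "c i = (\<lambda>e. snd (snd e) (w i))" using w[of i] i by auto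
    then have "w i \<notin> set vs" using disj by auto
    then have "map_of (zip vs ps) (w i) = None" using V(2) by (simp add: map_of_zip_is_None)
    then show ?thesis using False wi by (simp add: \<tau>_def val_subst_def)
  qed
  have P': "P x y z \<longleftrightarrow>
      psat (\<lambda>i. eval_r K x y (ac_subst us qs i)) (\<lambda>i. eval_v K x z (val_subst vs ps i)) \<phi>'" for x y z
  proof -
    have "P x y z \<longleftrightarrow> psat (\<lambda>i. b i (x, y, z)) (\<lambda>i. c i (x, y, z)) \<phi>"
      using \<phi>(4)[of "(x, y, z)"] by simp
    also have "\<dots> \<longleftrightarrow> psat (\<lambda>i. eval_r K x y (ac_subst us qs (\<sigma> i))) (\<lambda>i. eval_v K x z (val_subst vs ps (\<tau> i))) \<phi>"
      by (rule sat_cong[OF \<phi>(1)]) (simp_all add: b c)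
    finally show ?thesis unfolding \<phi>'(4) .
  qed
  obtain L where L: "\<forall>p\<in>set L. sep_pair (freeR \<phi>') (freeV \<phi>') p"
    "\<And>y z. psat y z \<phi>' \<longleftrightarrow> (\<exists>p\<in>set L. sat_pair y z p)"
    using separated_pure[OF \<phi>'(1)] unfolding separated_def by blast
  let ?r = "fm_subst_r (ac_subst us qs)" and ?v = "fm_subst_v (val_subst vs ps)"
  have ss: "\<forall>i. ac_subst us qs i = RVar i \<or> (\<exists>q. ac_subst us qs i = Ac q)"
    "\<forall>i. val_subst vs ps i = VVar i \<or> (\<exists>q. val_subst vs ps i = Val q)"
    using ac_subst_cases[OF U(2)] val_subst_cases[OF V(2)] by blast+
  show ?thesis
  proof (intro exI[of _ "map (\<lambda>p. (?r (fst p), ?v (snd p))) L"] conjI allI)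
    have "special_rfm xs ys (?r (fst p)) \<and> special_vfm xs zs (?v (snd p))" if "p \<in> set L" for p
    proof
      have "sep_pair (freeR \<phi>') (freeV \<phi>') p" using L(1) that by blast
      then have *: "pure_rfm (fst p)" "freeR (fst p) \<subseteq> set us \<union> set ys" "pure_vfm (snd p)"
        "freeV (snd p) \<subseteq> set vs \<union> set zs"
        using freeR freeV by (auto simp: sep_pair_def)
      show "special_rfm xs ys (?r (fst p))" unfolding special_rfm_def
        by (intro exI[of _ "fst p"] exI[of _ us] exI[of _ qs] conjI * U(1,2) disj(1) qs refl)
      show "special_vfm xs zs (?v (snd p))" unfolding special_vfm_def
        by (intro exI[of _ "snd p"] exI[of _ vs] exI[of _ ps] conjI * V(1,2) disj(2) ps refl)
    qed
    then show "\<forall>(\<psi>, \<theta>)\<in>set (map (\<lambda>p. (?r (fst p), ?v (snd p))) L). special_rfm xs ys \<psi> \<and> special_vfm xs zs \<theta>"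
      by simp
    fix x y z
    let ?y = "\<lambda>i. eval_r K x y (ac_subst us qs i)" and ?z = "\<lambda>i. eval_v K x z (val_subst vs ps i)"
    have "sat_pair ?y ?z p \<longleftrightarrow> sat K x y z (?r (fst p)) \<and> sat K x y z (?v (snd p))" if "p \<in> set L" for p
    proof -
      have "pure_rfm (fst p)" "pure_vfm (snd p)" using L(1) that by (auto simp: sep_pair_def)
      then show ?thesis unfolding sat_pair_def
        using sat_subst_r[of "fst p" _ x y z ?z] sat_subst_v[of "snd p" _ x y z ?y] ss by blast
    qed
    then show "P x y z \<longleftrightarrow> (\<exists>(\<psi>, \<theta>)\<in>set (map (\<lambda>p. (?r (fst p), ?v (snd p))) L). sat K x y z \<psi> \<and> sat K x y z \<theta>)"
      unfolding P' L(2) by simp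
  qed
qed

lemma sat_Disj: "sat K x y z (Disj \<phi>s) \<longleftrightarrow> (\<exists>\<phi>\<in>set \<phi>s. sat K x y z \<phi>)"
  unfolding Disj_def by (induction \<phi>s) auto

theorem special_normal_form:
  assumes "freeF \<phi> \<subseteq> set xs" "freeR \<phi> \<subseteq> set ys" "freeV \<phi> \<subseteq> set zs"
  shows "\<exists>(N::nat) \<psi> \<theta>. (\<forall>i<N. special_rfm xs ys (\<psi> i)) \<and> (\<forall>i<N. special_vfm xs zs (\<theta> i)) \<and>
    equivalent_over K \<phi> (Disj (map (\<lambda>i. And (\<psi> i) (\<theta> i)) [0..<N]))"
proof -
  obtain L where L: "\<forall>(\<psi>, \<theta>)\<in>set L. special_rfm xs ys \<psi> \<and> special_vfm xs zs \<theta>"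
    "\<And>x y z. sat K x y z \<phi> \<longleftrightarrow> (\<exists>(\<psi>, \<theta>)\<in>set L. sat K x y z \<psi> \<and> sat K x y z \<theta>)"
    using special_formulas[OF definable_sat[OF assms]] by blast
  show ?thesis
  proof (intro exI conjI allI impI)
    fix i assume "i < length L"
    then have "L ! i \<in> set L" by simp
    then show "special_rfm xs ys (fst (L ! i))" "special_vfm xs zs (snd (L ! i))"
      using L(1) by (auto simp: case_prod_unfold)
  next
    show "equivalent_over K \<phi> (Disj (map (\<lambda>i. And (fst (L ! i)) (snd (L ! i))) [0..<length L]))"
      unfolding equivalent_over_def sat_Disj L(2) case_prod_unfold set_conv_nth by fastforce
  qed
qed

end

theorem theorem3p3:
  fixes v :: "'k::linordered_field \<Rightarrow> 'g::linordered_ab_group_add"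
    and res ac :: "'k \<Rightarrow> 'r::linordered_field"
    and K :: "('k, 'r, 'g) ovf_ac"
  assumes "henselian_valuation v"
    and "residue_map v res"
    and "induced_residue_order v res"
    and "angular_component v res ac"
    and "compatible_ac ac"
    and "K = ovf_ac_structure v res ac"
  shows "eliminates_field_quantifiers (Th K) \<and>
    (\<forall>xs ys zs \<phi>. distinct xs \<longrightarrow> distinct ys \<longrightarrow> distinct zs \<longrightarrow>
       freeF \<phi> \<subseteq> set xs \<longrightarrow> freeR \<phi> \<subseteq> set ys \<longrightarrow> freeV \<phi> \<subseteq> set zs \<longrightarrow>
       (\<exists>(N::nat) \<psi> \<theta>.
          (\<forall>i<N. special_rfm xs ys (\<psi> i)) \<and> (\<forall>i<N. special_vfm xs zs (\<theta> i)) \<and>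
          equivalent_over K \<phi> (Disj (map (\<lambda>i. And (\<psi> i) (\<theta> i)) [0..<N]))))"
proof -
  interpret henselian_ovf_ac_structure v res ac K
    using assms by unfold_locales
  have "eliminates_field_quantifiers (Th K)"
    unfolding eliminates_field_quantifiers_def
  proof
    fix \<phi>
    obtain xs ys zs where vars: "set xs = freeF \<phi>" "set ys = freeR \<phi>" "set zs = freeV \<phi>"
      using finite_list[OF finite_freeF[of \<phi>]] finite_list[OF finite_freeR[of \<phi>]]
        finite_list[OF finite_freeV[of \<phi>]] by blast
    have "freeF \<phi> \<subseteq> set xs" "freeR \<phi> \<subseteq> set ys" "freeV \<phi> \<subseteq> set zs" using vars by simp_all
    from special_normal_form[OF this] obtain N \<psi> \<theta> where
      \<psi>: "\<And>i. i < N \<Longrightarrow> special_rfm xs ys (\<psi> i)" and \<theta>: "\<And>i. i < N \<Longrightarrow> special_vfm xs zs (\<theta> i)"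
      and eq: "equivalent_over K \<phi> (Disj (map (\<lambda>i. And (\<psi> i) (\<theta> i)) [0..<N]))"
      by (elim exE conjE) blast
    define \<chi> where "\<chi> = Disj (map (\<lambda>i. And (\<psi> i) (\<theta> i)) [0..<N])"
    note S = special_rfm_syntax[OF \<psi>] special_vfm_syntax[OF \<theta>]
    have qf: "field_quantifier_free \<chi>"
      unfolding \<chi>_def using S(1,5) by (intro Disj_syntax(1)) auto
    have free: "freeF \<chi> \<subseteq> freeF \<phi>" "freeR \<chi> \<subseteq> freeR \<phi>" "freeV \<chi> \<subseteq> freeV \<phi>"
      unfolding \<chi>_def Disj_syntax(2-4) vars[symmetric] using S(2-4,6-8) by (simp_all add: UN_subset_iff)
    have "sat K x y z (Iff \<phi> \<chi>)" for x y z
      using eq by (auto simp: equivalent_over_def Iff_def \<chi>_def)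
    then have "sat K x y z (all_closure xs ys zs (Iff \<phi> \<chi>))" for x y z
      unfolding all_closure_def by (intro sat_foldr_All)
    moreover have "sentence (all_closure xs ys zs (Iff \<phi> \<chi>))"
      unfolding sentence_def all_closure_def free_foldr_All using free vars by (auto simp: Iff_def)
    ultimately have "all_closure xs ys zs (Iff \<phi> \<chi>) \<in> Th K" by (simp add: Th_def)
    then show "\<exists>\<chi>. field_quantifier_free \<chi> \<and>
        freeF \<chi> \<subseteq> freeF \<phi> \<and> freeR \<chi> \<subseteq> freeR \<phi> \<and> freeV \<chi> \<subseteq> freeV \<phi> \<and>
        (\<exists>xs ys zs. set xs = freeF \<phi> \<and> set ys = freeR \<phi> \<and> set zs = freeV \<phi> \<and>
           all_closure xs ys zs (Iff \<phi> \<chi>) \<in> Th K)"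
      using qf free vars by (intro exI[of _ \<chi>] exI[of _ xs] exI[of _ ys] exI[of _ zs] conjI)
  qed
  then show ?thesis by (intro conjI allI impI special_normal_form)
qed

end
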